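(* Let $k$ be a field, let $n\ge 1$, and let $K_n := k[x_1^{\pm 1},\dots,x_n^{\pm 1}]$ be the Laurent polynomial algebra over $k$. Let $\delta$ be a $k$-derivation of $K_n$ of the form $$\delta=\sum_{i=1}^n g_i\frac{\partial}{\partial x_i},\qquad g_i\in kx_i+k \ \ (1\le i\le n),$$ and suppose that the Ore extension $R_{n+1}:=K_n[x,\delta]$ is a simple ring. Let $M$ be a simple right $R_{n+1}$-module. Then the Gelfand–Kirillov dimension of $M$ (over $k$, as an $R_{n+1}$-module) belongs to $\{1,n\}$.
   Context: All modules are right modules. $K_n[x,\delta]$ is the Ore extension (differential operator ring): it is free as a left $K_n$-module on $1,x,x^2,\dots$, with multiplication determined by $xa=ax+\delta(a)$ for $a\in K_n$. Gelfand–Kirillov dimension: let $A$ be a finitely generated (affine) $k$-algebra with finite generating set $\{a_1,\dots,a_s\}$ containing $1$. Put $A_0=k$, $A_1=\sum_{j} k a_j$, $A_m=A_1^m$. For a finitely generated right $A$-module $M$ with finite-dimensional generating subspace $M_0$, set $M_m=M_0A_m$. The GK dimension of $M$ is $\limsup_{m\to\infty}\log_m(\dim_k M_m)$; it does not depend on the choice of generating set or of $M_0$. *)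

theory Defs
  imports
    "HOL-Algebra.Generated_Groups"
    "HOL-Algebra.Generated_Rings"
    "HOL-Analysis.Finite_Cartesian_Product"
    "HOL-Computational_Algebra.Polynomial"
    "HOL-Library.Poly_Mapping"
    "HOL-Library.Liminf_Limsup"
    "HOL-Library.Extended_Real"
begin

section \<open>Laurent polynomials and their partial derivatives\<close>

text \<open>The group algebra of \<open>\<int>\<^sup>n\<close>, where \<open>n = CARD('n) \<ge> 1\<close>: the exponent vector \<open>\<alpha>\<close> stands
  for the monomial \<open>\<Prod>i. x\<^sub>i powi (\<alpha> $ i)\<close>, and multiplication is convolution.\<close>

type_synonym ('k, 'n) laurent = "(int, 'n) vec \<Rightarrow>\<^sub>0 'k"

definition lconst :: "'k::field \<Rightarrow> ('k, 'n::finite) laurent" where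
  "lconst c = Poly_Mapping.single 0 c"

definition lvar :: "'n::finite \<Rightarrow> ('k::field, 'n) laurent" where
  "lvar i = Poly_Mapping.single (axis i 1) 1"

definition lpartial :: "'n::finite \<Rightarrow> ('k::field, 'n) laurent \<Rightarrow> ('k, 'n) laurent" where
  "lpartial i f = (\<Sum>\<alpha>\<in>Poly_Mapping.keys f.
     Poly_Mapping.single (\<alpha> - axis i 1) (of_int (\<alpha> $ i) * Poly_Mapping.lookup f \<alpha>))"

section \<open>Ore extensions\<close>

text \<open>An element \<open>\<Sum>i. a\<^sub>i x\<^sup>i\<close> of \<open>K[x, \<delta>]\<close>, with coefficients on the left, is represented by
  the element of \<^typ>\<open>'a poly\<close> with the same coefficients.  By \<open>x a = a x + \<delta>(a)\<close>, left
  multiplication by \<open>x\<close> sends \<open>\<Sum>j. b\<^sub>j x\<^sup>j\<close> to \<open>\<Sum>j. b\<^sub>j x\<^sup>j\<^sup>+\<^sup>1 + \<Sum>j. \<delta>(b\<^sub>j) x\<^sup>j\<close>.\<close>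

definition ore_lmult_x :: "('a::comm_ring_1 \<Rightarrow> 'a) \<Rightarrow> 'a poly \<Rightarrow> 'a poly" where
  "ore_lmult_x \<delta> q = pCons 0 q + map_poly \<delta> q"

definition ore_mult :: "('a::comm_ring_1 \<Rightarrow> 'a) \<Rightarrow> 'a poly \<Rightarrow> 'a poly \<Rightarrow> 'a poly" where
  "ore_mult \<delta> p q = (\<Sum>i\<le>degree p. Polynomial.smult (poly.coeff p i) ((ore_lmult_x \<delta> ^^ i) q))"

definition ore_ext :: "('a::comm_ring_1 \<Rightarrow> 'a) \<Rightarrow> 'a poly ring" where
  "ore_ext \<delta> = \<lparr>carrier = UNIV, monoid.mult = ore_mult \<delta>, one = 1, zero = 0, add = (+)\<rparr>"

section \<open>Simple rings and simple right modules\<close>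

definition simple_ring :: "('r, 'z) ring_scheme \<Rightarrow> bool" where
  "simple_ring R \<longleftrightarrow> ring R \<and> \<one>\<^bsub>R\<^esub> \<noteq> \<zero>\<^bsub>R\<^esub> \<and> (\<forall>I. ideal I R \<longrightarrow> I = {\<zero>\<^bsub>R\<^esub>} \<or> I = carrier R)"

text \<open>The HOL-Algebra locale \<open>module\<close> is restricted to commutative rings.  Here the module is a
  whole type and \<open>act v r\<close> is \<open>v \<cdot> r\<close>.\<close>

locale right_module = ring R for R :: "('r, 'z) ring_scheme" (structure) +
  fixes act :: "'m::ab_group_add \<Rightarrow> 'r \<Rightarrow> 'm"
  assumes act_add_left: "r \<in> carrier R \<Longrightarrow> act (v + w) r = act v r + act w r"
    and act_add_right: "r \<in> carrier R \<Longrightarrow> s \<in> carrier R \<Longrightarrow> act v (r \<oplus> s) = act v r + act v s"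
    and act_mult: "r \<in> carrier R \<Longrightarrow> s \<in> carrier R \<Longrightarrow> act v (r \<otimes> s) = act (act v r) s"
    and act_one: "act v \<one> = v"

text \<open>Closure under negation follows from closure under the action of \<open>\<ominus> \<one>\<close>.\<close>

definition right_submodule ::
  "('r, 'z) ring_scheme \<Rightarrow> ('m::ab_group_add \<Rightarrow> 'r \<Rightarrow> 'm) \<Rightarrow> 'm set \<Rightarrow> bool" where
  "right_submodule R act N \<longleftrightarrow> 0 \<in> N \<and> (\<forall>v\<in>N. \<forall>w\<in>N. v + w \<in> N) \<and>
     (\<forall>v\<in>N. \<forall>r\<in>carrier R. act v r \<in> N)"

definition simple_right_module ::
  "('r, 'z) ring_scheme \<Rightarrow> ('m::ab_group_add \<Rightarrow> 'r \<Rightarrow> 'm) \<Rightarrow> bool" where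
  "simple_right_module R act \<longleftrightarrow> right_module R act \<and> (UNIV :: 'm set) \<noteq> {0} \<and>
     (\<forall>N. right_submodule R act N \<longrightarrow> N = {0} \<or> N = UNIV)"

section \<open>Gelfand--Kirillov dimension\<close>

text \<open>Throughout, the \<open>k\<close>-algebra structure of the ring \<open>A\<close> is given by the structure map
  \<open>\<phi>\<close> from \<open>k\<close> into the centre of \<open>A\<close>.\<close>

definition alg_span :: "('r, 'z) ring_scheme \<Rightarrow> ('k::field \<Rightarrow> 'r) \<Rightarrow> 'r set \<Rightarrow> 'r set" where
  "alg_span A \<phi> T = generate (add_monoid A) {\<phi> c \<otimes>\<^bsub>A\<^esub> t | c t. t \<in> T}"

text \<open>\<open>alg_filt A \<phi> S m\<close> is \<open>A\<^sub>m = A\<^sub>1\<^sup>m\<close> with \<open>A\<^sub>0 = k\<close> and \<open>A\<^sub>1 = alg_span A \<phi> S\<close>.\<close>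

primrec alg_filt ::
  "('r, 'z) ring_scheme \<Rightarrow> ('k::field \<Rightarrow> 'r) \<Rightarrow> 'r set \<Rightarrow> nat \<Rightarrow> 'r set" where
  "alg_filt A \<phi> S 0 = range \<phi>"
| "alg_filt A \<phi> S (Suc m) =
     alg_span A \<phi> {a \<otimes>\<^bsub>A\<^esub> b | a b. a \<in> alg_filt A \<phi> S m \<and> b \<in> alg_span A \<phi> S}"

definition alg_generating_set ::
  "('r, 'z) ring_scheme \<Rightarrow> ('k::field \<Rightarrow> 'r) \<Rightarrow> 'r set \<Rightarrow> bool" where
  "alg_generating_set A \<phi> S \<longleftrightarrow> finite S \<and> S \<subseteq> carrier A \<and> \<one>\<^bsub>A\<^esub> \<in> S \<and>
     generate_ring A (range \<phi> \<union> S) = carrier A"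

definition module_scale ::
  "('k::field \<Rightarrow> 'r) \<Rightarrow> ('m::ab_group_add \<Rightarrow> 'r \<Rightarrow> 'm) \<Rightarrow> 'k \<Rightarrow> 'm \<Rightarrow> 'm" where
  "module_scale \<phi> act c v = act v (\<phi> c)"

text \<open>\<open>M\<^sub>0 B\<close>, the \<open>k\<close>-span of all products.\<close>

definition module_prod ::
  "('k::field \<Rightarrow> 'r) \<Rightarrow> ('m::ab_group_add \<Rightarrow> 'r \<Rightarrow> 'm) \<Rightarrow> 'm set \<Rightarrow> 'r set \<Rightarrow> 'm set" where
  "module_prod \<phi> act M\<^sub>0 B =
     module.span (module_scale \<phi> act) {act v b | v b. v \<in> M\<^sub>0 \<and> b \<in> B}"

definition generating_subspace ::
  "('r, 'z) ring_scheme \<Rightarrow> ('k::field \<Rightarrow> 'r) \<Rightarrow> ('m::ab_group_add \<Rightarrow> 'r \<Rightarrow> 'm) \<Rightarrow> 'm set \<Rightarrow> bool" where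
  "generating_subspace A \<phi> act M\<^sub>0 \<longleftrightarrow>
     (\<exists>B. finite B \<and> M\<^sub>0 = module.span (module_scale \<phi> act) B) \<and>
     module_prod \<phi> act M\<^sub>0 (carrier A) = UNIV"

definition module_growth ::
  "('r, 'z) ring_scheme \<Rightarrow> ('k::field \<Rightarrow> 'r) \<Rightarrow> ('m::ab_group_add \<Rightarrow> 'r \<Rightarrow> 'm) \<Rightarrow>
     'r set \<Rightarrow> 'm set \<Rightarrow> ereal" where
  "module_growth A \<phi> act S M\<^sub>0 = limsup (\<lambda>m. ereal (log (real m)
     (real (vector_space.dim (module_scale \<phi> act) (module_prod \<phi> act M\<^sub>0 (alg_filt A \<phi> S m))))))"

text \<open>The first two conjuncts say that \<open>A\<close> is affine and the module finitely generated, so that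
  the third one is not vacuous.  Only meant for nonzero modules, since \<open>log\<close> is \<open>0\<close> at \<open>0\<close>.\<close>

definition has_GK_dim ::
  "('r, 'z) ring_scheme \<Rightarrow> ('k::field \<Rightarrow> 'r) \<Rightarrow> ('m::ab_group_add \<Rightarrow> 'r \<Rightarrow> 'm) \<Rightarrow> ereal \<Rightarrow> bool" where
  "has_GK_dim A \<phi> act d \<longleftrightarrow>
     (\<exists>S. alg_generating_set A \<phi> S) \<and> (\<exists>M\<^sub>0. generating_subspace A \<phi> act M\<^sub>0) \<and>
     (\<forall>S M\<^sub>0. alg_generating_set A \<phi> S \<and> generating_subspace A \<phi> act M\<^sub>0 \<longrightarrow>
        module_growth A \<phi> act S M\<^sub>0 = d)"

section \<open>Consistency of the definitions\<close>

subsection \<open>\<open>\<partial>/\<partial>x\<^sub>i\<close> is a derivation over the constants\<close>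

lemma lpartial_lookup:
  "Poly_Mapping.lookup (lpartial i f) \<beta> =
     of_int (\<beta> $ i + 1) * Poly_Mapping.lookup f (\<beta> + axis i 1)"
proof -
  have "Poly_Mapping.lookup (lpartial i f) \<beta> = (\<Sum>\<alpha>\<in>Poly_Mapping.keys f.
      if \<alpha> = \<beta> + axis i 1 then of_int (\<alpha> $ i) * Poly_Mapping.lookup f \<alpha> else 0)"
    unfolding lpartial_def lookup_sum
    by (rule sum.cong) (auto simp: lookup_single when_def algebra_simps)
  also have "\<dots> = of_int (\<beta> $ i + 1) * Poly_Mapping.lookup f (\<beta> + axis i 1)"
    by (simp add: sum.delta in_keys_iff)
  finally show ?thesis .
qed

lemma lpartial_add: "lpartial i (f + g) = lpartial i f + lpartial i g"
  by (rule poly_mapping_eqI) (simp add: lpartial_lookup lookup_add algebra_simps)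

lemma lpartial_single:
  "lpartial i (Poly_Mapping.single \<alpha> c) = Poly_Mapping.single (\<alpha> - axis i 1) (of_int (\<alpha> $ i) * c)"
  by (cases "c = 0") (simp_all add: lpartial_def)

lemma lpartial_lconst: "lpartial i (lconst c) = 0"
  by (simp add: lconst_def lpartial_single)

lemma lpartial_lvar: "lpartial i (lvar j) = (if i = j then 1 else 0)"
  by (auto simp: lvar_def lpartial_single axis_def)

lemma laurent_induct:
  fixes f :: "('k::field, 'n::finite) laurent"
  assumes "\<And>\<alpha> c. P (Poly_Mapping.single \<alpha> c)" "\<And>f g. P f \<Longrightarrow> P g \<Longrightarrow> P (f + g)"
  shows "P f"
proof -
  have f: "f = (\<Sum>\<alpha>\<in>Poly_Mapping.keys f. Poly_Mapping.single \<alpha> (Poly_Mapping.lookup f \<alpha>))"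
    by (rule poly_mapping_eqI)
      (simp add: lookup_sum lookup_single when_def sum.delta in_keys_iff)
  have "P (\<Sum>\<alpha>\<in>X. Poly_Mapping.single \<alpha> (Poly_Mapping.lookup f \<alpha>))" if "finite X" for X
    using that
  proof induction
    case empty
    show ?case using assms(1)[of 0 0] by simp
  qed (simp add: assms)
  from this[OF finite_keys, of f] f show ?thesis by metis
qed

lemma lpartial_mult: "lpartial i (f * g) = f * lpartial i g + lpartial i f * g"
proof (induction f rule: laurent_induct)
  case (1 \<alpha> c)
  show ?case
  proof (induction g rule: laurent_induct)
    case (1 \<beta> d)
    have "\<alpha> + \<beta> - axis i 1 = \<alpha> + (\<beta> - axis i 1)" "\<alpha> - axis i 1 + \<beta> = \<alpha> + (\<beta> - axis i 1)"
      by (simp_all add: algebra_simps)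
    then show ?case
      by (simp add: mult_single lpartial_single algebra_simps flip: single_add)
  next
    case (2 f g)
    then show ?case by (simp add: lpartial_add algebra_simps)
  qed
next
  case (2 f g)
  then show ?case by (simp add: lpartial_add algebra_simps)
qed

subsection \<open>\<open>K[x, \<delta>]\<close> is a ring if \<open>\<delta>\<close> is a derivation\<close>

locale derivation =
  fixes \<delta> :: "'a::comm_ring_1 \<Rightarrow> 'a"
  assumes add: "\<delta> (a + b) = \<delta> a + \<delta> b"
    and mult: "\<delta> (a * b) = a * \<delta> b + \<delta> a * b"
begin

lemma zero [simp]: "\<delta> 0 = 0"
  using add[of 0 0] by simp

lemma one [simp]: "\<delta> 1 = 0"
  using mult[of 1 1] by simp

abbreviation X where "X \<equiv> ore_lmult_x \<delta>"

lemma X_add: "X (p + q) = X p + X q"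
  by (rule poly_eqI) (simp add: ore_lmult_x_def coeff_map_poly add coeff_pCons split: nat.split)

lemma X_smult: "X (Polynomial.smult a p) = Polynomial.smult a (X p) + Polynomial.smult (\<delta> a) p"
  by (rule poly_eqI)
    (simp add: ore_lmult_x_def coeff_map_poly mult coeff_pCons algebra_simps split: nat.split)

lemma X_0 [simp]: "X 0 = 0"
  by (simp add: ore_lmult_x_def)

lemma X_sum: "X (sum f A) = (\<Sum>i\<in>A. X (f i))"
  by (induction A rule: infinite_finite_induct) (simp_all add: X_add)

lemma Xpow_add: "(X ^^ i) (p + q) = (X ^^ i) p + (X ^^ i) q"
  by (induction i) (simp_all add: X_add)

lemma Xpow_one: "(X ^^ i) 1 = Polynomial.monom 1 i"
proof (induction i)
  case (Suc i)
  have "map_poly \<delta> (Polynomial.monom 1 i) = 0"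
    by (rule poly_eqI) (simp add: coeff_map_poly)
  with Suc show ?case by (simp add: ore_lmult_x_def monom_Suc)
qed simp

lemma ore_mult_bound:
  assumes "degree p \<le> n"
  shows "ore_mult \<delta> p q = (\<Sum>i\<le>n. Polynomial.smult (poly.coeff p i) ((X ^^ i) q))"
  unfolding ore_mult_def
  by (rule sum.mono_neutral_left) (use assms in \<open>auto simp: coeff_eq_0\<close>)

lemma ore_mult_add_left: "ore_mult \<delta> (p + p') q = ore_mult \<delta> p q + ore_mult \<delta> p' q"
proof -
  let ?n = "max (degree p) (degree p')"
  show ?thesis
    by (simp add: ore_mult_bound[of _ ?n] degree_add_le smult_add_left sum.distrib)
qed

lemma ore_mult_add_right: "ore_mult \<delta> p (q + q') = ore_mult \<delta> p q + ore_mult \<delta> p q'"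
  by (simp add: ore_mult_def Xpow_add smult_add_right sum.distrib)

lemma smult_sum_right: "Polynomial.smult a (sum f A) = (\<Sum>i\<in>A. Polynomial.smult a (f i))"
  by (induction A rule: infinite_finite_induct) (simp_all add: smult_add_right)

lemma ore_mult_smult: "ore_mult \<delta> (Polynomial.smult a p) q = Polynomial.smult a (ore_mult \<delta> p q)"
proof -
  have "degree (Polynomial.smult a p) \<le> degree p" by (rule degree_smult_le)
  from ore_mult_bound[OF this] show ?thesis
    by (simp add: ore_mult_def smult_sum_right)
qed

lemma ore_mult_0 [simp]: "ore_mult \<delta> 0 q = 0"
  by (simp add: ore_mult_def)

lemma ore_mult_sum: "ore_mult \<delta> (sum f A) q = (\<Sum>i\<in>A. ore_mult \<delta> (f i) q)"
  by (induction A rule: infinite_finite_induct) (simp_all add: ore_mult_add_left)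

lemma X_ore_mult: "ore_mult \<delta> (X p) q = X (ore_mult \<delta> p q)"
proof -
  have *: "degree (pCons 0 p) \<le> Suc (degree p)" "degree (map_poly \<delta> p) \<le> degree p"
    by (auto intro!: degree_le simp: coeff_map_poly coeff_eq_0 coeff_pCons split: nat.split)
  have "ore_mult \<delta> (X p) q = ore_mult \<delta> (pCons 0 p) q + ore_mult \<delta> (map_poly \<delta> p) q"
    by (simp add: ore_lmult_x_def ore_mult_add_left)
  also have "ore_mult \<delta> (pCons 0 p) q =
      (\<Sum>i\<le>degree p. Polynomial.smult (poly.coeff p i) (X ((X ^^ i) q)))"
    by (subst ore_mult_bound[OF *(1)], subst sum.atMost_Suc_shift) simp
  also have "ore_mult \<delta> (map_poly \<delta> p) q =
      (\<Sum>i\<le>degree p. Polynomial.smult (\<delta> (poly.coeff p i)) ((X ^^ i) q))"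
    by (simp add: ore_mult_bound[OF *(2)] coeff_map_poly)
  finally show ?thesis
    by (simp add: ore_mult_def X_sum X_smult sum.distrib)
qed

lemma Xpow_ore_mult: "ore_mult \<delta> ((X ^^ i) p) q = (X ^^ i) (ore_mult \<delta> p q)"
  by (induction i) (simp_all add: X_ore_mult)

lemma ore_mult_assoc: "ore_mult \<delta> (ore_mult \<delta> p q) r = ore_mult \<delta> p (ore_mult \<delta> q r)"
  by (simp add: ore_mult_def[of \<delta> p] ore_mult_sum ore_mult_smult Xpow_ore_mult)

lemma ore_mult_one_left: "ore_mult \<delta> 1 q = q"
  by (simp add: ore_mult_def)

lemma ore_mult_one_right: "ore_mult \<delta> p 1 = p"
  by (simp add: ore_mult_def Xpow_one smult_monom poly_as_sum_of_monoms)

lemma ore_mult_const: "ore_mult \<delta> [:a:] q = Polynomial.smult a q"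
  by (simp add: ore_mult_def)

lemma ore_mult_x_const: "ore_mult \<delta> [:0, 1:] [:a:] = [:\<delta> a, a:]"
  by (simp add: ore_mult_def ore_lmult_x_def map_poly_pCons)

lemma ore_mult_const_x_pow: "ore_mult \<delta> [:a:] ((X ^^ i) 1) = Polynomial.monom a i"
  by (simp add: ore_mult_const Xpow_one smult_monom)

lemma ore_mult_const_right:
  assumes "\<delta> c = 0" and "\<And>b. \<delta> (c * b) = c * \<delta> b"
  shows "ore_mult \<delta> p [:c:] = Polynomial.smult c p"
proof -
  have "(X ^^ i) [:c:] = Polynomial.monom c i" for i
  proof (induction i)
    case (Suc i)
    have "map_poly \<delta> (Polynomial.monom c i) = 0"
      by (rule poly_eqI) (simp add: coeff_map_poly assms)
    with Suc show ?case by (simp add: ore_lmult_x_def monom_Suc)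
  qed (simp add: monom_0)
  then have "ore_mult \<delta> p [:c:] = (\<Sum>i\<le>degree p. Polynomial.smult c (Polynomial.monom (poly.coeff p i) i))"
    by (simp add: ore_mult_def smult_monom mult.commute)
  also have "\<dots> = Polynomial.smult c p"
    by (simp flip: smult_sum_right add: poly_as_sum_of_monoms)
  finally show ?thesis .
qed

lemma ring_ore_ext: "ring (ore_ext \<delta>)"
proof (rule ringI)
  show "abelian_group (ore_ext \<delta>)"
    by (rule abelian_groupI) (auto simp: ore_ext_def algebra_simps intro: exI[of _ "- _"] add.left_inverse)
  show "Group.monoid (ore_ext \<delta>)"
    by (rule monoidI)
      (auto simp: ore_ext_def ore_mult_assoc ore_mult_one_left ore_mult_one_right)
qed (auto simp: ore_ext_def ore_mult_add_left ore_mult_add_right)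

end

lemma derivation_sum_lpartial: "derivation (\<lambda>f. \<Sum>i\<in>UNIV. g i * lpartial i f)"
  by standard
    (simp_all add: lpartial_add lpartial_mult algebra_simps sum.distrib sum_distrib_left)

lemma ore_const_central:
  "ore_mult (\<lambda>f. \<Sum>i\<in>UNIV. g i * lpartial i f) p [:lconst c:] =
   ore_mult (\<lambda>f. \<Sum>i\<in>UNIV. g i * lpartial i f) [:lconst c:] p"
proof -
  interpret derivation "\<lambda>f. \<Sum>i\<in>UNIV. g i * lpartial i f"
    by (rule derivation_sum_lpartial)
  show ?thesis
    by (simp add: ore_mult_const ore_mult_const_right lpartial_lconst lpartial_mult
        sum_distrib_left mult_ac)
qed

end

theory Submission
  imports Defs
begin

text \<open>
  Write \<open>K\<close> for the Laurent polynomials, \<open>R = K[x, \<delta>]\<close>, and for a set \<open>S\<close> of variables write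
  \<open>K\<^sub>S\<close> for the Laurent polynomials in the variables of \<open>S\<close>.

  \<^emph>\<open>A dichotomy for each \<open>S\<close>.\<close>  If \<open>w f = 0\<close>, then \<open>(w x) f\<^sup>2 = w (f\<^sup>2 x + 2 f \<delta>(f)) = 0\<close>.  Hence
  the \<open>K\<^sub>S\<close>-torsion elements of the simple module \<open>M\<close> form an \<open>R\<close>-submodule, and \<open>M\<close> is either
  torsion-free or torsion over \<open>K\<^sub>S\<close> (\<open>torsion_dichotomy\<close>).  Fix a maximal \<open>S\<close> such that \<open>M\<close> is
  torsion-free over \<open>K\<^sub>S\<close>.  The theorem follows from three facts: if \<open>S\<close> consists of all variables,
  the dimension is \<open>n\<close>; if \<open>S\<close> is empty, it is \<open>1\<close>; nothing else occurs
  (\<open>torsion_alternative\<close>).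

  \<^emph>\<open>All variables.\<close>  For \<open>w \<noteq> 0\<close> the map \<open>f \<mapsto> w f\<close> is injective on \<open>K\<close>, so the growth is at least
  that of \<open>K\<close>.  On the other hand \<open>w\<close> is annihilated by some nonzero \<open>f \<in> R\<close>, because \<open>w x R\<close>
  is \<open>0\<close> or \<open>M\<close> and \<open>x\<close> is not a unit.  Let \<open>R\<^sub>m\<close> be the filtration described below and \<open>f \<in> R\<^sub>d\<close>.  As \<open>R\<close> is a
  domain, left multiplication by \<open>f\<close> embeds \<open>R\<^sub>m\<close> into the kernel of \<open>R\<^sub>m\<^sub>+\<^sub>d \<rightarrow> w R\<^sub>m\<^sub>+\<^sub>d\<close>, and
  \<open>dim R\<^sub>m\<^sub>+\<^sub>d - dim R\<^sub>m\<close> is only of order \<open>m\<^sup>n\<close> (\<open>growth_upper_bound\<close>).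

  \<^emph>\<open>Some variables missing.\<close>  For each \<open>i \<notin> S\<close> every \<open>w\<close> satisfies a polynomial relation in
  \<open>x\<^sub>i\<close> over \<open>K\<^sub>S\<close>, so that \<open>w K\<close> has finite rank over \<open>K\<^sub>S\<close>.  Choose \<open>w \<noteq> 0\<close> with minimal rank.
  This minimality does the work of an associated prime: multiplication by \<open>f\<close> is injective on
  \<open>w K\<close> as soon as \<open>w f \<noteq> 0\<close>, so that \<open>P = ann\<^sub>K(w)\<close> is prime (\<open>minimal_family_prime\<close>).  Simplicity of
  \<open>R\<close> implies that \<open>P \<noteq> 0\<close> is not \<open>\<delta>\<close>-stable and that \<open>k\<close> has characteristic \<open>0\<close>.  Multiplying a
  relation \<open>w \<Sum>\<^sub>j f\<^sub>j x\<^sup>j = 0\<close> by some \<open>q \<in> P\<close> with \<open>\<delta>(q) \<notin> P\<close> lowers its degree, which shows that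
  all \<open>w f\<^sub>j\<close> vanish (\<open>coefficients_vanish\<close>); in other words \<open>M\<close> is the direct sum of the
  translates of \<open>w K\<close> by the powers of \<open>x\<close>.  If \<open>S\<close> is empty, \<open>w K\<close> is finite-dimensional over \<open>k\<close>, and
  the growth of \<open>M\<close> is linear.

  If \<open>S\<close> is not empty, take a nonzero \<open>h \<in> K\<^sub>S\<close>.  Then \<open>w h R = M\<close>, and comparing the terms of degree
  \<open>0\<close> gives \<open>w \<in> w h K\<close>: every such \<open>h\<close> acts invertibly on \<open>w K\<close>.  But \<open>w K\<close>
  contains a nonzero free \<open>K\<^sub>S\<close>-module \<open>L\<close> of finite rank such that the elements of \<open>L K\<close> have powers of a single
  \<open>c \<in> K\<^sub>S\<close> as denominators with respect to \<open>L\<close>, so \<open>h\<close> divides a power of \<open>c\<close>.  This is absurd for a non-unit \<open>h \<equiv> 1\<close> modulo \<open>c\<close>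
  (\<open>torsion_free_variables_empty\<close>).

  \<^emph>\<open>Independence of the generators.\<close>  The terms \<open>x\<^sup>\<alpha> x\<^sup>j\<close> with \<open>\<bar>\<alpha>\<^sub>i\<bar> + j \<le> m\<close> for all \<open>i\<close> span a
  subspace \<open>R\<^sub>m\<close>, and \<open>R\<^sub>s R\<^sub>t \<subseteq> R\<^sub>s\<^sub>+\<^sub>t\<close> because \<open>\<delta>\<close> changes exponents by at most one; this is where the
  form of the \<open>g\<^sub>i\<close> enters.  Each finite generating set yields a filtration that
  agrees with this one up to a linear change of the index, so that bounds on \<open>dim w R\<^sub>m\<close> for a single
  \<open>w\<close> determine the dimension (\<open>has_GK_dimI\<close>).
\<close>

section \<open>Laurent polynomials\<close>

text \<open>Reduces a statement about all monomials that is stable under products to the variables and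
  their inverses.\<close>

lemma lattice_closed_induct:
  fixes \<alpha> :: "(int, 'n::finite) vec"
  assumes zero: "P 0" and add: "\<And>\<alpha> \<beta>. P \<alpha> \<Longrightarrow> P \<beta> \<Longrightarrow> P (\<alpha> + \<beta>)"
    and pos: "\<And>i. P (axis i 1)" and neg: "\<And>i. P (- axis i 1)"
  shows "P \<alpha>"
proof -
  have ax: "P (axis i k)" for i k
  proof (induction k rule: int_induct[where k = 0])
    case base
    have "axis i (0 :: int) = (0 :: (int, 'n) vec)" by (simp add: axis_def vec_eq_iff)
    then show ?case using zero by (simp only:)
  next
    case (step1 k)
    have "axis i (k + 1) = axis i k + axis i 1" by (simp add: axis_def vec_eq_iff)
    then show ?case using add[OF step1(2) pos] by simp
  next
    case (step2 k)
    have "axis i (k - 1) = axis i k + - axis i 1" by (simp add: axis_def vec_eq_iff)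
    then show ?case using add[OF step2(2) neg] by simp
  qed
  have "\<forall>\<alpha>. (\<forall>i. i \<notin> T \<longrightarrow> \<alpha> $ i = 0) \<longrightarrow> P \<alpha>" if "finite T" for T :: "'n set"
    using that
  proof (induction T)
    case empty
    have "\<alpha> = 0" if "\<forall>i. \<alpha> $ i = 0" for \<alpha> :: "(int, 'n) vec" using that by (simp add: vec_eq_iff)
    then show ?case using zero by auto
  next
    case (insert j T)
    show ?case
    proof (intro allI impI)
      fix \<alpha> :: "(int, 'n) vec"
      assume a: "\<forall>i. i \<notin> insert j T \<longrightarrow> \<alpha> $ i = 0"
      have "P (\<alpha> - axis j (\<alpha> $ j))"
        using a by (intro insert.IH[rule_format]) (auto simp: axis_def)
      from add[OF this ax[of j "\<alpha> $ j"]] show "P \<alpha>" by simp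
    qed
  qed
  from this[of UNIV] show ?thesis by simp
qed

lemma laurent_as_sum:
  fixes f :: "('k::field, 'n::finite) laurent"
  shows "f = (\<Sum>\<alpha>\<in>Poly_Mapping.keys f. Poly_Mapping.single \<alpha> (Poly_Mapping.lookup f \<alpha>))"
  by (rule poly_mapping_eqI)
    (simp add: lookup_sum lookup_single when_def sum.delta in_keys_iff)

lemma lookup_single_mult:
  fixes f :: "('k::field, 'n::finite) laurent"
  shows "Poly_Mapping.lookup (Poly_Mapping.single \<alpha> c * f) \<gamma> = c * Poly_Mapping.lookup f (\<gamma> - \<alpha>)"
proof (induction f rule: laurent_induct)
  case (1 \<beta> d)
  then show ?case by (auto simp: mult_single lookup_single when_def algebra_simps)
next
  case (2 f g)
  then show ?case by (simp add: algebra_simps lookup_add)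
qed

lemma lookup_laurent_mult:
  fixes f g :: "('k::field, 'n::finite) laurent"
  shows "Poly_Mapping.lookup (f * g) \<gamma> =
    (\<Sum>\<alpha>\<in>Poly_Mapping.keys f. Poly_Mapping.lookup f \<alpha> * Poly_Mapping.lookup g (\<gamma> - \<alpha>))"
proof -
  have "f * g = (\<Sum>\<alpha>\<in>Poly_Mapping.keys f. Poly_Mapping.single \<alpha> (Poly_Mapping.lookup f \<alpha>) * g)"
    by (subst laurent_as_sum[of f], subst sum_distrib_right) simp
  then show ?thesis by (simp add: lookup_sum lookup_single_mult)
qed

lemma keys_laurent_mult_le:
  fixes f g :: "('k::field, 'n::finite) laurent"
  assumes "Poly_Mapping.lookup (f * g) \<gamma> \<noteq> 0"
  obtains \<alpha> \<beta> where "\<gamma> = \<alpha> + \<beta>" "Poly_Mapping.lookup f \<alpha> \<noteq> 0" "Poly_Mapping.lookup g \<beta> \<noteq> 0"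
proof -
  from assms obtain \<alpha> where "\<alpha> \<in> Poly_Mapping.keys f"
     "Poly_Mapping.lookup f \<alpha> * Poly_Mapping.lookup g (\<gamma> - \<alpha>) \<noteq> 0"
    unfolding lookup_laurent_mult by (meson sum.not_neutral_contains_not_neutral)
  then show ?thesis using that[of \<alpha> "\<gamma> - \<alpha>"] by auto
qed

text \<open>The variables are indexed by an arbitrary finite type, so the lexicographic order of exponents
  is taken along an enumeration: finitely supported functions from \<^typ>\<open>nat\<close> to
  \<^typ>\<open>int\<close> are a linearly ordered group.\<close>

definition lex_embedding :: "(int, 'n::finite) vec \<Rightarrow> (nat \<Rightarrow>\<^sub>0 int)" where
  "lex_embedding \<alpha> = (\<Sum>i\<in>UNIV. Poly_Mapping.single (to_nat_on (UNIV :: 'n set) i) (\<alpha> $ i))"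

lemma lex_embedding_add: "lex_embedding (\<alpha> + \<beta>) = lex_embedding \<alpha> + lex_embedding \<beta>"
  by (simp add: lex_embedding_def single_add sum.distrib)

lemma lookup_lex_embedding:
  "Poly_Mapping.lookup (lex_embedding \<alpha>) (to_nat_on (UNIV :: 'n::finite set) i) = (\<alpha> :: (int, 'n) vec) $ i"
proof -
  have "inj (to_nat_on (UNIV :: 'n set))" by (simp add: countable_finite inj_on_to_nat_on)
  then show ?thesis
    by (simp add: lex_embedding_def lookup_sum lookup_single inj_eq when_def)
qed

lemma inj_lex_embedding: "inj lex_embedding"
  by (rule injI) (metis lookup_lex_embedding vec_eq_iff)

text \<open>Leading terms do not cancel: if \<open>\<alpha>\<close> and \<open>\<beta>\<close> are the largest exponents of the two factors, then
  \<open>(\<alpha>, \<beta>)\<close> is the only pair of exponents that contributes to \<open>\<alpha> + \<beta>\<close>.  The order is a parameter, so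
  that its reverse gives the same statement for the smallest exponents.\<close>

lemma lookup_mult_extreme:
  fixes f h :: "('k::field, 'n::finite) laurent"
    and \<phi> :: "(int, 'n) vec \<Rightarrow> 'o::linordered_ab_group_add"
  assumes \<phi>: "\<And>\<alpha> \<beta>. \<phi> (\<alpha> + \<beta>) = \<phi> \<alpha> + \<phi> \<beta>" "inj \<phi>" and "f \<noteq> 0" "h \<noteq> 0"
  obtains \<alpha> \<beta> where "\<alpha> \<in> Poly_Mapping.keys f" "\<beta> \<in> Poly_Mapping.keys h"
    "\<And>\<gamma>. \<gamma> \<in> Poly_Mapping.keys f \<Longrightarrow> \<phi> \<gamma> \<le> \<phi> \<alpha>" "\<And>\<gamma>. \<gamma> \<in> Poly_Mapping.keys h \<Longrightarrow> \<phi> \<gamma> \<le> \<phi> \<beta>"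
    "\<alpha> + \<beta> \<in> Poly_Mapping.keys (f * h)"
proof -
  have ex: "\<exists>\<alpha>\<in>Poly_Mapping.keys u. \<forall>\<gamma>\<in>Poly_Mapping.keys u. \<phi> \<gamma> \<le> \<phi> \<alpha>"
    if "u \<noteq> 0" for u :: "('k, 'n) laurent"
  proof -
    have fin: "finite (\<phi> ` Poly_Mapping.keys u)" "\<phi> ` Poly_Mapping.keys u \<noteq> {}"
      using that laurent_as_sum[of u] by auto
    from Max_in[OF this] obtain \<alpha> where "\<alpha> \<in> Poly_Mapping.keys u" "Max (\<phi> ` Poly_Mapping.keys u) = \<phi> \<alpha>"
      by auto
    with Max_ge[OF fin(1)] show ?thesis by (metis imageI)
  qed
  from ex[OF \<open>f \<noteq> 0\<close>] obtain \<alpha> where \<alpha>: "\<alpha> \<in> Poly_Mapping.keys f"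
    "\<And>\<gamma>. \<gamma> \<in> Poly_Mapping.keys f \<Longrightarrow> \<phi> \<gamma> \<le> \<phi> \<alpha>" by blast
  from ex[OF \<open>h \<noteq> 0\<close>] obtain \<beta> where \<beta>: "\<beta> \<in> Poly_Mapping.keys h"
    "\<And>\<gamma>. \<gamma> \<in> Poly_Mapping.keys h \<Longrightarrow> \<phi> \<gamma> \<le> \<phi> \<beta>" by blast
  have "Poly_Mapping.lookup h (\<alpha> + \<beta> - \<gamma>) = 0" if g: "\<gamma> \<in> Poly_Mapping.keys f" "\<gamma> \<noteq> \<alpha>" for \<gamma>
  proof (rule ccontr)
    assume "Poly_Mapping.lookup h (\<alpha> + \<beta> - \<gamma>) \<noteq> 0"
    then have "\<phi> (\<alpha> + \<beta> - \<gamma>) \<le> \<phi> \<beta>" using \<beta>(2) by (simp add: in_keys_iff)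
    moreover have "\<phi> (\<alpha> + \<beta> - \<gamma>) + \<phi> \<gamma> = \<phi> \<alpha> + \<phi> \<beta>" by (simp flip: \<phi>(1))
    moreover have "\<phi> \<gamma> < \<phi> \<alpha>" using \<alpha>(2)[OF g(1)] g(2) \<phi>(2) by (metis injD order_less_le)
    ultimately show False by (metis add.commute add_le_less_mono order_less_irrefl)
  qed
  then have "Poly_Mapping.lookup (f * h) (\<alpha> + \<beta>) = (\<Sum>\<gamma>\<in>Poly_Mapping.keys f.
      if \<gamma> = \<alpha> then Poly_Mapping.lookup f \<alpha> * Poly_Mapping.lookup h \<beta> else 0)"
    unfolding lookup_laurent_mult by (intro sum.cong) auto
  also have "\<dots> = Poly_Mapping.lookup f \<alpha> * Poly_Mapping.lookup h \<beta>"
    using \<alpha>(1) by (simp add: sum.delta)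
  finally have "\<alpha> + \<beta> \<in> Poly_Mapping.keys (f * h)" using \<alpha>(1) \<beta>(1) by (simp add: in_keys_iff)
  then show ?thesis using that \<alpha> \<beta> by blast
qed

lemma laurent_mult_eq_0_iff:
  fixes f h :: "('k::field, 'n::finite) laurent"
  shows "f * h = 0 \<longleftrightarrow> f = 0 \<or> h = 0"
proof (rule ccontr)
  assume *: "\<not> ?thesis"
  then have "f \<noteq> 0" "h \<noteq> 0" "f * h = 0" by auto
  then show False by (metis lookup_mult_extreme[OF lex_embedding_add inj_lex_embedding] empty_iff keys_zero)
qed

text \<open>The largest exponents of \<open>f\<close> and \<open>h\<close> add up to an exponent of \<open>1\<close>, that is, to \<open>0\<close>, and so do the
  smallest ones.  Hence the largest and the smallest exponent of \<open>f\<close> coincide.\<close>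

lemma laurent_unit_single_exponent:
  fixes f h :: "('k::field, 'n::finite) laurent"
  assumes "f * h = 1" and "\<alpha> \<in> Poly_Mapping.keys f" "\<beta> \<in> Poly_Mapping.keys f"
  shows "\<alpha> = \<beta>"
proof -
  let ?\<phi> = "lex_embedding :: (int, 'n) vec \<Rightarrow> _"
  have nz: "f \<noteq> 0" "h \<noteq> 0" using assms(1) by (auto simp: zero_neq_one)
  obtain \<alpha>1 \<beta>1 where 1: "\<alpha>1 \<in> Poly_Mapping.keys f" "\<beta>1 \<in> Poly_Mapping.keys h"
    "\<And>\<gamma>. \<gamma> \<in> Poly_Mapping.keys f \<Longrightarrow> ?\<phi> \<gamma> \<le> ?\<phi> \<alpha>1" "\<And>\<gamma>. \<gamma> \<in> Poly_Mapping.keys h \<Longrightarrow> ?\<phi> \<gamma> \<le> ?\<phi> \<beta>1"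
    "\<alpha>1 + \<beta>1 \<in> Poly_Mapping.keys (f * h)"
    using lookup_mult_extreme[OF lex_embedding_add inj_lex_embedding nz] by metis
  have inj: "inj (\<lambda>\<alpha>. - ?\<phi> \<alpha>)" using inj_lex_embedding by (auto simp: inj_def)
  have add: "- ?\<phi> (\<alpha> + \<beta>) = - ?\<phi> \<alpha> + - ?\<phi> \<beta>" for \<alpha> \<beta> by (simp add: lex_embedding_add)
  obtain \<alpha>2 \<beta>2 where 2: "\<alpha>2 \<in> Poly_Mapping.keys f" "\<beta>2 \<in> Poly_Mapping.keys h"
    "\<And>\<gamma>. \<gamma> \<in> Poly_Mapping.keys f \<Longrightarrow> - ?\<phi> \<gamma> \<le> - ?\<phi> \<alpha>2" "\<And>\<gamma>. \<gamma> \<in> Poly_Mapping.keys h \<Longrightarrow> - ?\<phi> \<gamma> \<le> - ?\<phi> \<beta>2"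
    "\<alpha>2 + \<beta>2 \<in> Poly_Mapping.keys (f * h)"
    using lookup_mult_extreme[OF add inj nz] by metis
  have "\<alpha>1 + \<beta>1 = \<alpha>2 + \<beta>2" using 1(5) 2(5) assms(1) by simp
  then have "?\<phi> \<alpha>1 + ?\<phi> \<beta>1 = ?\<phi> \<alpha>2 + ?\<phi> \<beta>2" by (metis lex_embedding_add)
  moreover have "?\<phi> \<alpha>2 \<le> ?\<phi> \<alpha>1" "?\<phi> \<beta>2 \<le> ?\<phi> \<beta>1" using 1 2 by auto
  ultimately have "?\<phi> \<alpha>1 = ?\<phi> \<alpha>2" by (metis add_less_le_mono order_less_irrefl order_less_le)
  then have "?\<phi> \<gamma> = ?\<phi> \<alpha>1" if "\<gamma> \<in> Poly_Mapping.keys f" for \<gamma>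
    using 1(3)[OF that] 2(3)[OF that] by simp
  then show ?thesis using assms inj_lex_embedding by (metis injD)
qed

section \<open>The filtration of the Ore extension by exponents\<close>

definition exponent_box :: "nat \<Rightarrow> (int, 'n::finite) vec set" where
  "exponent_box m = {\<alpha>. \<forall>i. \<bar>\<alpha> $ i\<bar> \<le> int m}"

lemma bij_betw_exponent_box:
  "bij_betw vec_nth (exponent_box m :: (int, 'n::finite) vec set) (PiE UNIV (\<lambda>_. {- int m..int m}))"
  by (rule bij_betwI[where g = vec_lambda])
    (auto simp: exponent_box_def abs_le_iff minus_le_iff PiE_iff vec_eq_iff)

lemma finite_exponent_box [simp]: "finite (exponent_box m)"
  using bij_betw_finite[OF bij_betw_exponent_box] by (simp add: finite_PiE)

lemma card_exponent_box: "card (exponent_box m :: (int, 'n::finite) vec set) = (2 * m + 1) ^ CARD('n)"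
proof -
  have "card {- int m..int m} = 2 * m + 1" by simp
  then show ?thesis
    using bij_betw_same_card[OF bij_betw_exponent_box[of m, where 'n = 'n]]
    by (simp add: card_PiE)
qed

text \<open>The pair \<open>(\<alpha>, j)\<close> stands for the term \<open>x\<^sup>\<alpha> x\<^sup>j\<close>.  The exponents of the Laurent variables are measured
  by the maximum norm, which makes \<open>exponent_box\<close> easy to count.\<close>

definition ore_exponents :: "nat \<Rightarrow> ((int, 'n::finite) vec \<times> nat) set" where
  "ore_exponents m = {(\<alpha>, j). \<forall>i. \<bar>\<alpha> $ i\<bar> + int j \<le> int m}"

lemma ore_exponents_subset: "ore_exponents m \<subseteq> exponent_box m \<times> {..m}"
proof
  fix p assume p: "p \<in> ore_exponents m"
  obtain \<alpha> j where [simp]: "p = (\<alpha>, j)" by fastforce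
  have "\<bar>\<alpha> $ i\<bar> \<le> int m \<and> j \<le> m" for i
    using p by (auto simp: ore_exponents_def dest: spec[of _ i])
  then show "p \<in> exponent_box m \<times> {..m}" by (simp add: exponent_box_def)
qed

lemma finite_ore_exponents [simp]: "finite (ore_exponents m)"
  by (rule finite_subset[OF ore_exponents_subset]) simp

text \<open>Raising \<open>j\<close> by \<open>d\<close> maps the smaller set into the larger one and misses only pairs with
  \<open>j < d\<close>.  The difference of the cardinalities thus has order \<open>m\<^sup>n\<close>, one less than the cardinalities
  themselves.\<close>

lemma card_ore_exponents_diff:
  "card (ore_exponents m :: ((int, 'n::finite) vec \<times> nat) set) \<le>
   card (ore_exponents (m - d) :: ((int, 'n) vec \<times> nat) set) + d * (2 * m + 1) ^ CARD('n)"
proof -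
  let ?E = "ore_exponents :: nat \<Rightarrow> ((int, 'n) vec \<times> nat) set"
  let ?s = "\<lambda>(\<alpha> :: (int, 'n) vec, j). (\<alpha>, j + d)"
  have "?E m \<subseteq> ?s ` ?E (m - d) \<union> exponent_box m \<times> {..<d}"
  proof
    fix p assume p: "p \<in> ?E m"
    obtain \<alpha> j where [simp]: "p = (\<alpha>, j)" by fastforce
    show "p \<in> ?s ` ?E (m - d) \<union> exponent_box m \<times> {..<d}"
    proof (cases "j < d")
      case True
      then show ?thesis using p ore_exponents_subset by fastforce
    next
      case False
      have *: "\<bar>\<alpha> $ i\<bar> + int j \<le> int m" for i using p by (simp add: ore_exponents_def)
      have "\<bar>\<alpha> $ i\<bar> + int (j - d) \<le> int (m - d)" for i
        using *[of i] False by (simp add: of_nat_diff)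
      then have "(\<alpha>, j - d) \<in> ?E (m - d)" by (simp add: ore_exponents_def)
      then show ?thesis using False by (force intro!: image_eqI[of _ _ "(\<alpha>, j - d)"])
    qed
  qed
  then have "card (?E m) \<le> card (?s ` ?E (m - d) \<union> exponent_box m \<times> {..<d})"
    by (intro card_mono) auto
  also have "\<dots> \<le> card (?s ` ?E (m - d)) + card (exponent_box m \<times> {..<d} :: ((int, 'n) vec \<times> nat) set)"
    by (rule card_Un_le)
  also have "card (?s ` ?E (m - d)) \<le> card (?E (m - d))" by (rule card_image_le) simp
  finally show ?thesis by (simp add: card_cartesian_product card_exponent_box mult.commute)
qed

definition ore_filt :: "nat \<Rightarrow> ('k::field, 'n::finite) laurent poly set" where
  "ore_filt m = {p. \<forall>j \<alpha>. Poly_Mapping.lookup (poly.coeff p j) \<alpha> \<noteq> 0 \<longrightarrow> (\<alpha>, j) \<in> ore_exponents m}"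

lemma ore_filtD:
  "p \<in> ore_filt m \<Longrightarrow> Poly_Mapping.lookup (poly.coeff p j) \<alpha> \<noteq> 0 \<Longrightarrow> \<bar>\<alpha> $ i\<bar> + int j \<le> int m"
  by (auto simp: ore_filt_def ore_exponents_def)

lemma ore_filtI:
  "(\<And>j \<alpha> i. Poly_Mapping.lookup (poly.coeff p j) \<alpha> \<noteq> 0 \<Longrightarrow> \<bar>\<alpha> $ i\<bar> + int j \<le> int m) \<Longrightarrow> p \<in> ore_filt m"
  by (auto simp: ore_filt_def ore_exponents_def)

lemma ore_filt_mono: "m \<le> m' \<Longrightarrow> ore_filt m \<subseteq> ore_filt m'"
  by (auto intro!: ore_filtI dest!: ore_filtD intro: order_trans)

lemma ore_filt_0 [simp]: "0 \<in> ore_filt m"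
  by (simp add: ore_filt_def)

lemma ore_filt_add: "p \<in> ore_filt m \<Longrightarrow> q \<in> ore_filt m \<Longrightarrow> p + q \<in> ore_filt m"
  by (auto simp: ore_filt_def lookup_add) (metis add_0)

lemma ore_filt_sum: "(\<And>i. i \<in> I \<Longrightarrow> f i \<in> ore_filt m) \<Longrightarrow> sum f I \<in> ore_filt m"
  by (induction I rule: infinite_finite_induct) (auto intro: ore_filt_add)

lemma ore_filt_smult:
  assumes "p \<in> ore_filt t" and a: "\<And>\<alpha> i. Poly_Mapping.lookup a \<alpha> \<noteq> 0 \<Longrightarrow> \<bar>\<alpha> $ i\<bar> \<le> int s"
  shows "Polynomial.smult a p \<in> ore_filt (s + t)"
proof (rule ore_filtI)
  fix j \<gamma> i
  assume "Poly_Mapping.lookup (poly.coeff (Polynomial.smult a p) j) \<gamma> \<noteq> 0"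
  then have "Poly_Mapping.lookup (a * poly.coeff p j) \<gamma> \<noteq> 0" by simp
  then obtain \<alpha> \<beta> where *: "\<gamma> = \<alpha> + \<beta>" "Poly_Mapping.lookup a \<alpha> \<noteq> 0"
    "Poly_Mapping.lookup (poly.coeff p j) \<beta> \<noteq> 0" by (rule keys_laurent_mult_le)
  with a[of \<alpha> i] ore_filtD[OF assms(1) *(3), of i] show "\<bar>\<gamma> $ i\<bar> + int j \<le> int (s + t)" by simp
qed

lemma ore_filt_monom:
  "(\<alpha>, j) \<in> ore_exponents m \<Longrightarrow> Polynomial.monom (Poly_Mapping.single \<alpha> c) j \<in> ore_filt m"
  by (auto simp: ore_filt_def lookup_single when_def split: if_splits)

lemma ore_filt_const: "[:lconst c:] \<in> ore_filt m"
  using ore_filt_monom[of 0 0 m c] by (simp add: lconst_def ore_exponents_def monom_0)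

lemma ex_ore_filt:
  fixes p :: "('k::field, 'n::finite) laurent poly"
  shows "\<exists>m. p \<in> ore_filt m"
proof -
  define F where "F = (\<Union>j\<le>degree p. Poly_Mapping.keys (poly.coeff p j) \<times> {j} \<times> (UNIV :: 'n set))"
  define m where "m = Max (insert 0 ((\<lambda>(\<alpha>, j, i). nat (\<bar>\<alpha> $ i\<bar> + int j)) ` F))"
  have fin: "finite F" by (auto simp: F_def)
  have "p \<in> ore_filt m"
  proof (rule ore_filtI)
    fix j \<alpha> i assume *: "Poly_Mapping.lookup (poly.coeff p j) \<alpha> \<noteq> 0"
    then have "j \<le> degree p" by (metis coeff_eq_0 lookup_zero not_le)
    with * have "(\<alpha>, j, i) \<in> F" by (auto simp: F_def in_keys_iff)
    then have "nat (\<bar>\<alpha> $ i\<bar> + int j) \<le> m"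
      unfolding m_def using fin by (intro Max_ge) force+
    then show "\<bar>\<alpha> $ i\<bar> + int j \<le> int m" by simp
  qed
  then show ?thesis ..
qed

lemma ore_filt_induct:
  fixes p :: "('k::field, 'n::finite) laurent poly"
  assumes p: "p \<in> ore_filt m" and zero: "P 0" and add: "\<And>p q. P p \<Longrightarrow> P q \<Longrightarrow> P (p + q)"
    and monom: "\<And>\<alpha> j c. (\<alpha>, j) \<in> ore_exponents m \<Longrightarrow> P (Polynomial.monom (Poly_Mapping.single \<alpha> c) j)"
  shows "P p"
proof -
  have Psum: "P (sum f I)" if "\<And>i. i \<in> I \<Longrightarrow> P (f i)" for f :: "'x \<Rightarrow> _" and I
    using that by (induction I rule: infinite_finite_induct) (auto simp: zero add)
  have Psum': "P (sum f I)" if "\<And>i. i \<in> I \<Longrightarrow> P (f i)" for f :: "'y \<Rightarrow> _" and I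
    using that by (induction I rule: infinite_finite_induct) (auto simp: zero add)
  have "Polynomial.monom (poly.coeff p j) j =
      (\<Sum>\<alpha>\<in>Poly_Mapping.keys (poly.coeff p j).
         Polynomial.monom (Poly_Mapping.single \<alpha> (Poly_Mapping.lookup (poly.coeff p j) \<alpha>)) j)" for j
    by (subst laurent_as_sum[of "poly.coeff p j"], rule poly_eqI) (simp add: coeff_sum)
  moreover have "P (Polynomial.monom (Poly_Mapping.single \<alpha> (Poly_Mapping.lookup (poly.coeff p j) \<alpha>)) j)"
    if "\<alpha> \<in> Poly_Mapping.keys (poly.coeff p j)" for \<alpha> j
    using p that by (intro monom) (auto simp: ore_filt_def in_keys_iff)
  ultimately have "P (Polynomial.monom (poly.coeff p j) j)" for j
    by (simp add: Psum)
  then have "P (\<Sum>j\<le>degree p. Polynomial.monom (poly.coeff p j) j)" by (intro Psum') auto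
  then show ?thesis by (simp add: poly_as_sum_of_monoms)
qed

locale laurent_ore =
  fixes g :: "'n::finite \<Rightarrow> ('k::field, 'n) laurent"
    and \<delta> :: "('k, 'n) laurent \<Rightarrow> ('k, 'n) laurent"
  assumes g_form: "\<And>i. \<exists>a b. g i = lconst a * lvar i + lconst b"
    and \<delta>_eq: "\<delta> = (\<lambda>f. \<Sum>i\<in>UNIV. g i * lpartial i f)"
begin

sublocale derivation \<delta>
  unfolding \<delta>_eq by (rule derivation_sum_lpartial)

text \<open>As \<open>g\<^sub>i \<in> k x\<^sub>i + k\<close>, the derivation maps \<open>x\<^sup>\<alpha>\<close> to a combination of \<open>x\<^sup>\<alpha>\<close> and the \<open>x\<^sup>\<alpha> x\<^sub>i\<^sup>-\<^sup>1\<close>, so that it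
  raises the maximum norm of exponents by at most one.\<close>

lemma \<delta>_lookup_nonzero:
  assumes "Poly_Mapping.lookup (\<delta> f) \<beta> \<noteq> 0"
  shows "Poly_Mapping.lookup f \<beta> \<noteq> 0 \<or> (\<exists>i. Poly_Mapping.lookup f (\<beta> + axis i 1) \<noteq> 0)"
proof -
  have "(\<Sum>i\<in>UNIV. Poly_Mapping.lookup (g i * lpartial i f) \<beta>) \<noteq> 0"
    using assms by (simp add: \<delta>_eq lookup_sum)
  then obtain i where i: "Poly_Mapping.lookup (g i * lpartial i f) \<beta> \<noteq> 0"
    by (meson sum.not_neutral_contains_not_neutral)
  obtain a b where "g i = lconst a * lvar i + lconst b" using g_form by blast
  then have "g i = Poly_Mapping.single (axis i 1) a + Poly_Mapping.single 0 b"
    by (simp add: lconst_def lvar_def mult_single)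
  then have "Poly_Mapping.lookup (g i * lpartial i f) \<beta> =
     a * (of_int (\<beta> $ i) * Poly_Mapping.lookup f \<beta>) +
     b * (of_int (\<beta> $ i + 1) * Poly_Mapping.lookup f (\<beta> + axis i 1))"
    by (simp add: distrib_right lookup_add lookup_single_mult lpartial_lookup)
  with i show ?thesis by auto
qed

lemma coeff_X: "poly.coeff (X q) j = (case j of 0 \<Rightarrow> 0 | Suc l \<Rightarrow> poly.coeff q l) + \<delta> (poly.coeff q j)"
  by (simp add: ore_lmult_x_def coeff_map_poly coeff_pCons split: nat.split)

lemma X_ore_filt: "q \<in> ore_filt m \<Longrightarrow> X q \<in> ore_filt (Suc m)"
proof (rule ore_filtI)
  fix j \<alpha> i
  assume q: "q \<in> ore_filt m" and "Poly_Mapping.lookup (poly.coeff (X q) j) \<alpha> \<noteq> 0"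
  then consider l where "j = Suc l" "Poly_Mapping.lookup (poly.coeff q l) \<alpha> \<noteq> 0"
    | "Poly_Mapping.lookup (\<delta> (poly.coeff q j)) \<alpha> \<noteq> 0"
    by (cases j) (auto simp: coeff_X lookup_add, metis add_0)
  then show "\<bar>\<alpha> $ i\<bar> + int j \<le> int (Suc m)"
  proof cases
    case 1
    then show ?thesis using ore_filtD[OF q 1(2), of i] by simp
  next
    case 2
    from \<delta>_lookup_nonzero[OF this] show ?thesis
    proof (elim disjE exE)
      assume "Poly_Mapping.lookup (poly.coeff q j) \<alpha> \<noteq> 0"
      from ore_filtD[OF q this, of i] show ?thesis by simp
    next
      fix i' assume "Poly_Mapping.lookup (poly.coeff q j) (\<alpha> + axis i' 1) \<noteq> 0"
      from ore_filtD[OF q this, of i] show ?thesis by (auto simp: axis_def split: if_splits)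
    qed
  qed
qed

lemma ore_filt_mult:
  assumes p: "p \<in> ore_filt s" and q: "q \<in> ore_filt t"
  shows "ore_mult \<delta> p q \<in> ore_filt (s + t)"
proof -
  have X: "(X ^^ i) q \<in> ore_filt (i + t)" for i
    by (induction i) (auto simp: q X_ore_filt)
  have "Polynomial.smult (poly.coeff p i) ((X ^^ i) q) \<in> ore_filt (s + t)" for i
  proof (cases "poly.coeff p i = 0")
    case False
    then obtain \<alpha> where "Poly_Mapping.lookup (poly.coeff p i) \<alpha> \<noteq> 0"
      by (metis lookup_zero poly_mapping_eqI)
    from ore_filtD[OF p this, of undefined] have "i \<le> s" by linarith
    then have *: "\<bar>\<alpha> $ l\<bar> \<le> int (s - i)" if "Poly_Mapping.lookup (poly.coeff p i) \<alpha> \<noteq> 0" for \<alpha> l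
      using ore_filtD[OF p that, of l] by (simp add: of_nat_diff)
    show ?thesis using ore_filt_smult[OF X[of i] *] \<open>i \<le> s\<close> by simp
  qed simp
  then show ?thesis unfolding ore_mult_def by (intro ore_filt_sum)
qed

lemma degree_Xpow: "degree ((X ^^ i) q) \<le> i + degree q"
proof (induction i)
  case (Suc i)
  show ?case
  proof (rule degree_le, intro allI impI)
    fix j assume "Suc i + degree q < j"
    with Suc show "poly.coeff ((X ^^ Suc i) q) j = 0"
      by (auto simp: coeff_X coeff_eq_0 split: nat.split)
  qed
qed simp

lemma lead_coeff_Xpow: "poly.coeff ((X ^^ i) q) (i + degree q) = lead_coeff q"
proof (induction i)
  case (Suc i)
  have "poly.coeff ((X ^^ i) q) (Suc (i + degree q)) = 0"
    using degree_Xpow[of i q] by (intro coeff_eq_0) simp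
  with Suc show ?case by (simp add: coeff_X)
qed simp

lemma degree_ore_mult_le: "degree (ore_mult \<delta> p q) \<le> degree p + degree q"
  unfolding ore_mult_def
  by (intro degree_sum_le order_trans[OF degree_smult_le] order_trans[OF degree_Xpow]) auto

lemma lead_coeff_ore_mult:
  "poly.coeff (ore_mult \<delta> p q) (degree p + degree q) = lead_coeff p * lead_coeff q"
proof -
  have "poly.coeff ((X ^^ i) q) (degree p + degree q) = 0" if "i < degree p" for i
    using degree_Xpow[of i q] that by (intro coeff_eq_0) simp
  then have "poly.coeff (ore_mult \<delta> p q) (degree p + degree q) =
     (\<Sum>i\<le>degree p. if i = degree p then lead_coeff p * lead_coeff q else 0)"
    unfolding ore_mult_def coeff_sum
    by (intro sum.cong) (auto simp: lead_coeff_Xpow)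
  then show ?thesis by simp
qed

text \<open>\<open>K[x, \<delta>]\<close> is a domain, since leading coefficients multiply as in a commutative polynomial ring.\<close>

lemma ore_mult_nonzero:
  assumes "p \<noteq> 0" "q \<noteq> 0"
  shows "ore_mult \<delta> p q \<noteq> 0" "degree (ore_mult \<delta> p q) = degree p + degree q"
proof -
  have *: "poly.coeff (ore_mult \<delta> p q) (degree p + degree q) \<noteq> 0"
    using assms by (simp add: lead_coeff_ore_mult laurent_mult_eq_0_iff)
  then show "ore_mult \<delta> p q \<noteq> 0" by force
  show "degree (ore_mult \<delta> p q) = degree p + degree q"
    using le_degree[OF *] degree_ore_mult_le[of p q] by simp
qed

lemma coeff_Xpow_const: "poly.coeff ((X ^^ i) [:q:]) i = q"
  using lead_coeff_Xpow[of i "[:q:]"] by simp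

text \<open>The second term of \<open>x\<^sup>i\<^sup>+\<^sup>1 q = q x\<^sup>i\<^sup>+\<^sup>1 + (i + 1) \<delta>(q) x\<^sup>i + \<dots>\<close>.\<close>

lemma coeff_Xpow_const_below: "poly.coeff ((X ^^ Suc i) [:q:]) i = of_nat (Suc i) * \<delta> q"
proof (induction i)
  case 0
  show ?case by (simp add: coeff_X)
next
  case (Suc i)
  have "poly.coeff ((X ^^ Suc (Suc i)) [:q:]) (Suc i) =
      poly.coeff ((X ^^ Suc i) [:q:]) i + \<delta> (poly.coeff ((X ^^ Suc i) [:q:]) (Suc i))"
    by (simp only: funpow.simps comp_apply coeff_X nat.case)
  also have "\<dots> = of_nat (Suc (Suc i)) * \<delta> q"
    unfolding Suc.IH coeff_Xpow_const by (simp add: algebra_simps)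
  finally show ?case .
qed

lemma ore_mult_scalar: "ore_mult \<delta> p [:lconst c:] = Polynomial.smult (lconst c) p"
  using ore_const_central[of g p c] ore_mult_const by (simp flip: \<delta>_eq)

lemma X_eq_mult: "X q = ore_mult \<delta> [:0, 1:] q"
proof -
  have "X 1 = [:0, 1:]" using Xpow_one[of 1] by (simp add: monom_Suc)
  then show ?thesis using X_ore_mult[of 1 q] by (simp add: ore_mult_one_left)
qed

section \<open>Consequences of the simplicity of the Ore extension\<close>

text \<open>The elements of \<open>K[x, \<delta>]\<close> with all coefficients in a \<open>\<delta>\<close>-stable ideal \<open>J\<close> of \<open>K\<close> form a two-sided
  ideal.\<close>

lemma \<delta>_stable_ideal:
  assumes simple: "simple_ring (ore_ext \<delta>)"
    and J: "0 \<in> J" "\<And>a b. a \<in> J \<Longrightarrow> b \<in> J \<Longrightarrow> a + b \<in> J" "\<And>a b. a \<in> J \<Longrightarrow> a * b \<in> J"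
    and \<delta>: "\<And>a. a \<in> J \<Longrightarrow> \<delta> a \<in> J"
  shows "J = {0} \<or> J = UNIV"
proof -
  define I where "I = {p. \<forall>j. poly.coeff p j \<in> J}"
  have sum: "sum f A \<in> J" if "\<And>i. i \<in> A \<Longrightarrow> f i \<in> J" for f :: "nat \<Rightarrow> _" and A
    using that by (induction A rule: infinite_finite_induct) (auto intro: J)
  have IX: "(X ^^ i) q \<in> I" if "q \<in> I" for i q
    using that
    by (induction i) (auto simp: I_def coeff_X split: nat.split intro!: J(2) \<delta> simp: J(1))
  have IL: "ore_mult \<delta> p q \<in> I" if "q \<in> I" for p q
    using IX[OF that] J(3)
    by (auto simp: I_def ore_mult_def coeff_sum mult.commute intro!: sum) (metis mult.commute)
  have IR: "ore_mult \<delta> p q \<in> I" if "p \<in> I" for p q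
    using that J(3) by (auto simp: I_def ore_mult_def coeff_sum intro!: sum)
  have neg: "- a \<in> J" if "a \<in> J" for a using J(3)[OF that, of "- 1"] by simp
  interpret R: ring "ore_ext \<delta>" by (rule ring_ore_ext)
  have ainv: "inv\<^bsub>add_monoid (ore_ext \<delta>)\<^esub> p = - p" for p
    using R.minus_equality[of "- p" p] by (simp add: ore_ext_def a_inv_def)
  have "ideal I (ore_ext \<delta>)"
  proof (rule idealI)
    show "ring (ore_ext \<delta>)" by (rule ring_ore_ext)
    show "subgroup I (add_monoid (ore_ext \<delta>))"
    proof (rule subgroup.intro)
      show "I \<subseteq> carrier (add_monoid (ore_ext \<delta>))" by (simp add: ore_ext_def)
      show "inv\<^bsub>add_monoid (ore_ext \<delta>)\<^esub> p \<in> I" if "p \<in> I" for p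
        using that neg unfolding ainv by (auto simp: I_def)
    qed (auto simp: I_def ore_ext_def J)
  qed (use IL IR in \<open>auto simp: ore_ext_def\<close>)
  with simple have "I = {0} \<or> I = UNIV"
    unfolding simple_ring_def by (auto simp: ore_ext_def)
  then show ?thesis
  proof
    assume I0: "I = {0}"
    have "a = 0" if "a \<in> J" for a
    proof -
      have "[:a:] \<in> I" using that J(1) by (auto simp: I_def coeff_pCons split: nat.split)
      then show ?thesis using I0 by simp
    qed
    then show ?thesis using J(1) by auto
  next
    assume I1: "I = UNIV"
    have "a \<in> J" for a
    proof -
      have "[:a:] \<in> I" using I1 by simp
      then show ?thesis by (auto simp: I_def dest: spec[of _ 0])
    qed
    then show ?thesis by auto
  qed
qed

text \<open>If \<open>N = 0\<close> in \<open>k\<close>, then \<open>\<delta>\<close> annihilates \<open>x\<^sub>i\<^sup>N - 1\<close>, which therefore generates a \<open>\<delta>\<close>-stable ideal.  This ideal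
  is proper because a unit has only one term.\<close>

lemma of_nat_nonzero_if_simple:
  assumes simple: "simple_ring (ore_ext \<delta>)" and "N > 0"
  shows "(of_nat N :: 'k) \<noteq> 0"
proof
  assume N: "(of_nat N :: 'k) = 0"
  fix i :: 'n
  define y :: "('k, 'n) laurent" where "y = Poly_Mapping.single (axis i (int N)) 1 - 1"
  have \<delta>y: "\<delta> y = 0"
  proof -
    have "lpartial l y = 0" for l
    proof -
      have "y = Poly_Mapping.single (axis i (int N)) 1 + lconst (- 1)"
        by (simp add: y_def lconst_def single_uminus)
      moreover have "(of_int (axis i (int N) $ l) :: 'k) = 0"
        using N by (auto simp: axis_def)
      ultimately show ?thesis
        by (simp only: lpartial_add lpartial_lconst lpartial_single) simp
    qed
    then show ?thesis by (simp add: \<delta>_eq)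
  qed
  have ne: "axis i (int N) \<noteq> (0 :: (int, 'n) vec)" using \<open>N > 0\<close> by (simp add: axis_eq_0_iff)
  have keys: "axis i (int N) \<in> Poly_Mapping.keys y" "0 \<in> Poly_Mapping.keys y"
    using ne by (auto simp: y_def in_keys_iff lookup_minus lookup_single lookup_one when_def)
  have "range ((*) y) = {0} \<or> range ((*) y) = UNIV"
  proof (rule \<delta>_stable_ideal[OF simple])
    show "0 \<in> range ((*) y)" by (metis mult_zero_right rangeI)
    show "a + b \<in> range ((*) y)" if "a \<in> range ((*) y)" "b \<in> range ((*) y)" for a b
      using that by (auto simp flip: distrib_left)
    show "a * b \<in> range ((*) y)" if "a \<in> range ((*) y)" for a b
      using that by (auto simp: mult.assoc)
    show "\<delta> a \<in> range ((*) y)" if "a \<in> range ((*) y)" for a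
      using that \<delta>y by (auto simp: mult)
  qed
  moreover have "y * 1 \<noteq> 0" using keys(2) by auto
  ultimately have "range ((*) y) = UNIV" by blast
  then obtain h where "y * h = 1" by (metis UNIV_I imageE)
  from laurent_unit_single_exponent[OF this keys] show False using ne by simp
qed

end

section \<open>Laurent polynomials in some of the variables\<close>

definition vars_subring :: "'n set \<Rightarrow> ('k::field, 'n::finite) laurent set" where
  "vars_subring S = {f. \<forall>\<alpha>. Poly_Mapping.lookup f \<alpha> \<noteq> 0 \<longrightarrow> (\<forall>i. i \<notin> S \<longrightarrow> \<alpha> $ i = 0)}"

lemma vars_subring_add:
  "f \<in> vars_subring S \<Longrightarrow> h \<in> vars_subring S \<Longrightarrow> f + h \<in> vars_subring S"
  by (auto simp: vars_subring_def lookup_add) (metis add_0)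

lemma vars_subring_uminus: "f \<in> vars_subring S \<Longrightarrow> - f \<in> vars_subring S"
  by (auto simp: vars_subring_def)

lemma vars_subring_diff:
  "f \<in> vars_subring S \<Longrightarrow> h \<in> vars_subring S \<Longrightarrow> f - h \<in> vars_subring S"
  using vars_subring_add[OF _ vars_subring_uminus, of f S h] by simp

lemma vars_subring_mult:
  assumes "f \<in> vars_subring S" "h \<in> vars_subring S"
  shows "f * h \<in> vars_subring S"
  unfolding vars_subring_def
proof (intro CollectI allI impI)
  fix \<gamma> i assume "Poly_Mapping.lookup (f * h) \<gamma> \<noteq> 0" "i \<notin> S"
  then show "\<gamma> $ i = 0"
    using assms by (elim keys_laurent_mult_le) (auto simp: vars_subring_def)
qed

lemma vars_subring_single: "(\<And>i. i \<notin> S \<Longrightarrow> \<alpha> $ i = 0) \<Longrightarrow> Poly_Mapping.single \<alpha> c \<in> vars_subring S"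
  by (auto simp: vars_subring_def lookup_single when_def split: if_splits)

lemma vars_subring_lconst [simp]: "lconst c \<in> vars_subring S"
  unfolding lconst_def by (rule vars_subring_single) simp

lemma vars_subring_0 [simp]: "0 \<in> vars_subring S"
  by (simp add: vars_subring_def)

lemma vars_subring_1 [simp]: "1 \<in> vars_subring S"
  using vars_subring_lconst[of 1] by (simp add: lconst_def)

lemma vars_subring_power: "f \<in> vars_subring S \<Longrightarrow> f ^ N \<in> vars_subring S"
  by (induction N) (auto intro: vars_subring_mult)

lemma vars_subring_UNIV [simp]: "f \<in> vars_subring UNIV"
  by (simp add: vars_subring_def)

lemma vars_subring_empty:
  assumes "f \<in> vars_subring {}"
  obtains c where "f = lconst c"
proof -
  have "f = lconst (Poly_Mapping.lookup f 0)"
    using assms by (intro poly_mapping_eqI)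
      (auto simp: vars_subring_def lconst_def lookup_single when_def, metis vec_eq_iff zero_index)
  then show ?thesis using that by blast
qed

text \<open>The sum starts at the lowest exponent \<open>lo\<close> of the variable that occurs in \<open>f\<close> and ends at the
  highest one, so that the first and the last coefficient are nonzero.\<close>

lemma expand_in_variable:
  fixes f :: "('k::field, 'n::finite) laurent"
  assumes "f \<in> vars_subring (insert i S)" "f \<noteq> 0" "i \<notin> S"
  obtains lo :: int and c :: "nat \<Rightarrow> ('k, 'n) laurent" and d :: nat
  where "f = (\<Sum>t\<le>d. Poly_Mapping.single (axis i (lo + int t)) 1 * c t)"
    "\<And>t. c t \<in> vars_subring S" "c 0 \<noteq> 0" "c d \<noteq> 0"
proof -
  define T where "T = (\<lambda>\<alpha>. \<alpha> $ i) ` Poly_Mapping.keys f"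
  have T: "finite T" "T \<noteq> {}"
    unfolding T_def using assms(2) laurent_as_sum[of f] by auto
  define b where "b t = (\<Sum>\<alpha> | \<alpha> \<in> Poly_Mapping.keys f \<and> \<alpha> $ i = t.
    Poly_Mapping.single (\<alpha> - axis i t) (Poly_Mapping.lookup f \<alpha>))" for t
  have lookup_b: "Poly_Mapping.lookup (b t) \<beta> =
      (if \<beta> $ i = 0 then Poly_Mapping.lookup f (\<beta> + axis i t) else 0)" for t \<beta>
  proof -
    have "Poly_Mapping.lookup (b t) \<beta> = (\<Sum>\<alpha> | \<alpha> \<in> Poly_Mapping.keys f \<and> \<alpha> $ i = t.
      if \<alpha> = \<beta> + axis i t then Poly_Mapping.lookup f \<alpha> else 0)"
      unfolding b_def lookup_sum
      by (intro sum.cong) (auto simp: lookup_single when_def algebra_simps)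
    also have "\<dots> = (if \<beta> $ i = 0 then Poly_Mapping.lookup f (\<beta> + axis i t) else 0)"
      by (subst sum.delta) (auto simp: in_keys_iff axis_def)
    finally show ?thesis .
  qed
  have b_in: "b t \<in> vars_subring S" for t
    unfolding vars_subring_def
  proof (intro CollectI allI impI)
    fix \<beta> l assume "Poly_Mapping.lookup (b t) \<beta> \<noteq> 0" and l: "l \<notin> S"
    then have 0: "\<beta> $ i = 0" "Poly_Mapping.lookup f (\<beta> + axis i t) \<noteq> 0"
      unfolding lookup_b by (auto split: if_splits)
    show "\<beta> $ l = 0"
    proof (cases "l = i")
      case False
      with l assms(1) 0(2) have "(\<beta> + axis i t) $ l = 0" by (auto simp: vars_subring_def)
      with False show ?thesis by (simp add: axis_def)
    qed (use 0 in simp)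
  qed
  have b_nz: "b t \<noteq> 0" if "t \<in> T" for t
  proof -
    from that obtain \<alpha> where "\<alpha> \<in> Poly_Mapping.keys f" "\<alpha> $ i = t" by (auto simp: T_def)
    then have "Poly_Mapping.lookup (b t) (\<alpha> - axis i t) \<noteq> 0" by (auto simp: lookup_b axis_def in_keys_iff)
    then show ?thesis by force
  qed
  define lo where "lo = Min T"
  define d where "d = nat (Max T - lo)"
  have "lo \<le> Max T" using T by (simp add: lo_def)
  have "f = (\<Sum>t\<le>d. Poly_Mapping.single (axis i (lo + int t)) 1 * b (lo + int t))"
  proof (rule poly_mapping_eqI)
    fix \<alpha>
    have "Poly_Mapping.lookup (\<Sum>t\<le>d. Poly_Mapping.single (axis i (lo + int t)) 1 * b (lo + int t)) \<alpha>
       = (\<Sum>t\<le>d. if t = nat (\<alpha> $ i - lo) \<and> lo \<le> \<alpha> $ i then Poly_Mapping.lookup f \<alpha> else 0)"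
      unfolding lookup_sum lookup_single_mult lookup_b by (intro sum.cong) (auto simp: axis_def)
    also have "\<dots> = Poly_Mapping.lookup f \<alpha>"
    proof (cases "\<alpha> \<in> Poly_Mapping.keys f")
      case True
      then have "\<alpha> $ i \<in> T" by (simp add: T_def)
      then have "lo \<le> \<alpha> $ i" "\<alpha> $ i \<le> Max T" using T by (auto simp: lo_def)
      then show ?thesis by (simp add: d_def nat_mono)
    next
      case False
      then have "Poly_Mapping.lookup f \<alpha> = 0" by (simp add: in_keys_iff)
      then show ?thesis by (simp cong: if_cong)
    qed
    finally show "Poly_Mapping.lookup f \<alpha> = Poly_Mapping.lookup
      (\<Sum>t\<le>d. Poly_Mapping.single (axis i (lo + int t)) 1 * b (lo + int t)) \<alpha>" ..
  qed
  moreover have "b (lo + int 0) \<noteq> 0" using T by (intro b_nz) (simp add: lo_def)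
  moreover have "b (lo + int d) \<noteq> 0" using T \<open>lo \<le> Max T\<close> by (intro b_nz) (simp add: d_def)
  ultimately show ?thesis using that[of lo "\<lambda>t. b (lo + int t)" d] b_in by blast
qed

section \<open>Simple modules over the Ore extension\<close>

locale simple_laurent_ore_module = laurent_ore g \<delta>
  for g :: "'n::finite \<Rightarrow> ('k::field, 'n) laurent" and \<delta> +
  fixes act :: "'m::ab_group_add \<Rightarrow> ('k, 'n) laurent poly \<Rightarrow> 'm"
  assumes simple: "simple_ring (ore_ext \<delta>)"
    and M: "simple_right_module (ore_ext \<delta>) act"
begin

lemma act_add_left: "act (v + w) p = act v p + act w p"
  and act_add_right: "act v (p + q) = act v p + act v q"
  and act_ore_mult: "act v (ore_mult \<delta> p q) = act (act v p) q"
  and act_one: "act v 1 = v"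
proof -
  interpret right_module "ore_ext \<delta>" act using M by (simp add: simple_right_module_def)
  show "act (v + w) p = act v p + act w p" "act v (p + q) = act v p + act v q"
    "act v (ore_mult \<delta> p q) = act (act v p) q" "act v 1 = v"
    using act_add_left[of p v w] act_add_right[of p q v] act_mult[of p q v] act_one[of v]
    by (simp_all add: ore_ext_def)
qed

lemma act_zero_left [simp]: "act 0 p = 0"
  using act_add_left[of 0 0 p] by simp

lemma act_zero_right [simp]: "act v 0 = 0"
  using act_add_right[of v 0 0] by simp

lemma act_uminus_right: "act v (- p) = - act v p"
  using act_add_right[of v p "- p"] by (simp add: eq_neg_iff_add_eq_0 add.commute)

lemma act_diff_right: "act v (p - q) = act v p - act v q"
  using act_add_right[of v p "- q"] by (simp add: act_uminus_right)

lemma act_sum_right: "act v (sum f A) = (\<Sum>i\<in>A. act v (f i))"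
  by (induction A rule: infinite_finite_induct) (simp_all add: act_add_right)

lemma act_sum_left: "act (sum f A) p = (\<Sum>i\<in>A. act (f i) p)"
  by (induction A rule: infinite_finite_induct) (simp_all add: act_add_left)

lemma cyclic:
  assumes "w \<noteq> 0"
  obtains p where "u = act w p"
proof -
  have "right_submodule (ore_ext \<delta>) act (range (act w))"
    unfolding right_submodule_def
    by (auto simp: ore_ext_def simp flip: act_add_right act_ore_mult) (metis act_zero_right rangeI)
  moreover have "w \<in> range (act w)" by (metis act_one rangeI)
  ultimately have "range (act w) = UNIV"
    using M assms unfolding simple_right_module_def by (metis singletonD)
  then show ?thesis using that by (metis UNIV_I imageE)
qed

lemma nonzero_exists: "\<exists>w :: 'm. w \<noteq> 0"
  using M by (auto simp: simple_right_module_def)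

abbreviation kact :: "'m \<Rightarrow> ('k, 'n) laurent \<Rightarrow> 'm" (infixl \<open>\<star>\<close> 70) where
  "v \<star> f \<equiv> act v [:f:]"

lemma kact_mult: "v \<star> (f * h) = v \<star> f \<star> h"
  using act_ore_mult[of v "[:f:]" "[:h:]"] by (simp add: ore_mult_const)

lemma kact_commute: "v \<star> f \<star> h = v \<star> h \<star> f"
  by (metis kact_mult mult.commute)

lemma kact_add: "v \<star> (f + h) = v \<star> f + v \<star> h"
  using act_add_right[of v "[:f:]" "[:h:]"] by simp

lemma kact_diff: "v \<star> (f - h) = v \<star> f - v \<star> h"
  using act_diff_right[of v "[:f:]" "[:h:]"] by simp

lemma kact_uminus: "v \<star> (- f) = - (v \<star> f)"
  using act_uminus_right[of v "[:f:]"] by simp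

lemma kact_one [simp]: "v \<star> 1 = v"
  using act_one by (simp add: one_pCons)

lemma kact_sum: "v \<star> (sum f A) = (\<Sum>i\<in>A. v \<star> f i)"
  by (induction A rule: infinite_finite_induct) (simp_all add: kact_add)

definition xact :: "'m \<Rightarrow> 'm" where "xact v = act v [:0, 1:]"

lemma xact_zero [simp]: "xact 0 = 0"
  by (simp add: xact_def)

lemma xact_pow_zero [simp]: "(xact ^^ j) 0 = 0"
  by (induction j) simp_all

lemma act_X: "act v (X q) = act (xact v) q"
  by (simp only: X_eq_mult act_ore_mult xact_def)

lemma act_Xpow: "act v ((X ^^ i) q) = act ((xact ^^ i) v) q"
  by (induction i arbitrary: v) (simp_all add: act_X funpow_swap1[where f = xact])

lemma act_monom: "act v (Polynomial.monom f j) = (xact ^^ j) (v \<star> f)"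
  using act_ore_mult[of v "[:f:]" "(X ^^ j) 1"]
  by (simp add: ore_mult_const_x_pow act_Xpow act_one)

lemma act_expand: "act v p = (\<Sum>j\<le>degree p. (xact ^^ j) (v \<star> poly.coeff p j))"
proof -
  have "act v p = act v (\<Sum>j\<le>degree p. Polynomial.monom (poly.coeff p j) j)"
    by (simp add: poly_as_sum_of_monoms)
  then show ?thesis by (simp add: act_sum_right act_monom)
qed

section \<open>Torsion with respect to some of the variables\<close>

definition torsion_free :: "'n set \<Rightarrow> bool" where
  "torsion_free S \<longleftrightarrow> (\<forall>v f. f \<in> vars_subring S \<longrightarrow> v \<star> f = 0 \<longrightarrow> v = 0 \<or> f = 0)"

lemma torsion_freeD: "torsion_free S \<Longrightarrow> f \<in> vars_subring S \<Longrightarrow> v \<star> f = 0 \<Longrightarrow> f \<noteq> 0 \<Longrightarrow> v = 0"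
  by (auto simp: torsion_free_def)

text \<open>The torsion elements are closed under \<open>x\<close>, because \<open>x e\<^sup>2 = e (e x + 2 \<delta>(e))\<close> lies in
  \<open>e K[x, \<delta>]\<close>.  They form a submodule, which is everything once it is nonzero.\<close>

lemma torsion_dichotomy:
  assumes "\<not> torsion_free S"
  obtains f where "f \<in> vars_subring S" "f \<noteq> 0" "w \<star> f = 0"
proof -
  define T where "T = {w. \<exists>f \<in> vars_subring S. f \<noteq> 0 \<and> w \<star> f = 0}"
  have zero: "0 \<in> T" unfolding T_def by (auto intro!: bexI[of _ 1])
  have add: "v + w \<in> T" if vw: "v \<in> T" "w \<in> T" for v w
  proof -
    obtain e where e: "e \<in> vars_subring S" "e \<noteq> 0" "v \<star> e = 0" using vw(1) by (auto simp: T_def)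
    obtain f where f: "f \<in> vars_subring S" "f \<noteq> 0" "w \<star> f = 0" using vw(2) by (auto simp: T_def)
    have "v \<star> (e * f) = 0" "w \<star> (e * f) = 0"
      using kact_mult[of v e f] kact_mult[of w f e] e(3) f(3) by (simp_all add: mult.commute)
    then have "(v + w) \<star> (e * f) = 0" by (simp add: act_add_left)
    then show ?thesis
      using e f unfolding T_def by (auto intro!: bexI[of _ "e * f"] vars_subring_mult simp: laurent_mult_eq_0_iff)
  qed
  have kact: "v \<star> a \<in> T" if v: "v \<in> T" for v a
  proof -
    obtain e where "e \<in> vars_subring S" "e \<noteq> 0" "v \<star> e = 0" using v by (auto simp: T_def)
    then show ?thesis unfolding T_def using kact_commute[of v a e] by (auto intro!: bexI[of _ e])
  qed
  have x: "xact v \<in> T" if v: "v \<in> T" for v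
  proof -
    obtain e where e: "e \<in> vars_subring S" "e \<noteq> 0" "v \<star> e = 0" using v by (auto simp: T_def)
    have "xact v \<star> (e * e) = act v (ore_mult \<delta> [:e:] [:2 * \<delta> e, e:])"
      by (simp add: xact_def flip: act_ore_mult)
        (simp add: ore_mult_x_const ore_mult_const mult algebra_simps)
    then have "xact v \<star> (e * e) = 0" by (simp add: act_ore_mult e(3))
    then show ?thesis
      using e unfolding T_def by (auto intro!: bexI[of _ "e * e"] vars_subring_mult simp: laurent_mult_eq_0_iff)
  qed
  have xpow: "(xact ^^ j) v \<in> T" if "v \<in> T" for v j
    using that by (induction j) (auto intro: x)
  have sum: "sum f A \<in> T" if "\<And>i. i \<in> A \<Longrightarrow> f i \<in> T" for f :: "nat \<Rightarrow> _" and A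
    using that by (induction A rule: infinite_finite_induct) (auto intro: zero add)
  have actT: "act v p \<in> T" if "v \<in> T" for v p
    by (subst act_expand) (intro sum xpow kact that)
  have "right_submodule (ore_ext \<delta>) act T"
    unfolding right_submodule_def by (auto intro!: zero add actT)
  moreover have "T \<noteq> {0}" using assms unfolding torsion_free_def T_def by blast
  ultimately have "w \<in> T" using M unfolding simple_right_module_def by blast
  then show ?thesis using that by (auto simp: T_def)
qed

text \<open>The submodules over \<open>K\<^sub>S\<close> for which the quotient is torsion-free.  Membership in such a submodule is
  membership in a subspace of the localisation at the nonzero elements of \<open>K\<^sub>S\<close>, which thus need not
  be constructed.\<close>

definition saturated :: "'n set \<Rightarrow> 'm set \<Rightarrow> bool" where
  "saturated S N \<longleftrightarrow> 0 \<in> N \<and> (\<forall>u\<in>N. \<forall>v\<in>N. u + v \<in> N) \<and> (\<forall>u\<in>N. \<forall>a\<in>vars_subring S. u \<star> a \<in> N) \<and>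
     (\<forall>u. \<forall>a\<in>vars_subring S. a \<noteq> 0 \<longrightarrow> u \<star> a \<in> N \<longrightarrow> u \<in> N)"

lemma saturated_zero: "saturated S N \<Longrightarrow> 0 \<in> N"
  and saturated_add: "saturated S N \<Longrightarrow> u \<in> N \<Longrightarrow> v \<in> N \<Longrightarrow> u + v \<in> N"
  and saturated_kact: "saturated S N \<Longrightarrow> u \<in> N \<Longrightarrow> a \<in> vars_subring S \<Longrightarrow> u \<star> a \<in> N"
  and saturated_divide:
    "saturated S N \<Longrightarrow> u \<star> a \<in> N \<Longrightarrow> a \<in> vars_subring S \<Longrightarrow> a \<noteq> 0 \<Longrightarrow> u \<in> N"
  unfolding saturated_def by blast+

lemma saturated_sum: "saturated S N \<Longrightarrow> (\<And>i. i \<in> A \<Longrightarrow> f i \<in> N) \<Longrightarrow> sum f A \<in> N"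
  by (induction A rule: infinite_finite_induct) (simp_all add: saturated_zero saturated_add)

lemma saturated_uminus: "saturated S N \<Longrightarrow> u \<in> N \<Longrightarrow> - u \<in> N"
  using saturated_kact[of S N u "- 1"] by (simp only: kact_uminus kact_one vars_subring_uminus vars_subring_1)

lemma saturated_relation:
  assumes N: "saturated S N" and fin: "finite A" "t0 \<in> A" and rel: "(\<Sum>t\<in>A. u t \<star> c t) = 0"
    and c: "\<And>t. c t \<in> vars_subring S" "c t0 \<noteq> 0" and u: "\<And>t. t \<in> A \<Longrightarrow> t \<noteq> t0 \<Longrightarrow> u t \<in> N"
  shows "u t0 \<in> N"
proof -
  have "u t0 \<star> c t0 = - (\<Sum>t\<in>A - {t0}. u t \<star> c t)"
    using rel fin by (simp add: sum.remove eq_neg_iff_add_eq_0)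
  moreover have "(\<Sum>t\<in>A - {t0}. u t \<star> c t) \<in> N"
    by (intro saturated_sum[OF N] saturated_kact[OF N] u c(1)) auto
  ultimately have "u t0 \<star> c t0 \<in> N" using saturated_uminus[OF N] by simp
  then show ?thesis by (rule saturated_divide[OF N _ c])
qed

text \<open>The monomials \<open>w x\<^sup>\<gamma> x\<^sub>i\<^sup>t\<close> satisfy a linear recurrence in \<open>t\<close> with coefficients in \<open>K\<^sub>S\<close>; its first and last
  coefficients are nonzero, so that it can be run in both directions.\<close>

lemma variable_recurrence:
  assumes "\<not> torsion_free (insert i S)" "i \<notin> S"
  obtains d :: nat and c :: "nat \<Rightarrow> ('k, 'n) laurent"
  where "\<And>\<gamma>. (\<Sum>t\<le>d. w \<star> Poly_Mapping.single (\<gamma> + axis i (int t)) 1 \<star> c t) = 0"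
    "\<And>t. c t \<in> vars_subring S" "c 0 \<noteq> 0" "c d \<noteq> 0"
proof -
  obtain f where f: "f \<in> vars_subring (insert i S)" "f \<noteq> 0" "w \<star> f = 0"
    by (rule torsion_dichotomy[OF assms(1), of w])
  obtain lo :: int and c d where *: "f = (\<Sum>t\<le>d. Poly_Mapping.single (axis i (lo + int t)) 1 * c t)"
    "\<And>t. c t \<in> vars_subring S" "c 0 \<noteq> 0" "c d \<noteq> 0"
    by (rule expand_in_variable[OF f(1,2) assms(2)]) (rule that, assumption+)
  have "(\<Sum>t\<le>d. w \<star> Poly_Mapping.single (\<gamma> + axis i (int t)) 1 \<star> c t) = 0" for \<gamma>
  proof -
    have ax: "axis i (lo + int t) = axis i lo + axis i (int t)" for t
      by (simp add: axis_def vec_eq_iff)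
    have "Poly_Mapping.single (\<gamma> - axis i lo) 1 * f =
       (\<Sum>t\<le>d. Poly_Mapping.single (\<gamma> + axis i (int t)) 1 * c t)"
      by (subst *(1)) (simp add: sum_distrib_left mult_single ax flip: mult.assoc)
    then have "(\<Sum>t\<le>d. w \<star> Poly_Mapping.single (\<gamma> + axis i (int t)) 1 \<star> c t) =
        w \<star> (Poly_Mapping.single (\<gamma> - axis i lo) 1 * f)"
      by (simp add: kact_sum kact_mult)
    also have "\<dots> = w \<star> f \<star> Poly_Mapping.single (\<gamma> - axis i lo) 1"
      by (simp only: mult.commute kact_mult[symmetric])
    finally show ?thesis using f(3) by simp
  qed
  then show ?thesis by (rule that) (use * in auto)
qed

text \<open>By the recurrences, the monomials whose exponents outside \<open>S\<close> lie in a finite box generate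
  all monomials up to \<open>K\<^sub>S\<close>-torsion.  The restriction to the box is lifted for one variable after
  the other.\<close>

lemma finitely_generated_up_to_torsion:
  assumes tors: "\<And>i. i \<notin> S \<Longrightarrow> \<not> torsion_free (insert i S)"
  obtains G where "finite G" "G \<subseteq> range ((\<star>) w)"
    "\<And>N f. saturated S N \<Longrightarrow> G \<subseteq> N \<Longrightarrow> w \<star> f \<in> N"
proof -
  define mon where "mon \<alpha> = w \<star> Poly_Mapping.single \<alpha> 1" for \<alpha> :: "(int, 'n) vec"
  have "\<exists>d c. i \<notin> S \<longrightarrow> (\<forall>\<gamma>. (\<Sum>t\<le>d. mon (\<gamma> + axis i (int t)) \<star> c t) = 0) \<and>
    (\<forall>t. c t \<in> vars_subring S) \<and> c 0 \<noteq> 0 \<and> c d \<noteq> 0" for i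
  proof (cases "i \<in> S")
    case False
    obtain d c where "\<And>\<gamma>. (\<Sum>t\<le>d. mon (\<gamma> + axis i (int t)) \<star> c t) = 0"
      "\<And>t. c t \<in> vars_subring S" "c 0 \<noteq> 0" "c d \<noteq> 0"
      by (rule variable_recurrence[OF tors[OF False] False, of w, folded mon_def]) (rule that, assumption+)
    then show ?thesis by (intro exI[of _ d] exI[of _ c]) simp
  qed simp
  then have "\<forall>i. \<exists>d c. i \<notin> S \<longrightarrow> (\<forall>\<gamma>. (\<Sum>t\<le>d. mon (\<gamma> + axis i (int t)) \<star> c t) = 0) \<and>
    (\<forall>t. c t \<in> vars_subring S) \<and> c 0 \<noteq> 0 \<and> c d \<noteq> 0" ..
  from choice[OF this] obtain d where
    "\<forall>i. \<exists>c. i \<notin> S \<longrightarrow> (\<forall>\<gamma>. (\<Sum>t\<le>d i. mon (\<gamma> + axis i (int t)) \<star> c t) = 0) \<and>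
    (\<forall>t. c t \<in> vars_subring S) \<and> c 0 \<noteq> 0 \<and> c (d i) \<noteq> 0" ..
  from choice[OF this] obtain c where
    "\<forall>i. i \<notin> S \<longrightarrow> (\<forall>\<gamma>. (\<Sum>t\<le>d i. mon (\<gamma> + axis i (int t)) \<star> c i t) = 0) \<and>
    (\<forall>t. c i t \<in> vars_subring S) \<and> c i 0 \<noteq> 0 \<and> c i (d i) \<noteq> 0" ..
  then have dc: "\<And>i \<gamma>. i \<notin> S \<Longrightarrow> (\<Sum>t\<le>d i. mon (\<gamma> + axis i (int t)) \<star> c i t) = 0"
      "\<And>i t. i \<notin> S \<Longrightarrow> c i t \<in> vars_subring S" "\<And>i. i \<notin> S \<Longrightarrow> c i 0 \<noteq> 0"
      "\<And>i. i \<notin> S \<Longrightarrow> c i (d i) \<noteq> 0"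
    by blast+
  \<comment> \<open>The box: by its recurrence, the powers of \<open>x\<^sub>i\<close> below \<open>d i\<close> suffice.\<close>
  define B where "B = {\<beta> :: (int, 'n) vec. \<forall>i. if i \<in> S then \<beta> $ i = 0 else 0 \<le> \<beta> $ i \<and> \<beta> $ i < int (d i)}"
  have "d i \<le> sum d UNIV" for i by (rule member_le_sum) auto
  then have d: "int (d i) \<le> int (sum d UNIV)" for i by (simp only: of_nat_le_iff)
  have "B \<subseteq> exponent_box (sum d UNIV)"
  proof
    fix \<beta> assume "\<beta> \<in> B"
    then have "\<bar>\<beta> $ i\<bar> \<le> int (d i)" for i by (auto simp: B_def dest: spec[of _ i] split: if_splits)
    then show "\<beta> \<in> exponent_box (sum d UNIV)" using d order_trans unfolding exponent_box_def by blast
  qed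
  then have "finite B" by (rule finite_subset) simp
  moreover have "w \<star> f \<in> N" if N: "saturated S N" "mon ` B \<subseteq> N" for N f
  proof -
    have "\<forall>\<alpha>. (\<forall>i. i \<notin> S \<and> i \<notin> T \<longrightarrow> 0 \<le> \<alpha> $ i \<and> \<alpha> $ i < int (d i)) \<longrightarrow> mon \<alpha> \<in> N"
      if "finite T" "T \<inter> S = {}" for T :: "'n set"
      using that
    proof (induction T)
      case empty
      show ?case
      proof (intro allI impI)
        fix \<alpha> assume \<alpha>: "\<forall>i. i \<notin> S \<and> i \<notin> {} \<longrightarrow> 0 \<le> \<alpha> $ i \<and> \<alpha> $ i < int (d i)"
        define \<beta> :: "(int, 'n) vec" where "\<beta> = (\<chi> i. if i \<in> S then 0 else \<alpha> $ i)"
        have "mon \<beta> \<in> N" using N(2) \<alpha> by (auto simp: B_def \<beta>_def)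
        moreover have "Poly_Mapping.single (\<alpha> - \<beta>) 1 \<in> vars_subring S"
          by (rule vars_subring_single) (simp add: \<beta>_def)
        ultimately have "mon \<beta> \<star> Poly_Mapping.single (\<alpha> - \<beta>) 1 \<in> N"
          by (rule saturated_kact[OF N(1)])
        then show "mon \<alpha> \<in> N" by (simp add: mon_def mult_single flip: kact_mult)
      qed
    next
      case (insert i T)
      have iS: "i \<notin> S" and IH: "\<And>\<alpha>. (\<forall>i. i \<notin> S \<and> i \<notin> T \<longrightarrow> 0 \<le> \<alpha> $ i \<and> \<alpha> $ i < int (d i)) \<Longrightarrow> mon \<alpha> \<in> N"
        using insert by auto
      show ?case
      proof (intro allI impI)
        fix \<alpha> assume \<alpha>: "\<forall>l. l \<notin> S \<and> l \<notin> insert i T \<longrightarrow> 0 \<le> \<alpha> $ l \<and> \<alpha> $ l < int (d l)"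
        define \<beta> where "\<beta> k = \<alpha> + axis i (k - \<alpha> $ i)" for k
        have \<beta>: "\<beta> k $ l = (if l = i then k else \<alpha> $ l)" for k l
          by (simp add: \<beta>_def axis_def)
        have \<beta>_add: "\<beta> k + axis i (int t) = \<beta> (k + int t)" for k t
          by (simp add: vec_eq_iff \<beta>) (simp add: axis_def)
        have rel: "(\<Sum>t\<le>d i. mon (\<beta> (k + int t)) \<star> c i t) = 0" for k
          using dc(1)[OF iS, of "\<beta> k"] by (simp add: \<beta>_add)
        \<comment> \<open>Beyond the box, solve the recurrence for its last term.\<close>
        have pos: "mon (\<beta> (int n)) \<in> N" for n
        proof (induction n rule: less_induct)
          case (less n)
          show ?case
          proof (cases "n < d i")
            case True
            then show ?thesis using \<alpha> by (intro IH) (auto simp: \<beta>)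
          next
            case False
            have "mon (\<beta> (int (n - d i) + int (d i))) \<in> N"
            proof (rule saturated_relation[OF N(1) _ _ rel dc(2)[OF iS] dc(4)[OF iS]])
              fix t assume "t \<in> {..d i}" "t \<noteq> d i"
              then have "mon (\<beta> (int (n - d i + t))) \<in> N" using False by (intro less) auto
              then show "mon (\<beta> (int (n - d i) + int t)) \<in> N" by simp
            qed simp_all
            then show ?thesis using False by (simp add: of_nat_diff)
          qed
        qed
        \<comment> \<open>For negative exponents, solve it for its first term.\<close>
        have neg: "mon (\<beta> (- int n)) \<in> N" for n
        proof (induction n rule: less_induct)
          case (less n)
          have "mon (\<beta> (- int n + int 0)) \<in> N"
          proof (rule saturated_relation[OF N(1) _ _ rel dc(2)[OF iS] dc(3)[OF iS]])
            fix t assume t: "t \<in> {..d i}" "t \<noteq> 0"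
            show "mon (\<beta> (- int n + int t)) \<in> N"
            proof (cases "n \<le> t")
              case True
              then have eq: "- int n + int t = int (t - n)" by linarith
              show ?thesis unfolding eq by (rule pos)
            next
              case False
              then have eq: "- int n + int t = - int (n - t)" by linarith
              show ?thesis unfolding eq by (rule less) (use False t in simp)
            qed
          qed simp_all
          then show ?case by simp
        qed
        have "mon (\<beta> (\<alpha> $ i)) \<in> N"
          using pos[of "nat (\<alpha> $ i)"] neg[of "nat (- \<alpha> $ i)"] by (cases "0 \<le> \<alpha> $ i") auto
        moreover have "\<beta> (\<alpha> $ i) = \<alpha>" by (simp add: vec_eq_iff \<beta>)
        ultimately show "mon \<alpha> \<in> N" by simp
      qed
    qed
    from this[of "- S"] have mon: "mon \<alpha> \<in> N" for \<alpha> by auto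
    have "w \<star> f = (\<Sum>\<alpha>\<in>Poly_Mapping.keys f. mon \<alpha> \<star> lconst (Poly_Mapping.lookup f \<alpha>))"
      by (subst laurent_as_sum[of f])
        (simp add: kact_sum mon_def lconst_def mult_single flip: kact_mult)
    moreover have "mon \<alpha> \<star> lconst a \<in> N" for \<alpha> a
      by (rule saturated_kact[OF N(1) mon vars_subring_lconst])
    ultimately show ?thesis by (simp only: saturated_sum[OF N(1)])
  qed
  ultimately show ?thesis using that[of "mon ` B"] by (auto simp: mon_def)
qed

section \<open>Minimal spanning families and their annihilators\<close>

text \<open>Families rather than sets of vectors: their members may coincide after multiplication by an element
  of \<open>K\<close>, and such a coincidence has to count as a dependence.\<close>

definition lin_comb :: "nat set \<Rightarrow> (nat \<Rightarrow> 'm) \<Rightarrow> (nat \<Rightarrow> ('k, 'n) laurent) \<Rightarrow> 'm" where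
  "lin_comb I e a = (\<Sum>i\<in>I. e i \<star> a i)"

lemma lin_comb_add: "lin_comb I e a + lin_comb I e b = lin_comb I e (\<lambda>i. a i + b i)"
  by (simp add: lin_comb_def kact_add sum.distrib)

lemma lin_comb_diff: "lin_comb I e a - lin_comb I e b = lin_comb I e (\<lambda>i. a i - b i)"
  by (simp add: lin_comb_def kact_diff sum_subtractf)

lemma lin_comb_kact: "lin_comb I e a \<star> f = lin_comb I e (\<lambda>i. a i * f)"
  by (simp add: lin_comb_def act_sum_left kact_mult)

lemma lin_comb_kact_family: "lin_comb I (\<lambda>i. e i \<star> f) a = lin_comb I e a \<star> f"
  unfolding lin_comb_def act_sum_left by (rule sum.cong) (auto simp: kact_commute)

lemma lin_comb_remove:
  "finite I \<Longrightarrow> l \<in> I \<Longrightarrow> lin_comb I e a = e l \<star> a l + lin_comb (I - {l}) e a"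
  by (simp add: lin_comb_def sum.remove)

definition span_on :: "'n set \<Rightarrow> nat set \<Rightarrow> (nat \<Rightarrow> 'm) \<Rightarrow> 'm set" where
  "span_on S I e = {lin_comb I e a | a. \<forall>i. a i \<in> vars_subring S}"

lemma span_onI: "(\<And>i. a i \<in> vars_subring S) \<Longrightarrow> lin_comb I e a \<in> span_on S I e"
  unfolding span_on_def by blast

lemma span_onE:
  assumes "u \<in> span_on S I e"
  obtains a where "\<And>i. a i \<in> vars_subring S" "u = lin_comb I e a"
  using assms unfolding span_on_def by blast

lemma span_on_zero: "0 \<in> span_on S I e"
  using span_onI[of "\<lambda>_. 0" S I e] by (simp add: lin_comb_def)

lemma span_on_add: "u \<in> span_on S I e \<Longrightarrow> v \<in> span_on S I e \<Longrightarrow> u + v \<in> span_on S I e"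
  by (elim span_onE) (simp only: lin_comb_add span_onI vars_subring_add)

lemma span_on_kact: "u \<in> span_on S I e \<Longrightarrow> f \<in> vars_subring S \<Longrightarrow> u \<star> f \<in> span_on S I e"
  by (elim span_onE) (simp only: lin_comb_kact span_onI vars_subring_mult)

lemma span_on_sum: "(\<And>x. x \<in> A \<Longrightarrow> f x \<in> span_on S I e) \<Longrightarrow> sum f A \<in> span_on S I e"
  by (induction A rule: infinite_finite_induct) (simp_all add: span_on_zero span_on_add)

lemma span_on_base: "finite I \<Longrightarrow> i \<in> I \<Longrightarrow> e i \<in> span_on S I e"
  using span_onI[of "\<lambda>l. if l = i then 1 else 0" S I e]
  by (simp add: lin_comb_def if_distrib[where f = "\<lambda>f. act _ [:f:]"] sum.delta cong: if_cong)

definition tspan_on :: "'n set \<Rightarrow> nat set \<Rightarrow> (nat \<Rightarrow> 'm) \<Rightarrow> 'm set" where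
  "tspan_on S I e = {u. \<exists>h \<in> vars_subring S. h \<noteq> 0 \<and> u \<star> h \<in> span_on S I e}"

lemma tspan_onI: "u \<star> h \<in> span_on S I e \<Longrightarrow> h \<in> vars_subring S \<Longrightarrow> h \<noteq> 0 \<Longrightarrow> u \<in> tspan_on S I e"
  unfolding tspan_on_def by blast

lemma tspan_onE:
  assumes "u \<in> tspan_on S I e"
  obtains h where "h \<in> vars_subring S" "h \<noteq> 0" "u \<star> h \<in> span_on S I e"
  using assms unfolding tspan_on_def by blast

lemma span_on_subset_tspan_on: "span_on S I e \<subseteq> tspan_on S I e"
  by (auto intro!: tspan_onI[where h = 1])

lemma saturated_tspan_on: "saturated S (tspan_on S I e)"
  unfolding saturated_def
proof (intro conjI ballI allI impI)
  show "0 \<in> tspan_on S I e" using span_on_subset_tspan_on span_on_zero by blast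
next
  fix u v assume "u \<in> tspan_on S I e" "v \<in> tspan_on S I e"
  then obtain h h' where h: "h \<in> vars_subring S" "h \<noteq> 0" "u \<star> h \<in> span_on S I e"
    and h': "h' \<in> vars_subring S" "h' \<noteq> 0" "v \<star> h' \<in> span_on S I e" by (elim tspan_onE)
  have "(u + v) \<star> (h * h') = u \<star> h \<star> h' + v \<star> h' \<star> h"
    by (simp only: act_add_left kact_mult kact_commute[of v h])
  then have "(u + v) \<star> (h * h') \<in> span_on S I e"
    using h h' by (simp only: span_on_add span_on_kact)
  then show "u + v \<in> tspan_on S I e"
    by (rule tspan_onI) (use h h' in \<open>auto simp: laurent_mult_eq_0_iff vars_subring_mult\<close>)
next
  fix u and a :: "('k, 'n) laurent" assume "u \<in> tspan_on S I e" and a: "a \<in> vars_subring S"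
  then obtain h where h: "h \<in> vars_subring S" "h \<noteq> 0" "u \<star> h \<in> span_on S I e" by (elim tspan_onE)
  have "u \<star> a \<star> h \<in> span_on S I e" unfolding kact_commute[of u a] by (intro span_on_kact h a)
  then show "u \<star> a \<in> tspan_on S I e" by (rule tspan_onI[OF _ h(1,2)])
next
  fix u and a :: "('k, 'n) laurent" assume a: "a \<in> vars_subring S" "a \<noteq> 0" and "u \<star> a \<in> tspan_on S I e"
  then obtain h where h: "h \<in> vars_subring S" "h \<noteq> 0" "u \<star> a \<star> h \<in> span_on S I e" by (elim tspan_onE)
  then have "u \<star> (a * h) \<in> span_on S I e" by (simp only: kact_mult)
  then show "u \<in> tspan_on S I e"
    by (rule tspan_onI) (use h a in \<open>auto simp: laurent_mult_eq_0_iff vars_subring_mult\<close>)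
qed

text \<open>The size of a smallest such family is the rank of \<open>w K\<close> over \<open>K\<^sub>S\<close>.\<close>

definition spanning_family :: "'n set \<Rightarrow> 'm \<Rightarrow> nat set \<Rightarrow> (nat \<Rightarrow> 'm) \<Rightarrow> bool" where
  "spanning_family S w I e \<longleftrightarrow> finite I \<and> (\<forall>i\<in>I. e i \<in> range ((\<star>) w)) \<and> range ((\<star>) w) \<subseteq> tspan_on S I e"

lemma spanning_family_exists:
  assumes "\<And>i. i \<notin> S \<Longrightarrow> \<not> torsion_free (insert i S)"
  obtains I e where "spanning_family S w I e"
proof -
  obtain G where G: "finite G" "G \<subseteq> range ((\<star>) w)"
    "\<And>N f. saturated S N \<Longrightarrow> G \<subseteq> N \<Longrightarrow> w \<star> f \<in> N"
    using assms by (rule finitely_generated_up_to_torsion[of S w]) (assumption, rule that)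
  obtain e where e: "bij_betw e {..<card G} G"
    using ex_bij_betw_nat_finite[OF G(1)] by (auto simp: atLeast0LessThan)
  have "G \<subseteq> tspan_on S {..<card G} e"
  proof
    fix x assume "x \<in> G"
    then obtain i where "i \<in> {..<card G}" "x = e i" using e by (auto simp: bij_betw_def)
    then show "x \<in> tspan_on S {..<card G} e"
      using span_on_subset_tspan_on span_on_base by blast
  qed
  then have "spanning_family S w {..<card G} e"
    using G(2) e unfolding spanning_family_def
    by (auto intro: G(3)[OF saturated_tspan_on] simp: bij_betw_def)
  then show ?thesis by (rule that)
qed

text \<open>Minimality ranges over all \<open>w\<close> at once: the rank of \<open>w K\<close> is the least one among all nonzero \<open>w\<close>.\<close>

definition minimal_family :: "'n set \<Rightarrow> 'm \<Rightarrow> nat set \<Rightarrow> (nat \<Rightarrow> 'm) \<Rightarrow> bool" where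
  "minimal_family S w I e \<longleftrightarrow> w \<noteq> 0 \<and> spanning_family S w I e \<and>
     (\<forall>w' I' e'. w' \<noteq> 0 \<longrightarrow> spanning_family S w' I' e' \<longrightarrow> card I \<le> card I')"

lemma minimal_family_exists:
  assumes "\<And>i. i \<notin> S \<Longrightarrow> \<not> torsion_free (insert i S)"
  obtains w I e where "minimal_family S w I e"
proof -
  define P where "P r \<longleftrightarrow> (\<exists>w I e. w \<noteq> 0 \<and> spanning_family S w I e \<and> card I = r)" for r
  obtain w :: 'm where w: "w \<noteq> 0" using nonzero_exists by blast
  obtain I e where "spanning_family S w I e" using spanning_family_exists[OF assms] .
  with w have "P (card I)" unfolding P_def by blast
  then have least: "P (LEAST r. P r)" "\<And>r. P r \<Longrightarrow> (LEAST r. P r) \<le> r" by (auto intro: LeastI Least_le)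
  from least(1) obtain w I e where *: "w \<noteq> 0" "spanning_family S w I e" "card I = (LEAST r. P r)"
    unfolding P_def by blast
  have "card I \<le> card I'" if "w' \<noteq> 0" "spanning_family S w' I' e'" for w' I' e'
    unfolding *(3) by (rule least(2)) (use that in \<open>auto simp: P_def\<close>)
  then have "minimal_family S w I e" using * unfolding minimal_family_def by blast
  then show ?thesis by (rule that)
qed

text \<open>A member that occurs in a relation with a nonzero coefficient can be eliminated
  after multiplication by that coefficient, which would leave a smaller spanning family.\<close>

lemma minimal_family_independent:
  assumes min: "minimal_family S w I e" and a: "\<And>i. a i \<in> vars_subring S"
    and 0: "lin_comb I e a = 0" and l: "l \<in> I"
  shows "a l = 0"
proof (rule ccontr)
  assume al: "a l \<noteq> 0"
  have sp: "spanning_family S w I e" and w: "w \<noteq> 0" using min by (auto simp: minimal_family_def)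
  have fin: "finite I" using sp by (simp add: spanning_family_def)
  have "u \<in> tspan_on S (I - {l}) e" if u: "u \<in> range ((\<star>) w)" for u
  proof -
    from u sp have "u \<in> tspan_on S I e" unfolding spanning_family_def by blast
    then obtain h b where h: "h \<in> vars_subring S" "h \<noteq> 0" and b: "\<And>i. b i \<in> vars_subring S"
      "u \<star> h = lin_comb I e b"
      by (elim tspan_onE span_onE) (rule that, assumption+)
    \<comment> \<open>The coefficient of \<open>e l\<close> in this combination vanishes.\<close>
    let ?c = "\<lambda>i. b i * a l - a i * b l"
    have "u \<star> (h * a l) = lin_comb I e b \<star> a l - lin_comb I e a \<star> b l"
      using b(2) 0 by (simp add: kact_mult)
    also have "\<dots> = lin_comb I e ?c" by (simp only: lin_comb_kact lin_comb_diff)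
    also have "\<dots> = lin_comb (I - {l}) e ?c"
      using lin_comb_remove[OF fin l, of e ?c] by (simp add: mult.commute)
    also have "\<dots> \<in> span_on S (I - {l}) e"
      by (intro span_onI vars_subring_diff vars_subring_mult a b)
    finally show ?thesis
      by (rule tspan_onI) (use h a al in \<open>auto simp: laurent_mult_eq_0_iff vars_subring_mult\<close>)
  qed
  then have "spanning_family S w (I - {l}) e" using sp unfolding spanning_family_def by blast
  then have "card I \<le> card (I - {l})" using min w unfolding minimal_family_def by blast
  then show False using fin l by (metis card_Diff1_less not_le)
qed

text \<open>Multiplication by \<open>f\<close> maps \<open>w K\<close> onto \<open>w f K\<close>, so the images still span; as the rank of \<open>w f K\<close> cannot
  drop below the minimum, they form a minimal family again.\<close>

lemma minimal_family_shift:
  assumes min: "minimal_family S w I e" and wf: "w \<star> f \<noteq> 0"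
  shows "minimal_family S (w \<star> f) I (\<lambda>i. e i \<star> f)"
proof -
  have sp: "spanning_family S w I e" using min by (auto simp: minimal_family_def)
  have "e i \<star> f \<in> range ((\<star>) (w \<star> f))" if "i \<in> I" for i
  proof -
    obtain b where "e i = w \<star> b" using sp \<open>i \<in> I\<close> unfolding spanning_family_def by blast
    then show ?thesis by (simp add: kact_commute[of w b])
  qed
  moreover have "w \<star> f \<star> b \<in> tspan_on S I (\<lambda>i. e i \<star> f)" for b
  proof -
    have "w \<star> b \<in> tspan_on S I e" using sp unfolding spanning_family_def by blast
    then obtain h a where h: "h \<in> vars_subring S" "h \<noteq> 0" and a: "\<And>i. a i \<in> vars_subring S"
      "w \<star> b \<star> h = lin_comb I e a"
      by (elim tspan_onE span_onE) (rule that, assumption+)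
    have "w \<star> f \<star> b \<star> h = w \<star> b \<star> h \<star> f"
      by (simp only: kact_commute[of w f] kact_commute[of _ f])
    also have "\<dots> = lin_comb I (\<lambda>i. e i \<star> f) a" by (simp only: a(2) lin_comb_kact_family)
    also have "\<dots> \<in> span_on S I (\<lambda>i. e i \<star> f)" using a(1) by (rule span_onI)
    finally show ?thesis by (rule tspan_onI[OF _ h])
  qed
  ultimately have "spanning_family S (w \<star> f) I (\<lambda>i. e i \<star> f)"
    using sp unfolding spanning_family_def by blast
  then show ?thesis using min wf unfolding minimal_family_def by blast
qed

text \<open>If \<open>w b \<noteq> 0\<close>, then the family \<open>e\<close> stays independent after multiplication by \<open>b\<close>, so that
  multiplication by \<open>b\<close> is injective on the span of \<open>e\<close>.  If moreover \<open>w f b = 0\<close>, then a multiple \<open>w f h\<close>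
  with \<open>h \<noteq> 0\<close> lies in this span and is annihilated by \<open>b\<close>, so that \<open>w f h = 0\<close>.\<close>

lemma minimal_family_prime:
  assumes tf: "torsion_free S" and min: "minimal_family S w I e" and 0: "w \<star> (f * b) = 0"
  shows "w \<star> f = 0 \<or> w \<star> b = 0"
proof (rule disjCI)
  assume wb: "w \<star> b \<noteq> 0"
  have sp: "spanning_family S w I e" using min by (auto simp: minimal_family_def)
  then have "w \<star> f \<in> tspan_on S I e" unfolding spanning_family_def by blast
  then obtain h a where h: "h \<in> vars_subring S" "h \<noteq> 0" and a: "\<And>i. a i \<in> vars_subring S"
    "w \<star> f \<star> h = lin_comb I e a"
      by (elim tspan_onE span_onE) (rule that, assumption+)
  have "lin_comb I (\<lambda>i. e i \<star> b) a = w \<star> f \<star> h \<star> b" by (simp only: lin_comb_kact_family a(2))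
  also have "\<dots> = w \<star> (f * b) \<star> h" by (simp only: kact_mult kact_commute[of _ h])
  finally have "lin_comb I (\<lambda>i. e i \<star> b) a = 0" using 0 by simp
  then have "a i = 0" if "i \<in> I" for i
    using minimal_family_independent[OF minimal_family_shift[OF min wb], of a] a(1) that by blast
  then have "w \<star> f \<star> h = 0" unfolding a(2) by (simp add: lin_comb_def)
  then show "w \<star> f = 0" using torsion_freeD[OF tf h(1)] h(2) by blast
qed

section \<open>Directness of the sum of the translates by powers of x\<close>

text \<open>The annihilator \<open>P\<close> of \<open>w\<close> is nonzero and proper, hence not \<open>\<delta>\<close>-stable: there is \<open>q \<in> P\<close> with
  \<open>\<delta>(q) \<notin> P\<close>.  Multiplying \<open>p = b x\<^sup>d\<^sup>+\<^sup>1 + \<dots>\<close> by \<open>q\<close> on the right makes the leading coefficient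
  \<open>b q \<in> P\<close> disappear, and the next one is \<open>(d + 1) b \<delta>(q)\<close> modulo \<open>P\<close>.  By induction on the degree this lies
  in \<open>P\<close>, and so does \<open>b\<close>, because \<open>P\<close> is prime and the characteristic is \<open>0\<close>.\<close>

lemma coefficients_vanish:
  assumes prime: "\<And>f b. w \<star> (f * b) = 0 \<Longrightarrow> w \<star> f = 0 \<or> w \<star> b = 0"
    and w: "w \<noteq> 0" and f: "f \<noteq> 0" "w \<star> f = 0" and p: "act w p = 0"
  shows "w \<star> poly.coeff p j = 0"
proof -
  have "\<exists>q. w \<star> q = 0 \<and> w \<star> \<delta> q \<noteq> 0"
  proof (rule ccontr)
    assume *: "\<not> (\<exists>q. w \<star> q = 0 \<and> w \<star> \<delta> q \<noteq> 0)"
    have "{q. w \<star> q = 0} = {0} \<or> {q. w \<star> q = 0} = UNIV"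
      by (rule \<delta>_stable_ideal[OF simple]) (use * in \<open>auto simp: kact_add kact_mult\<close>)
    moreover have "1 \<notin> {q. w \<star> q = 0}" using w by (simp add: act_one)
    ultimately show False using f by blast
  qed
  then obtain q where q: "w \<star> q = 0" "w \<star> \<delta> q \<noteq> 0" by blast
  have "\<forall>j. w \<star> poly.coeff p j = 0" if "degree p \<le> d" "act w p = 0" for d p
    using that
  proof (induction d arbitrary: p)
    case 0
    then obtain a where "p = [:a:]" by (metis degree_eq_zeroE le_zero_eq)
    with 0 show ?case by (auto simp: coeff_pCons split: nat.split)
  next
    case (Suc d)
    define b where "b = poly.coeff p (Suc d)"
    define r where "r = ore_mult \<delta> p [:q:] - Polynomial.monom (b * q) (Suc d)"
    have pq: "ore_mult \<delta> p [:q:] = (\<Sum>i\<le>Suc d. Polynomial.smult (poly.coeff p i) ((X ^^ i) [:q:]))"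
      by (rule ore_mult_bound) (rule Suc)
    have small: "poly.coeff ((X ^^ i) [:q:]) l = 0" if "i < l" for i l
      using degree_Xpow[of i "[:q:]"] that by (intro coeff_eq_0) simp
    have top: "poly.coeff (ore_mult \<delta> p [:q:]) l = (if l = Suc d then b * q else 0)" if "Suc d \<le> l" for l
      unfolding pq coeff_sum using that small[of _ l]
      by (auto simp: sum.neutral b_def coeff_Xpow_const simp del: funpow.simps)
    have next_top: "poly.coeff (ore_mult \<delta> p [:q:]) d = poly.coeff p d * q + b * (of_nat (Suc d) * \<delta> q)"
    proof -
      have "poly.coeff (ore_mult \<delta> p [:q:]) d =
        (\<Sum>i<d. 0) + poly.coeff p d * q + b * (of_nat (Suc d) * \<delta> q)"
        unfolding pq coeff_sum
        by (simp add: lessThan_Suc_atMost[symmetric] small coeff_Xpow_const b_def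
            coeff_Xpow_const_below del: funpow.simps of_nat_Suc)
      then show ?thesis by simp
    qed
    have "degree r \<le> d"
      by (rule degree_le) (auto simp: r_def top)
    moreover have "act w r = 0"
      using Suc(3) kact_mult[of w q b] q(1)
      by (simp add: r_def act_diff_right act_ore_mult act_monom mult.commute)
    ultimately have "w \<star> poly.coeff r d = 0" using Suc.IH by blast
    moreover have "poly.coeff r d = poly.coeff p d * q + of_nat (Suc d) * (b * \<delta> q)"
      by (simp add: r_def next_top algebra_simps)
    moreover have "w \<star> (poly.coeff p d * q) = 0"
      using kact_mult[of w q "poly.coeff p d"] q(1) by (simp add: mult.commute)
    ultimately have "w \<star> (of_nat (Suc d) * (b * \<delta> q)) = 0" by (simp add: kact_add)
    moreover have "of_nat (Suc d) = lconst (of_nat (Suc d) :: 'k)"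
      by (simp add: lconst_def flip: single_of_nat)
    moreover have "w \<star> lconst (of_nat (Suc d)) \<noteq> 0"
    proof
      assume *: "w \<star> lconst (of_nat (Suc d)) = 0"
      have "lconst (of_nat (Suc d)) * lconst (inverse (of_nat (Suc d))) = (1 :: ('k, 'n) laurent)"
        using of_nat_nonzero_if_simple[OF simple, of "Suc d"]
        by (simp add: lconst_def mult_single del: of_nat_Suc single_of_nat)
      then have "w = w \<star> lconst (of_nat (Suc d)) \<star> lconst (inverse (of_nat (Suc d)))"
        by (simp add: act_one flip: kact_mult)
      then show False using * w by simp
    qed
    ultimately have "w \<star> (b * \<delta> q) = 0" using prime by metis
    then have wb: "w \<star> b = 0" using prime q(2) by blast
    define s where "s = p - Polynomial.monom b (Suc d)"
    have "degree s \<le> d"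
      using Suc(2) by (intro degree_le) (auto simp: s_def b_def coeff_eq_0)
    moreover have "act w s = 0"
      using Suc(3) wb by (simp add: s_def act_diff_right act_monom)
    ultimately have s: "w \<star> poly.coeff s j = 0" for j using Suc.IH by blast
    show ?case
    proof
      fix j
      have "poly.coeff p j = (if j = Suc d then b else poly.coeff s j)" by (simp add: s_def b_def)
      then show "w \<star> poly.coeff p j = 0" using wb s by simp
    qed
  qed
  from this[OF order_refl p] show ?thesis by blast
qed

section \<open>Exclusion of proper nonempty sets of variables\<close>

text \<open>As \<open>w h\<close> generates \<open>M\<close>, there is \<open>p\<close> with \<open>w (h p - 1) = 0\<close>; the coefficient of degree \<open>0\<close> of \<open>p\<close>
  is an inverse of \<open>h\<close> on \<open>w K\<close>.\<close>

lemma divisible_by_subring: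
  assumes van: "\<And>p j. act w p = 0 \<Longrightarrow> w \<star> poly.coeff p j = 0"
    and wh: "w \<star> h \<noteq> 0"
  obtains f where "\<And>b. w \<star> b = w \<star> b \<star> (h * f)"
proof -
  obtain p where p: "w = act (w \<star> h) p" using cyclic[OF wh] .
  have "act w (ore_mult \<delta> [:h:] p - 1) = 0" by (simp add: act_diff_right act_ore_mult act_one flip: p)
  from van[OF this, of 0] have "w \<star> (h * poly.coeff p 0 - 1) = 0" by (simp add: ore_mult_const)
  then have *: "w \<star> (h * poly.coeff p 0) = w" by (simp only: kact_diff kact_one right_minus_eq)
  have "w \<star> b = w \<star> b \<star> (h * poly.coeff p 0)" for b by (subst kact_commute) (simp only: *)
  then show ?thesis by (rule that)
qed

lemma common_denominator:
  assumes "finite F" "F \<subseteq> tspan_on S I e"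
  obtains c where "c \<in> vars_subring S" "c \<noteq> 0" "\<And>u. u \<in> F \<Longrightarrow> u \<star> c \<in> span_on S I e"
proof -
  have "\<exists>c\<in>vars_subring S. c \<noteq> 0 \<and> (\<forall>u\<in>F. u \<star> c \<in> span_on S I e)"
    using assms
  proof (induction F)
    case empty
    show ?case by (auto intro!: bexI[of _ 1])
  next
    case (insert v F)
    from insert.IH insert.prems obtain c where c: "c \<in> vars_subring S" "c \<noteq> 0"
      and Fc: "\<forall>u\<in>F. u \<star> c \<in> span_on S I e" by auto
    from insert.prems have "v \<in> tspan_on S I e" by simp
    then obtain h where h: "h \<in> vars_subring S" "h \<noteq> 0" "v \<star> h \<in> span_on S I e" by (rule tspan_onE)
    have "v \<star> (h * c) \<in> span_on S I e" unfolding kact_mult by (rule span_on_kact[OF h(3) c(1)])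
    moreover have "u \<star> (h * c) \<in> span_on S I e" if "u \<in> F" for u
      unfolding kact_mult kact_commute[of u h] by (rule span_on_kact[OF Fc[rule_format, OF that] h(1)])
    moreover have "h * c \<in> vars_subring S" "h * c \<noteq> 0"
      using h c by (auto simp: vars_subring_mult laurent_mult_eq_0_iff)
    ultimately show ?case by (intro bexI[of _ "h * c"]) auto
  qed
  then show ?thesis by (elim bexE conjE) (rule that, auto)
qed

text \<open>A common denominator \<open>c\<close> for the products of the members of the family with the \<open>x\<^sub>i\<close> and \<open>x\<^sub>i\<^sup>-\<^sup>1\<close> serves
  for all of \<open>K\<close>: the elements that map the span into itself after multiplication by a power of
  \<open>c\<close> form a subring.\<close>

lemma multiplier_denominator:
  assumes I: "finite I" and mon: "\<And>i \<alpha>. i \<in> I \<Longrightarrow> e i \<star> Poly_Mapping.single \<alpha> 1 \<in> tspan_on S I e"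
  obtains c where "c \<in> vars_subring S" "c \<noteq> 0"
    "\<And>f. \<exists>N. \<forall>u \<in> span_on S I e. u \<star> (f * c ^ N) \<in> span_on S I e"
proof -
  define E where "E = range (\<lambda>l. axis l 1) \<union> range (\<lambda>l. - axis l (1 :: int) :: (int, 'n) vec)"
  define F where "F = (\<lambda>(i, \<alpha>). e i \<star> Poly_Mapping.single \<alpha> 1) ` (I \<times> E)"
  have "finite E" by (simp add: E_def)
  then have "finite F" using I by (simp add: F_def)
  moreover have "F \<subseteq> tspan_on S I e" using mon by (auto simp: F_def)
  ultimately obtain c where c: "c \<in> vars_subring S" "c \<noteq> 0" "\<And>u. u \<in> F \<Longrightarrow> u \<star> c \<in> span_on S I e"
    by (rule common_denominator) (rule that, assumption+)
  define Q where "Q f \<longleftrightarrow> (\<exists>N. \<forall>u \<in> span_on S I e. u \<star> (f * c ^ N) \<in> span_on S I e)" for f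
  have QS: "Q f" if "f \<in> vars_subring S" for f
    unfolding Q_def by (rule exI[of _ 0]) (simp add: span_on_kact that)
  have Qmult: "Q (f * h)" if "Q f" "Q h" for f h
  proof -
    obtain N1 N2 where N: "\<And>u. u \<in> span_on S I e \<Longrightarrow> u \<star> (f * c ^ N1) \<in> span_on S I e"
      "\<And>u. u \<in> span_on S I e \<Longrightarrow> u \<star> (h * c ^ N2) \<in> span_on S I e"
      using \<open>Q f\<close> \<open>Q h\<close> unfolding Q_def by blast
    have eq: "(f * h) * c ^ (N1 + N2) = (f * c ^ N1) * (h * c ^ N2)" by (simp add: power_add mult_ac)
    have "u \<star> ((f * h) * c ^ (N1 + N2)) \<in> span_on S I e" if "u \<in> span_on S I e" for u
      unfolding eq kact_mult[of u "f * c ^ N1"] by (intro N that)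
    then show ?thesis unfolding Q_def by blast
  qed
  have Qadd: "Q (f + h)" if "Q f" "Q h" for f h
  proof -
    obtain N1 N2 where N: "\<And>u. u \<in> span_on S I e \<Longrightarrow> u \<star> (f * c ^ N1) \<in> span_on S I e"
      "\<And>u. u \<in> span_on S I e \<Longrightarrow> u \<star> (h * c ^ N2) \<in> span_on S I e"
      using \<open>Q f\<close> \<open>Q h\<close> unfolding Q_def by blast
    have eq: "(f + h) * c ^ (N1 + N2) = (f * c ^ N1) * c ^ N2 + (h * c ^ N2) * c ^ N1"
      by (simp add: power_add algebra_simps)
    have "u \<star> ((f + h) * c ^ (N1 + N2)) \<in> span_on S I e" if "u \<in> span_on S I e" for u
      unfolding eq kact_add kact_mult[of u "f * c ^ N1"] kact_mult[of u "h * c ^ N2"]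
      by (intro N that span_on_add span_on_kact vars_subring_power c)
    then show ?thesis unfolding Q_def by blast
  qed
  have QE: "Q (Poly_Mapping.single \<alpha> 1)" if "\<alpha> \<in> E" for \<alpha>
    unfolding Q_def
  proof (intro exI[of _ 1] ballI)
    fix u assume "u \<in> span_on S I e"
    then obtain a where a: "\<And>i. a i \<in> vars_subring S" "u = lin_comb I e a"
      by (rule span_onE) (rule that, assumption+)
    have "u \<star> (Poly_Mapping.single \<alpha> 1 * c ^ 1) = (\<Sum>i\<in>I. e i \<star> Poly_Mapping.single \<alpha> 1 \<star> c \<star> a i)"
      unfolding a(2) lin_comb_def act_sum_left power_one_right kact_mult
      by (intro sum.cong refl) (simp only: kact_commute[of _ "a _"])
    also have "\<dots> \<in> span_on S I e"
      using that by (intro span_on_sum span_on_kact a(1) c(3)) (auto simp: F_def)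
    finally show "u \<star> (Poly_Mapping.single \<alpha> 1 * c ^ 1) \<in> span_on S I e" .
  qed
  have Q1: "Q (Poly_Mapping.single \<alpha> 1)" for \<alpha>
  proof (induction \<alpha> rule: lattice_closed_induct)
    case 1 then show ?case by (simp add: QS)
  next
    case (2 \<alpha> \<beta>)
    from Qmult[OF this] show ?case by (simp add: mult_single)
  qed (auto intro!: QE simp: E_def)
  have Qall: "Q f" for f
  proof (induction f rule: laurent_induct)
    case (1 \<alpha> a)
    have "Poly_Mapping.single \<alpha> a = lconst a * Poly_Mapping.single \<alpha> 1" by (simp add: lconst_def mult_single)
    then show ?case by (simp only: Qmult QS Q1 vars_subring_lconst)
  qed (rule Qadd)
  show ?thesis by (rule that[OF c(1,2) Qall[unfolded Q_def]])
qed

text \<open>Take for \<open>z\<close> a power of \<open>x\<^sub>i\<close> such that \<open>c z\<close> has no constant term.  Then \<open>1 + c z\<close> has at least two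
  terms.\<close>

lemma non_unit_congruent_1:
  fixes c :: "('k, 'n) laurent"
  assumes c: "c \<in> vars_subring S" "c \<noteq> 0" and "i \<in> S"
  obtains z where "z \<in> vars_subring S" "1 + c * z \<noteq> 0" "\<not> 1 + c * z dvd 1"
proof -
  have "inj (\<lambda>t. - axis i t :: (int, 'n) vec)" by (auto simp: inj_def axis_eq_axis)
  then have "finite ((\<lambda>t. - axis i t) -` Poly_Mapping.keys c)" by (intro finite_vimageI) auto
  then obtain t where t: "- axis i t \<notin> Poly_Mapping.keys c"
    using ex_new_if_finite[OF infinite_UNIV_int] by blast
  define z where "z = Poly_Mapping.single (axis i t) (1 :: 'k)"
  define h where "h = 1 + c * z"
  have lookup_h: "Poly_Mapping.lookup h \<gamma> = (1 when \<gamma> = 0) + Poly_Mapping.lookup c (\<gamma> - axis i t)" for \<gamma>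
    unfolding h_def z_def mult.commute[of c] by (simp add: lookup_add lookup_one lookup_single_mult)
  obtain \<alpha> where \<alpha>: "\<alpha> \<in> Poly_Mapping.keys c" using c(2) laurent_as_sum[of c] by fastforce
  have ne: "\<alpha> + axis i t \<noteq> 0" using \<alpha> t by (auto simp: add_eq_0_iff2)
  have keys: "0 \<in> Poly_Mapping.keys h" "\<alpha> + axis i t \<in> Poly_Mapping.keys h"
    using t ne \<alpha> by (simp_all add: in_keys_iff lookup_h)
  have "\<not> h dvd 1"
  proof
    assume "h dvd 1"
    then obtain b where "h * b = 1" by (metis dvdE)
    from laurent_unit_single_exponent[OF this keys] ne show False by simp
  qed
  moreover have "h \<noteq> 0" using keys by auto
  moreover have "z \<in> vars_subring S"
    unfolding z_def by (rule vars_subring_single) (use \<open>i \<in> S\<close> in \<open>auto simp: axis_def\<close>)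
  ultimately show ?thesis unfolding h_def by (intro that)
qed

text \<open>Suppose that \<open>S\<close> contains a variable, let \<open>c\<close> be the denominator from \<open>multiplier_denominator\<close> and let
  \<open>h \<in> K\<^sub>S\<close> be a non-unit congruent to \<open>1\<close> modulo \<open>c\<close>.  Since \<open>h\<close> acts invertibly on \<open>w K\<close>, the product of a
  member \<open>e\<^sub>i\<close> with a power \<open>c\<^sup>N\<close> is \<open>h\<close> times an element of the span.  As the family is independent,
  \<open>h\<close> divides \<open>c\<^sup>N\<close>; but \<open>h\<close> is coprime to \<open>c\<close>.\<close>

lemma torsion_free_variables_empty:
  assumes min: "minimal_family S w I e" and tf: "torsion_free S"
    and van: "\<And>p j. act w p = 0 \<Longrightarrow> w \<star> poly.coeff p j = 0"
  shows "S = {}"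
proof (rule ccontr)
  assume "S \<noteq> {}"
  then obtain l where l: "l \<in> S" by blast
  have w: "w \<noteq> 0" and sp: "spanning_family S w I e" using min by (auto simp: minimal_family_def)
  have I: "finite I" and e: "\<And>i. i \<in> I \<Longrightarrow> e i \<in> range ((\<star>) w)" and cover: "\<And>f. w \<star> f \<in> tspan_on S I e"
    using sp unfolding spanning_family_def by blast+
  have mon: "e i \<star> Poly_Mapping.single \<alpha> 1 \<in> tspan_on S I e" if "i \<in> I" for i \<alpha>
    using e[OF that] cover by (auto simp flip: kact_mult)
  obtain c where c: "c \<in> vars_subring S" "c \<noteq> 0"
    "\<And>f. \<exists>N. \<forall>u \<in> span_on S I e. u \<star> (f * c ^ N) \<in> span_on S I e"
    
    by (rule multiplier_denominator[OF I mon]) (assumption, rule that, assumption+)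
  obtain z where z: "z \<in> vars_subring S" "1 + c * z \<noteq> 0" "\<not> 1 + c * z dvd 1"
    
    by (rule non_unit_congruent_1[OF c(1,2) l])
  define h where "h = 1 + c * z"
  have h: "h \<in> vars_subring S" "h \<noteq> 0" "\<not> h dvd 1"
    unfolding h_def by (intro vars_subring_add vars_subring_1 vars_subring_mult c z)+
  have "w \<star> h \<noteq> 0" using torsion_freeD[OF tf h(1)] h(2) w by blast
  from divisible_by_subring[OF van this] obtain f where f: "\<And>b. w \<star> b = w \<star> b \<star> (h * f)" by blast
  obtain N where N: "\<And>u. u \<in> span_on S I e \<Longrightarrow> u \<star> (f * c ^ N) \<in> span_on S I e" using c(3) by blast
  have "I \<noteq> {}"
  proof
    assume "I = {}"
    then have "span_on S I e \<subseteq> {0}" by (auto simp: span_on_def lin_comb_def)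
    moreover obtain b where "b \<in> vars_subring S" "b \<noteq> 0" "w \<star> 1 \<star> b \<in> span_on S I e"
      using cover[of 1] by (rule tspan_onE)
    ultimately have "w \<star> b = 0" by (auto simp: act_one)
    then show False using torsion_freeD[OF tf \<open>b \<in> vars_subring S\<close>] w \<open>b \<noteq> 0\<close> by blast
  qed
  then obtain i where i: "i \<in> I" by blast
  then obtain b where b: "e i = w \<star> b" using e by blast
  have "e i \<star> (f * c ^ N) \<in> span_on S I e" by (rule N[OF span_on_base[OF I i]])
  then obtain a where a: "\<And>l. a l \<in> vars_subring S" "e i \<star> (f * c ^ N) = lin_comb I e a"
    by (rule span_onE) (rule that, assumption+)
  have "e i \<star> c ^ N = e i \<star> (h * f) \<star> c ^ N" unfolding b using f by simp
  also have "\<dots> = e i \<star> (f * c ^ N) \<star> h" by (simp add: mult_ac flip: kact_mult)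
  finally have 1: "e i \<star> c ^ N = lin_comb I e (\<lambda>l. a l * h)" by (simp only: a(2) lin_comb_kact)
  have 2: "e i \<star> c ^ N = lin_comb I e (\<lambda>l. if l = i then c ^ N else 0)"
    using I i by (simp add: lin_comb_def if_distrib[where f = "\<lambda>f. act _ [:f:]"] sum.delta cong: if_cong)
  have "lin_comb I e (\<lambda>l. (if l = i then c ^ N else 0) - a l * h) = 0"
    by (simp only: 1[symmetric] 2[symmetric] lin_comb_diff[symmetric] diff_self)
  from minimal_family_independent[OF min _ this i]
  have "c ^ N - a i * h = 0"
    by (simp add: vars_subring_diff vars_subring_mult vars_subring_power a h(1) c(1))
  then have "h dvd c ^ N" by simp
  then have *: "h dvd (c * z) ^ N" by (simp add: power_mult_distrib)
  \<comment> \<open>\<open>c z \<equiv> -1\<close> modulo \<open>h\<close>, so \<open>h\<close> divides a power of \<open>-1\<close>.\<close>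
  have "h dvd (- 1) ^ m" if "h dvd (c * z) ^ m" for m
  proof -
    have "h dvd (c * z) ^ m - (- 1) ^ m"
    proof (induction m)
      case (Suc m)
      have "(c * z) ^ Suc m - (- 1) ^ Suc m = c * z * ((c * z) ^ m - (- 1) ^ m) + h * (- 1) ^ m"
        by (simp add: h_def algebra_simps)
      then show ?case using Suc by simp
    qed simp
    with that show ?thesis by (metis diff_diff_eq2 dvd_diff add_diff_cancel_left')
  qed
  from dvd_mult2[OF this[OF *], of "(- 1) ^ N"] have "h dvd 1" by (simp flip: power_mult_distrib)
  with h(3) show False by blast
qed

text \<open>The second alternative comes from a maximal \<open>S\<close> that misses a variable.\<close>

lemma torsion_alternative:
  obtains "torsion_free UNIV"
  | w I e where "minimal_family {} w I e" "\<And>p j. act w p = 0 \<Longrightarrow> w \<star> poly.coeff p j = 0"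
proof (cases "torsion_free UNIV")
  case False
  have "torsion_free {}"
    unfolding torsion_free_def
  proof (intro allI impI)
    fix v f assume f: "f \<in> vars_subring {}" "v \<star> f = 0"
    from f(1) obtain c where c: "f = lconst c" by (rule vars_subring_empty)
    show "v = 0 \<or> f = 0"
    proof (cases "c = 0")
      case False
      then have "f * lconst (inverse c) = 1" by (simp add: c lconst_def mult_single)
      then have "v \<star> f \<star> lconst (inverse c) = v" by (simp add: act_one flip: kact_mult)
      then show ?thesis using f by simp
    qed (simp add: c lconst_def)
  qed
  then have "Collect torsion_free \<noteq> {}" by blast
  from finite_has_maximal[OF _ this] obtain S where tf: "torsion_free S"
    and max: "\<And>T. torsion_free T \<Longrightarrow> S \<le> T \<Longrightarrow> S = T" by auto
  have tors: "\<not> torsion_free (insert i S)" if "i \<notin> S" for i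
    using max[of "insert i S"] that by blast
  obtain i where i: "i \<notin> S" using tf False by (cases "S = UNIV") auto
  obtain w I e where min: "minimal_family S w I e" 
    by (rule minimal_family_exists[OF tors])
  obtain f where f: "f \<noteq> 0" "w \<star> f = 0" 
    by (rule torsion_dichotomy[OF tors[OF i], of w]) (rule that, assumption+)
  have w: "w \<noteq> 0" using min by (simp add: minimal_family_def)
  have van: "w \<star> poly.coeff p j = 0" if "act w p = 0" for p j
    by (rule coefficients_vanish[OF minimal_family_prime[OF tf min] w f that])
  have "S = {}" by (rule torsion_free_variables_empty[OF min tf van])
  with min van that(2) show ?thesis by blast
qed

end

section \<open>Comparison of filtrations\<close>

context laurent_ore begin

abbreviation "ore_ring \<equiv> ore_ext \<delta>"

abbreviation emb :: "'k \<Rightarrow> ('k, 'n) laurent poly" where "emb \<equiv> \<lambda>c. [:lconst c:]"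

lemma ore_ring_simps:
  "carrier ore_ring = UNIV" "p \<otimes>\<^bsub>ore_ring\<^esub> q = ore_mult \<delta> p q" "p \<oplus>\<^bsub>ore_ring\<^esub> q = p + q"
  "\<zero>\<^bsub>ore_ring\<^esub> = 0" "\<one>\<^bsub>ore_ring\<^esub> = 1"
  by (simp_all add: ore_ext_def)

lemma ore_ring_a_inv: "\<ominus>\<^bsub>ore_ring\<^esub> p = - p"
proof -
  interpret R: ring ore_ring by (rule ring_ore_ext)
  show ?thesis using R.minus_equality[of "- p" p] by (simp add: ore_ring_simps)
qed

lemma ore_ring_add_inv: "inv\<^bsub>add_monoid ore_ring\<^esub> p = - p"
  using ore_ring_a_inv[of p] by (simp add: a_inv_def)

lemma ore_ring_add_one: "\<one>\<^bsub>add_monoid ore_ring\<^esub> = 0"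
  by (simp add: ore_ext_def)

lemma ore_ring_add_mult: "p \<otimes>\<^bsub>add_monoid ore_ring\<^esub> q = p + q"
  by (simp add: ore_ext_def)

lemma ore_mult_0_right [simp]: "ore_mult \<delta> p 0 = 0"
  using ore_mult_add_right[of p 0 0] by simp

lemma lconst_mult: "lconst a * lconst b = lconst (a * b)"
  by (simp add: lconst_def mult_single)

lemma lconst_1: "lconst 1 = 1"
  by (simp add: lconst_def)

lemma lconst_minus_1: "Polynomial.smult (lconst (- 1)) p = - p"
  by (simp add: lconst_def single_uminus)

lemma ore_mult_smult_right:
  "ore_mult \<delta> p (Polynomial.smult (lconst c) q) = Polynomial.smult (lconst c) (ore_mult \<delta> p q)"
  by (metis ore_mult_assoc ore_mult_scalar)

definition scalar_subspace :: "('k, 'n) laurent poly set \<Rightarrow> bool" where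
  "scalar_subspace V \<longleftrightarrow> 0 \<in> V \<and> (\<forall>p\<in>V. \<forall>q\<in>V. p + q \<in> V) \<and> (\<forall>p\<in>V. \<forall>c. Polynomial.smult (lconst c) p \<in> V)"

lemma scalar_subspaceD:
  assumes "scalar_subspace V"
  shows "0 \<in> V" "p \<in> V \<Longrightarrow> q \<in> V \<Longrightarrow> p + q \<in> V" "p \<in> V \<Longrightarrow> Polynomial.smult (lconst c) p \<in> V"
    "p \<in> V \<Longrightarrow> - p \<in> V"
  using assms unfolding scalar_subspace_def by (blast, blast, blast, metis lconst_minus_1)

lemma scalar_subspace_ore_filt: "scalar_subspace (ore_filt m)"
  unfolding scalar_subspace_def
proof (intro conjI ballI allI)
  fix p c assume p: "p \<in> (ore_filt m :: ('k, 'n) laurent poly set)"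
  have "Polynomial.smult (lconst c) p \<in> ore_filt (0 + m)"
    by (rule ore_filt_smult[OF p]) (auto simp: lconst_def lookup_single when_def split: if_splits)
  then show "Polynomial.smult (lconst c) p \<in> ore_filt m" by simp
qed (auto intro: ore_filt_add)

lemma alg_span_subset:
  assumes "scalar_subspace V" "T \<subseteq> V"
  shows "alg_span ore_ring emb T \<subseteq> V"
proof
  fix p assume "p \<in> alg_span ore_ring emb T"
  then show "p \<in> V"
    unfolding alg_span_def
  proof induction
    case (inv h)
    then have "h \<in> V" using assms(2) by (auto simp: ore_ring_simps ore_mult_const intro: scalar_subspaceD[OF assms(1)])
    then show ?case unfolding ore_ring_add_inv by (rule scalar_subspaceD[OF assms(1)])
  qed (use assms(2) in \<open>auto simp: ore_ring_simps ore_mult_const intro: scalar_subspaceD[OF assms(1)]\<close>)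
qed

lemma scalar_subspace_alg_span: "scalar_subspace (alg_span ore_ring emb T)"
  unfolding scalar_subspace_def
proof (intro conjI ballI allI)
  show "0 \<in> alg_span ore_ring emb T"
    unfolding alg_span_def by (rule generate.one[of "add_monoid ore_ring", unfolded ore_ring_add_one])
  show "p + q \<in> alg_span ore_ring emb T"
    if "p \<in> alg_span ore_ring emb T" "q \<in> alg_span ore_ring emb T" for p q
    using generate.eng[of p "add_monoid ore_ring" _ q] that unfolding alg_span_def by (simp add: ore_ring_simps)
  show "Polynomial.smult (lconst c) p \<in> alg_span ore_ring emb T" if "p \<in> alg_span ore_ring emb T" for p c
    using that unfolding alg_span_def
  proof induction
    case one
    show ?case
      unfolding ore_ring_add_one smult_0_right
      by (rule generate.one[of "add_monoid ore_ring", unfolded ore_ring_add_one])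
  next
    case (incl h)
    then obtain a t where "h = Polynomial.smult (lconst a) t" "t \<in> T" by (auto simp: ore_ring_simps ore_mult_const)
    then have "Polynomial.smult (lconst c) h = emb (c * a) \<otimes>\<^bsub>ore_ring\<^esub> t" "t \<in> T"
      by (simp_all add: ore_ring_simps ore_mult_const lconst_mult)
    then show ?case by (intro generate.incl) blast
  next
    case (inv h)
    then obtain a t where "h = Polynomial.smult (lconst a) t" "t \<in> T" by (auto simp: ore_ring_simps ore_mult_const)
    then have "Polynomial.smult (lconst c) (- h) = emb (c * - a) \<otimes>\<^bsub>ore_ring\<^esub> t" "t \<in> T"
      by (simp_all add: ore_ring_simps ore_mult_const lconst_def single_uminus mult_single)
    then show ?case unfolding ore_ring_add_inv by (intro generate.incl) blast
  next
    case (eng h1 h2)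
    from generate.eng[OF eng(3,4)] show ?case
      unfolding ore_ring_add_mult smult_add_right .
  qed
qed

lemma alg_span_base: "t \<in> T \<Longrightarrow> t \<in> alg_span ore_ring emb T"
proof -
  assume "t \<in> T"
  moreover have "t = emb 1 \<otimes>\<^bsub>ore_ring\<^esub> t" by (simp add: ore_ring_simps ore_mult_const lconst_1)
  ultimately show ?thesis unfolding alg_span_def by (intro generate.incl) blast
qed

abbreviation "filt S m \<equiv> alg_filt ore_ring emb S m"

lemma scalar_subspace_filt: "scalar_subspace (filt S m)"
proof (cases m)
  case 0
  have "0 = emb 0" "emb a + emb b = emb (a + b)" "Polynomial.smult (lconst a) (emb b) = emb (a * b)" for a b
    by (simp_all add: lconst_def single_add mult_single)
  then show ?thesis unfolding 0 scalar_subspace_def by (auto intro: range_eqI)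
qed (simp add: scalar_subspace_alg_span)

lemma filt_Suc_mult: "p \<in> filt S m \<Longrightarrow> q \<in> alg_span ore_ring emb S \<Longrightarrow> ore_mult \<delta> p q \<in> filt S (Suc m)"
  by (auto intro!: alg_span_base simp: ore_ring_simps)

lemma filt_mult: "p \<in> filt S m \<Longrightarrow> q \<in> filt S l \<Longrightarrow> ore_mult \<delta> p q \<in> filt S (m + l)"
proof (induction l arbitrary: q)
  case 0
  then show ?case by (auto simp: ore_mult_scalar intro: scalar_subspaceD(3)[OF scalar_subspace_filt])
next
  case (Suc l)
  define V where "V = {q. ore_mult \<delta> p q \<in> filt S (Suc (m + l))}"
  have "scalar_subspace V"
    unfolding scalar_subspace_def V_def
    using scalar_subspaceD[OF scalar_subspace_filt[of S "Suc (m + l)"]]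
    by (auto simp: ore_mult_add_right ore_mult_smult_right simp del: alg_filt.simps)
  moreover have "{a \<otimes>\<^bsub>ore_ring\<^esub> b | a b. a \<in> filt S l \<and> b \<in> alg_span ore_ring emb S} \<subseteq> V"
  proof clarify
    fix a b assume "a \<in> filt S l" "b \<in> alg_span ore_ring emb S"
    then have "ore_mult \<delta> (ore_mult \<delta> p a) b \<in> filt S (Suc (m + l))"
      by (intro filt_Suc_mult Suc)
    then show "a \<otimes>\<^bsub>ore_ring\<^esub> b \<in> V" by (simp only: V_def ore_ring_simps ore_mult_assoc mem_Collect_eq)
  qed
  ultimately have "filt S (Suc l) \<subseteq> V" unfolding alg_filt.simps by (rule alg_span_subset)
  with Suc(3) show ?case by (auto simp only: V_def mem_Collect_eq add_Suc_right)
qed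

lemma filt_mono: "1 \<in> S \<Longrightarrow> m \<le> m' \<Longrightarrow> filt S m \<subseteq> filt S m'"
proof (rule lift_Suc_mono_le[of "filt S"])
  fix m assume "1 \<in> S"
  then show "filt S m \<subseteq> filt S (Suc m)"
    using filt_Suc_mult[of _ S m 1] by (auto simp only: ore_mult_one_right alg_span_base)
qed

lemma filt_exhaustive:
  assumes S: "alg_generating_set ore_ring emb S"
  shows "\<exists>m. p \<in> filt S m"
proof -
  have 1: "1 \<in> S" using S by (simp add: alg_generating_set_def ore_ring_simps)
  have "p \<in> generate_ring ore_ring (range emb \<union> S)"
    using S by (simp add: alg_generating_set_def ore_ring_simps)
  then show ?thesis
  proof induction
    case one
    show ?case by (intro exI[of _ 0]) (auto simp: ore_ring_simps one_pCons lconst_1 intro!: range_eqI[of _ _ 1])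
  next
    case (incl h)
    then show ?case
    proof
      assume "h \<in> range emb" then show ?thesis by (intro exI[of _ 0]) simp
    next
      assume "h \<in> S"
      have "1 \<in> filt S 0" by (auto simp: one_pCons lconst_1 intro!: range_eqI[of _ _ 1])
      from filt_Suc_mult[OF this alg_span_base[OF \<open>h \<in> S\<close>]] show ?thesis
        unfolding ore_mult_one_left by blast
    qed
  next
    case (a_inv h)
    then show ?case unfolding ore_ring_a_inv using scalar_subspaceD(4)[OF scalar_subspace_filt] by blast
  next
    case (eng_add h1 h2)
    then obtain m1 m2 where "h1 \<in> filt S m1" "h2 \<in> filt S m2" by blast
    then have "h1 \<in> filt S (max m1 m2)" "h2 \<in> filt S (max m1 m2)"
      using filt_mono[OF 1] max.cobounded1 max.cobounded2 by blast+
    then show ?case unfolding ore_ring_simps using scalar_subspaceD(2)[OF scalar_subspace_filt] by blast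
  next
    case (eng_mult h1 h2)
    then show ?case unfolding ore_ring_simps using filt_mult by blast
  qed
qed

lemma finite_subset_ore_filt:
  assumes "finite (T :: ('k, 'n) laurent poly set)"
  obtains c where "T \<subseteq> ore_filt c"
proof -
  have "\<exists>c. T \<subseteq> ore_filt c"
    using assms
  proof induction
    case (insert p T)
    obtain a b where "p \<in> ore_filt a" "T \<subseteq> ore_filt b" using ex_ore_filt insert by blast
    then have "insert p T \<subseteq> ore_filt (max a b)"
      using ore_filt_mono[of a "max a b"] ore_filt_mono[of b "max a b"] by auto
    then show ?case ..
  qed simp
  then show ?thesis using that by blast
qed

lemma filt_le_ore_filt:
  assumes "finite S"
  obtains c where "\<And>m. filt S m \<subseteq> ore_filt (c * m)"
proof -
  obtain c where c: "S \<subseteq> ore_filt c" using finite_subset_ore_filt[OF assms] .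
  have span: "alg_span ore_ring emb S \<subseteq> ore_filt c" by (rule alg_span_subset[OF scalar_subspace_ore_filt c])
  have "filt S m \<subseteq> ore_filt (c * m)" for m
  proof (induction m)
    case 0
    show ?case by (auto simp: ore_filt_const)
  next
    case (Suc m)
    have "{a \<otimes>\<^bsub>ore_ring\<^esub> b | a b. a \<in> filt S m \<and> b \<in> alg_span ore_ring emb S} \<subseteq> ore_filt (c * m + c)"
      using Suc span by (auto simp only: ore_ring_simps intro!: ore_filt_mult)
    from alg_span_subset[OF scalar_subspace_ore_filt this] show ?case by (simp add: add.commute)
  qed
  then show ?thesis by (rule that)
qed

lemma \<delta>_lconst: "\<delta> (lconst c) = 0"
  by (simp add: \<delta>_eq lpartial_lconst)

text \<open>The terms of \<open>ore_filt 1\<close> lie in some step of the filtration of \<open>S\<close>, and they generate multiplicatively: a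
  term in \<open>ore_filt (Suc m)\<close> splits off either a factor \<open>x\<close> or the monomial whose exponents are
  the signs of \<open>\<alpha>\<close>.\<close>

lemma ore_filt_le_filt:
  assumes S: "alg_generating_set ore_ring emb S"
  obtains c where "\<And>m. ore_filt m \<subseteq> filt S (c * m)"
proof -
  have 1: "1 \<in> S" using S by (simp add: alg_generating_set_def ore_ring_simps)
  have fin: "\<exists>c. T \<subseteq> filt S c" if "finite T" for T
    using that
  proof induction
    case (insert p T)
    obtain a b where "p \<in> filt S a" "T \<subseteq> filt S b" using filt_exhaustive[OF S] insert by blast
    then have "insert p T \<subseteq> filt S (max a b)"
      using filt_mono[OF 1, of a "max a b"] filt_mono[OF 1, of b "max a b"] by auto
    then show ?case ..
  qed simp
  have "finite ((\<lambda>(\<alpha>, j). Polynomial.monom (Poly_Mapping.single \<alpha> (1 :: 'k)) j) ` (ore_exponents 1 :: ((int, 'n) vec \<times> nat) set))"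
    by simp
  from fin[OF this] obtain c where c:
    "(\<lambda>(\<alpha>, j). Polynomial.monom (Poly_Mapping.single \<alpha> (1 :: 'k)) j) ` (ore_exponents 1 :: ((int, 'n) vec \<times> nat) set) \<subseteq> filt S c"
    ..
  note sub = scalar_subspaceD[OF scalar_subspace_filt]
  have base: "p \<in> filt S c" if p: "p \<in> ore_filt 1" for p
    using p
  proof (rule ore_filt_induct)
    fix \<alpha> :: "(int, 'n) vec" and j a assume "(\<alpha>, j) \<in> ore_exponents 1"
    then have "Polynomial.monom (Poly_Mapping.single \<alpha> 1) j \<in> filt S c" using c by auto
    then have "Polynomial.smult (lconst a) (Polynomial.monom (Poly_Mapping.single \<alpha> 1) j) \<in> filt S c" by (rule sub)
    then show "Polynomial.monom (Poly_Mapping.single \<alpha> a) j \<in> filt S c"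
      by (simp add: smult_monom lconst_def mult_single)
  qed (auto intro: sub)
  have "ore_filt m \<subseteq> filt S (c * m)" for m
  proof (induction m)
    case 0
    show ?case
    proof
      fix p :: "('k, 'n) laurent poly" assume "p \<in> ore_filt 0"
      then show "p \<in> filt S (c * 0)"
      proof (rule ore_filt_induct)
        fix \<alpha> :: "(int, 'n) vec" and j a assume "(\<alpha>, j) \<in> ore_exponents 0"
        then have "\<bar>\<alpha> $ i\<bar> + int j \<le> 0" for i by (simp add: ore_exponents_def)
        then have "\<alpha> $ i = 0 \<and> j = 0" for i by (smt (verit) of_nat_0_le_iff of_nat_eq_0_iff)
        then have "\<alpha> = 0" "j = 0" by (auto simp: vec_eq_iff)
        then show "Polynomial.monom (Poly_Mapping.single \<alpha> a) j \<in> filt S (c * 0)"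
          by (auto simp: monom_0 lconst_def)
      qed (auto intro: sub simp del: alg_filt.simps)
    qed
  next
    case (Suc m)
    have step: "ore_mult \<delta> p q \<in> filt S (c * Suc m)" if "p \<in> ore_filt 1" "q \<in> ore_filt m" for p q
      using filt_mult[OF base[OF that(1)] subsetD[OF Suc that(2)]] by simp
    show ?case
    proof
      fix p :: "('k, 'n) laurent poly" assume "p \<in> ore_filt (Suc m)"
      then show "p \<in> filt S (c * Suc m)"
      proof (rule ore_filt_induct)
        fix \<alpha> :: "(int, 'n) vec" and j a assume "(\<alpha>, j) \<in> ore_exponents (Suc m)"
        then have E: "\<bar>\<alpha> $ i\<bar> + int j \<le> int (Suc m)" for i by (auto simp: ore_exponents_def)
        show "Polynomial.monom (Poly_Mapping.single \<alpha> a) j \<in> filt S (c * Suc m)"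
        proof (cases "j = Suc m")
          case True
          have "\<alpha> $ i = 0" for i using E[of i] True by simp
          then have \<alpha>: "\<alpha> = 0" by (simp add: vec_eq_iff)
          have "Polynomial.monom (Poly_Mapping.single \<alpha> a) j = X (Polynomial.monom (lconst a) m)"
            by (rule poly_eqI) (auto simp: True \<alpha> coeff_X \<delta>_lconst lconst_def[symmetric] split: nat.split)
          moreover have "Polynomial.monom (lconst a) m \<in> ore_filt m"
            unfolding lconst_def by (rule ore_filt_monom) (simp add: ore_exponents_def)
          moreover have "[:0, 1:] \<in> ore_filt 1"
            using ore_filt_monom[of 0 1 1 1] by (simp add: ore_exponents_def monom_Suc one_pCons)
          ultimately show ?thesis
            using step[of "[:0, 1:]" "Polynomial.monom (lconst a) m"] by (simp only: X_eq_mult)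
        next
          case False
          \<comment> \<open>Subtracting the signs lowers every nonzero \<open>\<bar>\<alpha> $ i\<bar>\<close> by one.\<close>
          define \<beta> where "\<beta> = (\<chi> i. sgn (\<alpha> $ i))"
          have j: "j \<le> m" using E[of undefined] False by linarith
          have "\<bar>(\<alpha> - \<beta>) $ i\<bar> + int j \<le> int m" for i
            using E[of i] j by (auto simp: \<beta>_def sgn_if split: if_splits)
          then have q: "Polynomial.monom (Poly_Mapping.single (\<alpha> - \<beta>) a) j \<in> ore_filt m"
            by (intro ore_filt_monom) (simp add: ore_exponents_def)
          have "\<bar>\<beta> $ i\<bar> \<le> 1" for i by (simp add: \<beta>_def sgn_if)
          then have "[:Poly_Mapping.single \<beta> 1:] \<in> ore_filt 1"
            using ore_filt_monom[of \<beta> 0 1 1] by (simp add: ore_exponents_def monom_0)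
          from step[OF this q] show ?thesis by (simp add: ore_mult_const smult_monom mult_single)
        qed
      qed (auto intro: sub simp del: alg_filt.simps)
    qed
  qed
  then show ?thesis by (rule that)
qed

lemma alg_generating_set_exists: "\<exists>S. alg_generating_set ore_ring emb S"
proof -
  define S :: "('k, 'n) laurent poly set" where
    "S = {1, [:0, 1:]} \<union> range (\<lambda>i. [:Poly_Mapping.single (axis i 1) 1:]) \<union> range (\<lambda>i. [:Poly_Mapping.single (- axis i 1) 1:])"
  define H where "H = generate_ring ore_ring (range emb \<union> S)"
  have add: "p + q \<in> H" if "p \<in> H" "q \<in> H" for p q
    using generate_ring.eng_add[of p ore_ring _ q] that by (simp add: H_def ore_ring_simps)
  have mult: "ore_mult \<delta> p q \<in> H" if "p \<in> H" "q \<in> H" for p q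
    using generate_ring.eng_mult[of p ore_ring _ q] that by (simp add: H_def ore_ring_simps)
  have incl: "p \<in> H" if "p \<in> range emb \<union> S" for p
    unfolding H_def using that by (rule generate_ring.incl)
  have 1: "1 \<in> H" by (rule incl) (simp add: S_def)
  have single1: "[:Poly_Mapping.single \<alpha> 1:] \<in> H" for \<alpha>
  proof (induction \<alpha> rule: lattice_closed_induct)
    case 1
    then show ?case using \<open>1 \<in> H\<close> by (simp add: one_pCons)
  next
    case (2 \<alpha> \<beta>)
    from mult[OF this] show ?case by (simp add: ore_mult_const mult_single)
  qed (auto intro!: incl simp: S_def)
  have single: "[:Poly_Mapping.single \<alpha> a:] \<in> H" for \<alpha> a
    using mult[OF incl single1, of "emb a" \<alpha>] by (simp add: ore_mult_const lconst_def mult_single)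
  have Xpow: "(X ^^ j) 1 \<in> H" for j
  proof (induction j)
    case (Suc j)
    have "[:0, 1:] \<in> H" by (rule incl) (simp add: S_def)
    from mult[OF this Suc] show ?case by (simp flip: X_eq_mult)
  qed (simp add: 1)
  have "p \<in> H" for p
  proof -
    obtain m where "p \<in> ore_filt m" using ex_ore_filt by blast
    then show ?thesis
    proof (rule ore_filt_induct)
      have "emb 0 \<in> H" by (rule incl) simp
      then show "0 \<in> H" by (simp add: lconst_def)
      show "Polynomial.monom (Poly_Mapping.single \<alpha> a) j \<in> H" for \<alpha> j a
        using mult[OF single Xpow, of \<alpha> a j] by (simp add: ore_mult_const_x_pow)
    qed (rule add)
  qed
  then have "alg_generating_set ore_ring emb S"
    unfolding alg_generating_set_def H_def by (auto simp: ore_ring_simps S_def)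
  then show ?thesis ..
qed

end

section \<open>Dimension counts\<close>

lemma (in vector_space) independent_family:
  assumes fin: "finite A" and zero: "\<And>c. (\<Sum>i\<in>A. scale (c i) (b i)) = 0 \<Longrightarrow> \<forall>i\<in>A. c i = 0"
  shows "inj_on b A" "independent (b ` A)"
proof -
  show inj: "inj_on b A"
  proof (rule inj_onI, rule ccontr)
    fix i j assume ij: "i \<in> A" "j \<in> A" "b i = b j" "i \<noteq> j"
    define c where "c l = (if l = i then 1 else if l = j then - 1 else 0 :: 'a)" for l
    have "(\<Sum>l\<in>A. scale (c l) (b l)) = (\<Sum>l\<in>{i, j}. scale (c l) (b l))"
      by (rule sum.mono_neutral_right) (use fin ij in \<open>auto simp: c_def\<close>)
    also have "\<dots> = 0" using ij by (simp add: c_def)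
    finally have "c i = 0" using zero ij(1) by blast
    then show False by (simp add: c_def)
  qed
  show "independent (b ` A)"
  proof (rule independent_if_scalars_zero)
    fix f x assume 0: "(\<Sum>x\<in>b ` A. scale (f x) x) = 0" and x: "x \<in> b ` A"
    have "(\<Sum>i\<in>A. scale (f (b i)) (b i)) = 0" using 0 inj by (simp add: sum.reindex)
    from zero[OF this] x show "f x = 0" by blast
  qed (use fin in simp)
qed

lemma (in vector_space) card_le_dim_of_independent:
  assumes "B \<subseteq> V" "independent B" "V \<subseteq> span F" "finite F"
  shows "card B \<le> dim V"
proof -
  obtain C where C: "C \<subseteq> V" "independent C" "V \<subseteq> span C" "card C = dim V"
    using basis_exists[of V] .
  have "finite C" using independent_span_bound[OF assms(4) C(2)] C(1) assms(3) by blast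
  from independent_span_bound[OF this assms(2)] show ?thesis using assms(1) C by auto
qed

text \<open>The constants in the bounds vanish in the limit since \<open>log\<^sub>m b = ln b / ln m\<close> tends to \<open>0\<close>.\<close>

lemma growth_exponent:
  fixes D :: "nat \<Rightarrow> nat"
  assumes "0 < a" "0 < b"
    and lower: "\<And>m. N \<le> m \<Longrightarrow> a * real m ^ d \<le> real (D m)"
    and upper: "\<And>m. N \<le> m \<Longrightarrow> real (D m) \<le> b * real m ^ d"
  shows "limsup (\<lambda>m. ereal (log (real m) (real (D m)))) = ereal (real d)"
proof -
  have lim: "(\<lambda>m. real d + ln c / ln (real m)) \<longlonglongrightarrow> real d" for c :: real
  proof -
    have "filterlim (\<lambda>m. ln (real m)) at_infinity sequentially"
      by (intro filterlim_at_top_imp_at_infinity filterlim_compose[OF ln_at_top filterlim_real_sequentially])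
    from tendsto_add[OF tendsto_const tendsto_divide_0[OF tendsto_const this]] show ?thesis by simp
  qed
  have log: "log (real m) (c * real m ^ d) = real d + ln c / ln (real m)" if "0 < c" "2 \<le> m" for c m
    using that by (simp add: log_def ln_mult ln_realpow add_divide_distrib)
  have ev: "eventually (\<lambda>m. m \<ge> max 2 N) sequentially" by (rule eventually_ge_at_top)
  have "(\<lambda>m. log (real m) (real (D m))) \<longlonglongrightarrow> real d"
  proof (rule tendsto_sandwich[OF _ _ lim[of a] lim[of b]])
    show "eventually (\<lambda>m. real d + ln a / ln (real m) \<le> log (real m) (real (D m))) sequentially"
      using ev
    proof eventually_elim
      case (elim m)
      then have "log (real m) (a * real m ^ d) \<le> log (real m) (real (D m))"
        using lower[of m] \<open>0 < a\<close> by (intro log_mono) auto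
      then show ?case using elim log[OF \<open>0 < a\<close>, of m] by simp
    qed
    show "eventually (\<lambda>m. log (real m) (real (D m)) \<le> real d + ln b / ln (real m)) sequentially"
      using ev
    proof eventually_elim
      case (elim m)
      have "0 < a * real m ^ d" using elim \<open>0 < a\<close> by simp
      then have "0 < real (D m)" using lower[of m] elim by linarith
      then have "log (real m) (real (D m)) \<le> log (real m) (b * real m ^ d)"
        using upper[of m] elim by (intro log_mono) auto
      then show ?case using elim log[OF \<open>0 < b\<close>, of m] by simp
    qed
  qed
  then have "(\<lambda>m. ereal (log (real m) (real (D m)))) \<longlonglongrightarrow> ereal (real d)" by (rule tendsto_ereal)
  then show ?thesis by (intro lim_imp_Limsup) auto
qed

context simple_laurent_ore_module begin

abbreviation "kscale \<equiv> module_scale emb act"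

lemma kscale_act: "kscale c (act v p) = act v (Polynomial.smult (lconst c) p)"
  by (simp add: module_scale_def ore_mult_scalar flip: act_ore_mult)

lemma act_kscale: "act (kscale c v) p = kscale c (act v p)"
  by (simp add: module_scale_def ore_mult_scalar ore_mult_const flip: act_ore_mult)

sublocale vs: vector_space kscale
proof
  fix a b x y
  show "kscale a (x + y) = kscale a x + kscale a y" by (simp add: module_scale_def act_add_left)
  show "kscale (a + b) x = kscale a x + kscale b x"
    by (simp add: module_scale_def lconst_def single_add kact_add)
  show "kscale a (kscale b x) = kscale (a * b) x"
    by (simp add: module_scale_def lconst_mult mult.commute flip: kact_mult)
  show "kscale 1 x = x" by (simp add: module_scale_def lconst_1 act_one)
qed

lemma subspace_act: "scalar_subspace V \<Longrightarrow> vs.subspace (act w ` V)"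
  unfolding vs.subspace_def
proof (intro conjI ballI allI)
  assume V: "scalar_subspace V"
  show "0 \<in> act w ` V" using scalar_subspaceD(1)[OF V] by (metis act_zero_right imageI)
  show "u + v \<in> act w ` V" if "u \<in> act w ` V" "v \<in> act w ` V" for u v
    using that scalar_subspaceD(2)[OF V] by (auto simp flip: act_add_right)
  show "kscale c u \<in> act w ` V" if "u \<in> act w ` V" for u c
    using that scalar_subspaceD(3)[OF V] by (auto simp: kscale_act)
qed

text \<open>For a generating set \<open>S\<close> of the algebra and a generating space \<open>M0\<close> of the module, the space
  \<open>M0 A\<^sub>m\<close> lies between two spaces \<open>w R\<^sub>t\<close> whose indices \<open>t\<close> depend linearly on \<open>m\<close>.  The upper one is
  found by expressing the generators through \<open>w\<close>, the lower one by expressing \<open>w\<close> through a nonzero element of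
  \<open>M0\<close>.\<close>

lemma has_GK_dimI:
  assumes w: "w \<noteq> 0"
    and upper: "\<And>m. \<exists>F. finite F \<and> card F \<le> C * (m + 1) ^ d \<and> act w ` ore_filt m \<subseteq> vs.span F"
    and lower: "\<And>m. \<exists>B. B \<subseteq> act w ` ore_filt m \<and> vs.independent B \<and> (m + 1) ^ d \<le> card B"
  shows "has_GK_dim ore_ring emb act (ereal (real d))"
  unfolding has_GK_dim_def
proof (intro conjI allI impI)
  show "\<exists>S. alg_generating_set ore_ring emb S" by (rule alg_generating_set_exists)
  show "\<exists>M0. generating_subspace ore_ring emb act M0"
  proof
    have "u \<in> module_prod emb act (vs.span {w}) UNIV" for u
    proof -
      obtain p where "u = act w p" using cyclic[OF w] .
      then show ?thesis unfolding module_prod_def by (intro vs.span_base) (auto intro: vs.span_base)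
    qed
    then show "generating_subspace ore_ring emb act (vs.span {w})"
      unfolding generating_subspace_def ore_ring_simps by blast
  qed
next
  fix S M0 assume "alg_generating_set ore_ring emb S \<and> generating_subspace ore_ring emb act M0"
  then have S: "alg_generating_set ore_ring emb S" and M0: "generating_subspace ore_ring emb act M0" by auto
  have S1: "1 \<in> S" and "finite S" using S by (auto simp: alg_generating_set_def ore_ring_simps)
  define P where "P m = module_prod emb act M0 (filt S m)" for m
  obtain c where c: "\<And>m. filt S m \<subseteq> ore_filt (c * m)" 
    by (rule filt_le_ore_filt[OF \<open>finite S\<close>]) (rule that)
  obtain c' where c': "\<And>m. ore_filt m \<subseteq> filt S (c' * m)" 
    by (rule ore_filt_le_filt[OF S]) (rule that)
  obtain B0 where B0: "finite B0" "M0 = vs.span B0" and gen: "module_prod emb act M0 UNIV = UNIV"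
    using M0 unfolding generating_subspace_def ore_ring_simps by blast
  obtain e where e: "M0 \<subseteq> act w ` ore_filt e"
  proof -
    have "\<exists>p. u = act w p" for u using cyclic[OF w] by metis
    then obtain q where q: "\<And>u. u = act w (q u)" by metis
    obtain e where "q ` B0 \<subseteq> ore_filt e" using finite_subset_ore_filt[of "q ` B0"] B0(1) by blast
    then have "B0 \<subseteq> act w ` ore_filt e" using q by blast
    then have "M0 \<subseteq> act w ` ore_filt e"
      unfolding B0(2) by (intro vs.span_minimal subspace_act scalar_subspace_ore_filt)
    then show ?thesis by (rule that)
  qed
  have P_le: "P m \<subseteq> act w ` ore_filt (e + c * m)" for m
    unfolding P_def module_prod_def
  proof (intro vs.span_minimal subspace_act scalar_subspace_ore_filt)
    show "{act v b |v b. v \<in> M0 \<and> b \<in> filt S m} \<subseteq> act w ` ore_filt (e + c * m)"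
    proof clarify
      fix v b assume "v \<in> M0" "b \<in> filt S m"
      then obtain p where "v = act w p" "p \<in> ore_filt e" "b \<in> ore_filt (c * m)" using e c by blast
      then show "act v b \<in> act w ` ore_filt (e + c * m)"
        by (auto intro!: ore_filt_mult simp flip: act_ore_mult)
    qed
  qed
  have fin_span: "\<exists>F. finite F \<and> card F \<le> C * (e + c * m + 1) ^ d \<and> P m \<subseteq> vs.span F" for m
    using upper[of "e + c * m"] P_le[of m] by (meson order_trans)
  obtain u where u: "u \<in> M0" "u \<noteq> 0"
  proof -
    have "\<not> M0 \<subseteq> {0}"
    proof
      assume "M0 \<subseteq> {0}"
      then have "{act v b |v b. v \<in> M0 \<and> b \<in> UNIV} \<subseteq> {0}" by auto
      then have "module_prod emb act M0 UNIV \<subseteq> {0}"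
        unfolding module_prod_def by (intro vs.span_minimal vs.subspace_0) simp_all
      then show False using gen w by blast
    qed
    then show ?thesis using that by blast
  qed
  obtain r where r: "w = act u r" using cyclic[OF u(2)] .
  obtain e' where e': "r \<in> ore_filt e'" using ex_ore_filt by blast
  \<comment> \<open>The successor keeps the factor positive, as it will be divided by.\<close>
  define K where "K = Suc c'"
  have K: "0 < K" by (simp add: K_def)
  have P_ge: "act w ` ore_filt t \<subseteq> P m" if "K * (e' + t) \<le> m" for t m
  proof
    fix v assume "v \<in> act w ` ore_filt t"
    then obtain p where p: "p \<in> ore_filt t" "v = act u (ore_mult \<delta> r p)" by (auto simp: act_ore_mult r)
    have "c' * (e' + t) \<le> m" using that by (simp add: K_def)
    then have "ore_mult \<delta> r p \<in> filt S m"
      using ore_filt_mult[OF e' p(1)] c' filt_mono[OF S1] by blast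
    then show "v \<in> P m" unfolding P_def module_prod_def p(2) using u(1) by (intro vs.span_base) blast
  qed
  have lower': "(1 / (2 * real K)) ^ d * real m ^ d \<le> real (vs.dim (P m))" if m: "2 * K * (e' + 1) \<le> m" for m
  proof -
    \<comment> \<open>The largest index with \<open>K * (e' + t) \<le> m\<close>.\<close>
    define t where "t = m div K - e'"
    have m': "2 * (K * e') + 2 * K \<le> m" using m by (simp add: distrib_left mult.assoc)
    then have "e' * K \<le> m" by (simp add: mult.commute)
    then have "e' \<le> m div K" using K by (simp add: less_eq_div_iff_mult_less_eq)
    then have t: "e' + t = m div K" by (simp add: t_def)
    have "K * (e' + t) \<le> m" unfolding t by (rule times_div_less_eq_dividend)
    note sub = P_ge[OF this]
    from lower[of t] obtain B where B: "B \<subseteq> act w ` ore_filt t" "vs.independent B" "(t + 1) ^ d \<le> card B"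
      by blast
    from fin_span[of m] obtain F where F: "finite F" "P m \<subseteq> vs.span F" by blast
    from vs.card_le_dim_of_independent[OF order_trans[OF B(1) sub] B(2) F(2,1)] B(3)
    have "(t + 1) ^ d \<le> vs.dim (P m)" by (rule order_trans[rotated])
    then have "real ((t + 1) ^ d) \<le> real (vs.dim (P m))" by (rule of_nat_mono)
    then have "real (t + 1) ^ d \<le> real (vs.dim (P m))" by (simp only: of_nat_power)
    moreover have "1 / (2 * real K) * real m \<le> real (t + 1)"
    proof -
      have "m < K * (m div K + 1)"
        using dividend_less_times_div[OF K, of m] by simp
      then have "m < K * e' + K * t + K" unfolding t[symmetric] by (simp add: distrib_left)
      with m' have "m \<le> 2 * (K * t) + 2 * K" by linarith
      also have "\<dots> = (2 * K) * (t + 1)" by simp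
      finally have "real m \<le> real ((2 * K) * (t + 1))" by (rule of_nat_mono)
      also have "\<dots> = (2 * real K) * real (t + 1)" by (simp only: of_nat_mult of_nat_numeral)
      finally have "real m / (2 * real K) \<le> real (t + 1)"
        using K by (subst pos_divide_le_eq) (simp_all add: mult.commute)
      then show ?thesis by simp
    qed
    then have "(1 / (2 * real K) * real m) ^ d \<le> real (t + 1) ^ d" by (intro power_mono) simp_all
    ultimately have "(1 / (2 * real K) * real m) ^ d \<le> real (vs.dim (P m))" by linarith
    then show ?thesis unfolding power_mult_distrib .
  qed
  have upper': "real (vs.dim (P m)) \<le> (real C * real (e + c + 1) ^ d + 1) * real m ^ d" if m: "1 \<le> m" for m
  proof -
    obtain F where F: "finite F" "card F \<le> C * (e + c * m + 1) ^ d" "P m \<subseteq> vs.span F" using fin_span[of m] by blast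
    have "vs.dim (P m) \<le> C * (e + c * m + 1) ^ d" 
      using vs.dim_le_card[OF F(3,1)] F(2) by (rule order_trans)
    also have "\<dots> \<le> C * ((e + c + 1) * m) ^ d"
    proof -
      have "e * 1 \<le> e * m" using m by (rule mult_le_mono2)
      then have "e + c * m + 1 \<le> (e + c + 1) * m" using m unfolding add_mult_distrib by linarith
      then have "(e + c * m + 1) ^ d \<le> ((e + c + 1) * m) ^ d" by (rule power_mono) (rule le0)
      then show ?thesis by (rule mult_le_mono2)
    qed
    finally have "real (vs.dim (P m)) \<le> real (C * ((e + c + 1) * m) ^ d)" by (rule of_nat_mono)
    also have "\<dots> = real C * real (e + c + 1) ^ d * real m ^ d"
      by (simp only: of_nat_mult of_nat_power power_mult_distrib mult.assoc)
    also have "\<dots> \<le> (real C * real (e + c + 1) ^ d + 1) * real m ^ d"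
      by (rule mult_right_mono) simp_all
    finally show ?thesis .
  qed
  show "module_growth ore_ring emb act S M0 = ereal (real d)"
    unfolding module_growth_def P_def[symmetric]
  proof (rule growth_exponent[where N = "2 * K * (e' + 1)"])
    show "0 < (1 / (2 * real K)) ^ d" using K by simp
    show "0 < real C * real (e + c + 1) ^ d + 1" by (simp add: add_nonneg_pos)
  next
    fix m assume m: "2 * K * (e' + 1) \<le> m"
    show "(1 / (2 * real K)) ^ d * real m ^ d \<le> real (vs.dim (P m))" by (rule lower'[OF m])
    have "1 * 1 * 1 \<le> 2 * K * (e' + 1)" using K by (intro mult_le_mono) simp_all
    then have "1 \<le> m" using m by linarith
    then show "real (vs.dim (P m)) \<le> (real C * real (e + c + 1) ^ d + 1) * real m ^ d" by (rule upper')
  qed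
qed

section \<open>Growth of simple modules\<close>

lemma kscale_single: "v \<star> Poly_Mapping.single \<alpha> c = kscale c (v \<star> Poly_Mapping.single \<alpha> 1)"
  by (simp add: module_scale_def lconst_def mult_single flip: kact_mult)

text \<open>Here \<open>w K\<close> is finite-dimensional, so that \<open>w R\<^sub>m\<close>, contained in the sum of its translates by \<open>x\<^sup>j\<close> for \<open>j \<le> m\<close>, has dimension
  \<open>O(m)\<close>; the vectors \<open>w x\<^sup>j\<close> are independent.\<close>

lemma GK_dim_1:
  assumes min: "minimal_family {} w I e" and van: "\<And>p j. act w p = 0 \<Longrightarrow> w \<star> poly.coeff p j = 0"
  shows "has_GK_dim ore_ring emb act 1"
proof -
  have w: "w \<noteq> 0" and I: "finite I" and cover: "\<And>f. w \<star> f \<in> tspan_on {} I e"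
    using min unfolding minimal_family_def spanning_family_def by blast+
  have wK: "w \<star> f \<in> vs.span (e ` I)" for f
  proof -
    obtain h where h: "h \<in> vars_subring {}" "h \<noteq> 0" "w \<star> f \<star> h \<in> span_on {} I e"
      using cover by (rule tspan_onE)
    obtain c where c: "h = lconst c" using h(1) by (rule vars_subring_empty)
    have "c \<noteq> 0"
    proof
      assume "c = 0"
      with c h(2) show False by (simp add: lconst_def)
    qed
    have "w \<star> f \<star> h \<in> vs.span (e ` I)"
      using h(3)
    proof (rule span_onE)
      fix a assume a: "\<And>i. a i \<in> vars_subring {}" and eq: "w \<star> f \<star> h = lin_comb I e a"
      have "e i \<star> a i \<in> vs.span (e ` I)" if "i \<in> I" for i
      proof -
        obtain b where b: "a i = lconst b" using a by (rule vars_subring_empty)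
        have "e i \<in> vs.span (e ` I)" by (rule vs.span_base) (rule imageI[OF that])
        then have "kscale b (e i) \<in> vs.span (e ` I)" by (rule vs.span_scale)
        then show ?thesis by (simp only: b module_scale_def)
      qed
      then show ?thesis unfolding eq lin_comb_def by (intro vs.span_sum)
    qed
    then have "kscale (inverse c) (w \<star> f \<star> h) \<in> vs.span (e ` I)" by (rule vs.span_scale)
    moreover have "kscale (inverse c) (kscale c (w \<star> f)) = w \<star> f"
      unfolding vs.scale_scale left_inverse[OF \<open>c \<noteq> 0\<close>] by (rule vs.scale_one)
    moreover have "w \<star> f \<star> h = kscale c (w \<star> f)" unfolding c module_scale_def ..
    ultimately show ?thesis by metis
  qed
  have "has_GK_dim ore_ring emb act (ereal (real 1))"
  proof (rule has_GK_dimI[OF w, where C = "card I" and d = 1])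
    fix m
    define F where "F = (\<lambda>(i, j). (xact ^^ j) (e i)) ` (I \<times> {..m})"
    have "card F \<le> card (I \<times> {..m})" unfolding F_def using I by (intro card_image_le) auto
    then have "card F \<le> card I * (m + 1) ^ 1" by (simp add: card_cartesian_product)
    moreover have "finite F" using I by (simp add: F_def)
    moreover have "act w ` ore_filt m \<subseteq> vs.span F"
    proof clarify
      fix p :: "('k, 'n) laurent poly" assume p: "p \<in> ore_filt m"
      have xpow: "(xact ^^ j) u \<in> vs.span F" if u: "u \<in> vs.span (e ` I)" and j: "j \<le> m" for u j
      proof -
        have x: "(xact ^^ j) v = act v ((X ^^ j) 1)" for v by (simp add: act_Xpow act_one)
        show ?thesis
          using u
        proof (induction rule: vs.span_induct_alt)
          case base
          then show ?case by (simp add: vs.span_zero)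
        next
          case (step c v y)
          have "(xact ^^ j) v \<in> F" using step(1) j by (auto simp: F_def)
          then have "kscale c ((xact ^^ j) v) \<in> vs.span F" by (intro vs.span_scale vs.span_base)
          from vs.span_add[OF this step(2)] show ?case unfolding x act_add_left act_kscale .
        qed
      qed
      have "(xact ^^ j) (w \<star> poly.coeff p j) \<in> vs.span F" for j
      proof (cases "poly.coeff p j = 0")
        case True
        then show ?thesis by (simp add: vs.span_zero)
      next
        case False
        then obtain \<alpha> where "Poly_Mapping.lookup (poly.coeff p j) \<alpha> \<noteq> 0"
          by (metis lookup_zero poly_mapping_eqI)
        from ore_filtD[OF p this, of undefined] have "j \<le> m" by linarith
        then show ?thesis by (intro xpow wK)
      qed
      then show "act w p \<in> vs.span F" by (subst act_expand) (rule vs.span_sum)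
    qed
    ultimately show "\<exists>F. finite F \<and> card F \<le> card I * (m + 1) ^ 1 \<and> act w ` ore_filt m \<subseteq> vs.span F"
      by blast
  next
    fix m
    define b where "b j = act w (Polynomial.monom 1 j)" for j
    have indep: "\<forall>j\<in>{..m}. c j = 0" if 0: "(\<Sum>j\<in>{..m}. kscale (c j) (b j)) = 0" for c
    proof
      fix l assume l: "l \<in> {..m}"
      define p :: "('k, 'n) laurent poly" where "p = (\<Sum>j\<in>{..m}. Polynomial.monom (lconst (c j)) j)"
      have "act w p = 0"
        using 0 unfolding p_def b_def act_sum_right by (simp add: kscale_act smult_monom)
      from van[OF this, of l] have "w \<star> lconst (c l) = 0"
        using l by (simp add: p_def coeff_sum)
      then have "kscale (c l) w = 0" by (simp add: module_scale_def)
      then show "c l = 0" using w by simp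
    qed
    have "b ` {..m} \<subseteq> act w ` ore_filt m"
    proof clarify
      fix j assume "j \<le> m"
      then have "Polynomial.monom (Poly_Mapping.single 0 1) j \<in> (ore_filt m :: ('k, 'n) laurent poly set)"
        by (intro ore_filt_monom) (simp add: ore_exponents_def)
      then show "b j \<in> act w ` ore_filt m" by (simp add: b_def)
    qed
    moreover have "vs.independent (b ` {..m})" "inj_on b {..m}"
      using vs.independent_family[OF _ indep] by auto
    moreover from this(2) have "(m + 1) ^ 1 \<le> card (b ` {..m})" by (simp add: card_image)
    ultimately show "\<exists>B. B \<subseteq> act w ` ore_filt m \<and> vs.independent B \<and> (m + 1) ^ 1 \<le> card B"
      by blast
  qed
  then show ?thesis by (simp add: one_ereal_def)
qed

text \<open>Either \<open>x\<close> annihilates \<open>w\<close>, or \<open>w x\<close> generates \<open>M\<close>, so that \<open>w = w x p\<close> for some \<open>p\<close>; then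
  \<open>1 - x p\<close> annihilates \<open>w\<close>, and it is nonzero because \<open>x\<close> is not a unit.\<close>

lemma annihilator_nonzero: "\<exists>f. f \<noteq> 0 \<and> act w f = 0"
proof (cases "xact w = 0")
  case True
  have "([:0, 1:] :: ('k, 'n) laurent poly) \<noteq> 0" by simp
  with True show ?thesis unfolding xact_def by blast
next
  case False
  obtain p where p: "w = act (xact w) p" using cyclic[OF False] .
  have "act w (1 - X p) = 0" unfolding act_diff_right act_X act_one p[symmetric] by (rule diff_self)
  moreover have "1 - X p \<noteq> 0"
  proof
    assume "1 - X p = 0"
    then have Xp: "X p = 1" by (metis right_minus_eq)
    then have "p \<noteq> 0" by force
    have "poly.coeff (X p) (Suc (degree p)) = lead_coeff p"
      using lead_coeff_Xpow[of 1 p] by simp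
    then show False using Xp \<open>p \<noteq> 0\<close> by simp
  qed
  ultimately show ?thesis by blast
qed

definition mon :: "(int, 'n) vec \<times> nat \<Rightarrow> ('k, 'n) laurent poly" where
  "mon x = Polynomial.monom (Poly_Mapping.single (fst x) 1) (snd x)"

abbreviation "pscale \<equiv> \<lambda>c. Polynomial.smult (lconst c :: ('k, 'n) laurent)"

interpretation ps: vector_space pscale
  by standard (simp_all add: smult_add_right lconst_def single_add smult_add_left mult_single)

lemma mon_independent:
  assumes "finite E" "(\<Sum>x\<in>E. pscale (c x) (mon x)) = 0"
  shows "\<forall>x\<in>E. c x = 0"
proof
  fix x assume x: "x \<in> E"
  obtain \<alpha> j where [simp]: "x = (\<alpha>, j)" by fastforce
  have "0 = Poly_Mapping.lookup (poly.coeff (\<Sum>x\<in>E. pscale (c x) (mon x)) j) \<alpha>" by (simp add: assms(2))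
  also have "\<dots> = (\<Sum>y\<in>E. if y = x then c x else 0)"
    unfolding coeff_sum lookup_sum
    by (intro sum.cong)
      (auto simp: mon_def smult_monom lconst_def mult_single lookup_single when_def split: if_splits)
  also have "\<dots> = c x" using assms(1) x by simp
  finally show "c x = 0" by simp
qed

lemma ore_filt_span: "ore_filt m \<subseteq> ps.span (mon ` ore_exponents m)"
proof
  fix p :: "('k, 'n) laurent poly" assume "p \<in> ore_filt m"
  then show "p \<in> ps.span (mon ` ore_exponents m)"
  proof (rule ore_filt_induct)
    fix \<alpha> :: "(int, 'n) vec" and j c assume "(\<alpha>, j) \<in> ore_exponents m"
    then have "pscale c (mon (\<alpha>, j)) \<in> ps.span (mon ` ore_exponents m)"
      by (intro ps.span_scale ps.span_base) simp
    then show "Polynomial.monom (Poly_Mapping.single \<alpha> c) j \<in> ps.span (mon ` ore_exponents m)"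
      by (simp add: mon_def smult_monom lconst_def mult_single)
  qed (auto intro: ps.span_add ps.span_zero)
qed

text \<open>A basis of \<open>f R\<^sub>m\<close>, which has as many elements as one of \<open>R\<^sub>m\<close>, extends to a basis of \<open>R\<^sub>m\<^sub>+\<^sub>d\<close>.  It is
  annihilated by \<open>w\<close>, so that the images of the added basis vectors span \<open>w R\<^sub>m\<^sub>+\<^sub>d\<close>.\<close>

lemma growth_upper_bound:
  assumes f: "f \<noteq> 0" "act w f = 0" "f \<in> ore_filt d"
  shows "\<exists>F. finite F \<and> card F \<le> d * (2 * (m + d) + 1) ^ CARD('n) \<and> act w ` ore_filt m \<subseteq> vs.span F"
proof -
  let ?E = "ore_exponents :: nat \<Rightarrow> ((int, 'n) vec \<times> nat) set"
  define b where "b x = ore_mult \<delta> f (mon x)" for x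
  have "\<forall>x\<in>?E m. c x = 0" if 0: "(\<Sum>x\<in>?E m. pscale (c x) (b x)) = 0" for c
  proof -
    have "(\<Sum>x\<in>A. pscale (c x) (b x)) = ore_mult \<delta> f (\<Sum>x\<in>A. pscale (c x) (mon x))" for A
      by (induction A rule: infinite_finite_induct)
        (simp_all add: b_def ore_mult_add_right ore_mult_smult_right)
    with 0 have "ore_mult \<delta> f (\<Sum>x\<in>?E m. pscale (c x) (mon x)) = 0" by simp
    then have "(\<Sum>x\<in>?E m. pscale (c x) (mon x)) = 0" using ore_mult_nonzero(1)[OF f(1)] by blast
    then show ?thesis by (rule mon_independent[OF finite_ore_exponents])
  qed
  note b = ps.independent_family[OF finite_ore_exponents this]
  have mon_filt: "mon x \<in> ore_filt l" if "x \<in> ?E l" for x l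
    using that unfolding mon_def by (intro ore_filt_monom) simp
  have "b ` ?E m \<subseteq> ore_filt (m + d)"
  proof clarify
    fix \<alpha> j assume "(\<alpha>, j) \<in> ?E m"
    from ore_filt_mult[OF f(3) mon_filt[OF this]] show "b (\<alpha>, j) \<in> ore_filt (m + d)"
      by (simp add: b_def add.commute)
  qed
  from ps.maximal_independent_subset_extend[OF this b(2)] obtain B where
    B: "b ` ?E m \<subseteq> B" "B \<subseteq> ore_filt (m + d)" "ps.independent B" "ore_filt (m + d) \<subseteq> ps.span B" .
  have "B \<subseteq> ps.span (mon ` ?E (m + d))" using B(2) ore_filt_span by blast
  from ps.independent_span_bound[OF _ B(3) this]
  have finB: "finite B" and "card B \<le> card (mon ` ?E (m + d))" by auto
  then have cardB: "card B \<le> card (?E (m + d))" using card_image_le[OF finite_ore_exponents, of mon "m + d"] by linarith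
  define F where "F = act w ` (B - b ` ?E m)"
  have finF: "finite F" using finB by (simp add: F_def)
  have "card F \<le> card (B - b ` ?E m)" unfolding F_def using finB by (intro card_image_le) simp
  also have "\<dots> = card B - card (?E m)"
    using finB B(1) b(1) by (simp add: card_Diff_subset finite_subset card_image)
  also have "\<dots> \<le> d * (2 * (m + d) + 1) ^ CARD('n)"
    using cardB card_ore_exponents_diff[of "m + d" d, where 'n = 'n] by simp
  finally have "card F \<le> d * (2 * (m + d) + 1) ^ CARD('n)" .
  moreover have "act w ` ore_filt m \<subseteq> vs.span F"
  proof clarify
    fix p :: "('k, 'n) laurent poly" assume "p \<in> ore_filt m"
    then have "p \<in> ps.span B" using B(4) ore_filt_mono[of m "m + d"] by auto
    then show "act w p \<in> vs.span F"
    proof (induction rule: ps.span_induct_alt)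
      case base
      then show ?case by (simp add: vs.span_zero)
    next
      case (step c q r)
      have "act w q \<in> vs.span F"
      proof (cases "q \<in> b ` ?E m")
        case True
        then have "act w q = 0" by (auto simp: b_def act_ore_mult f(2))
        then show ?thesis by (simp add: vs.span_zero)
      next
        case False
        then show ?thesis using step(1) by (intro vs.span_base) (simp add: F_def)
      qed
      then show ?case
        unfolding act_add_right kscale_act[symmetric] using step(2) by (intro vs.span_add vs.span_scale)
    qed
  qed
  ultimately show ?thesis using finF by blast
qed

text \<open>Torsion-freeness makes the \<open>w x\<^sup>\<alpha>\<close> independent, which bounds the growth from below.\<close>

lemma GK_dim_n:
  assumes tf: "torsion_free UNIV"
  shows "has_GK_dim ore_ring emb act (ereal (real CARD('n)))"
proof -
  obtain w :: 'm where w: "w \<noteq> 0" using nonzero_exists by blast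
  obtain f where f: "f \<noteq> 0" "act w f = 0" using annihilator_nonzero by blast
  obtain d where d: "f \<in> ore_filt d" using ex_ore_filt by blast
  show ?thesis
  proof (rule has_GK_dimI[OF w, where C = "d * (2 * d + 2) ^ CARD('n)"])
    fix m
    obtain F where F: "finite F" "card F \<le> d * (2 * (m + d) + 1) ^ CARD('n)" "act w ` ore_filt m \<subseteq> vs.span F"
      using growth_upper_bound[OF f d] by blast
    have "2 * (m + d) + 1 \<le> (2 * d + 2) * (m + 1)" by (simp add: algebra_simps)
    then have "d * (2 * (m + d) + 1) ^ CARD('n) \<le> d * ((2 * d + 2) * (m + 1)) ^ CARD('n)"
      by (intro mult_le_mono2 power_mono) auto
    also have "\<dots> = d * (2 * d + 2) ^ CARD('n) * (m + 1) ^ CARD('n)"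
      by (simp only: power_mult_distrib mult.assoc)
    finally have "card F \<le> d * (2 * d + 2) ^ CARD('n) * (m + 1) ^ CARD('n)" using F(2) by (rule order_trans[rotated])
    with F show "\<exists>F. finite F \<and> card F \<le> d * (2 * d + 2) ^ CARD('n) * (m + 1) ^ CARD('n) \<and>
        act w ` ore_filt m \<subseteq> vs.span F" by blast
  next
    fix m
    let ?E = "exponent_box m :: (int, 'n) vec set"
    define b where "b \<alpha> = w \<star> Poly_Mapping.single \<alpha> 1" for \<alpha> :: "(int, 'n) vec"
    have "\<forall>\<alpha>\<in>?E. c \<alpha> = 0" if 0: "(\<Sum>\<alpha>\<in>?E. kscale (c \<alpha>) (b \<alpha>)) = 0" for c
    proof
      fix \<beta> assume \<beta>: "\<beta> \<in> ?E"
      have "w \<star> (\<Sum>\<alpha>\<in>?E. Poly_Mapping.single \<alpha> (c \<alpha>)) = 0"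
        using 0 by (simp only: kact_sum b_def kscale_single[symmetric])
      then have "(\<Sum>\<alpha>\<in>?E. Poly_Mapping.single \<alpha> (c \<alpha>)) = 0"
        using torsion_freeD[OF tf vars_subring_UNIV] w by blast
      then have "0 = Poly_Mapping.lookup (\<Sum>\<alpha>\<in>?E. Poly_Mapping.single \<alpha> (c \<alpha>)) \<beta>" by simp
      also have "\<dots> = c \<beta>" using \<beta> by (simp add: lookup_sum lookup_single when_def)
      finally show "c \<beta> = 0" by simp
    qed
    note b = vs.independent_family[OF finite_exponent_box this]
    have "b ` ?E \<subseteq> act w ` ore_filt m"
    proof clarify
      fix \<alpha> assume "\<alpha> \<in> ?E"
      then have "Polynomial.monom (Poly_Mapping.single \<alpha> 1) 0 \<in> (ore_filt m :: ('k, 'n) laurent poly set)"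
        by (intro ore_filt_monom) (simp add: ore_exponents_def exponent_box_def)
      then show "b \<alpha> \<in> act w ` ore_filt m" by (simp add: b_def monom_0)
    qed
    moreover have "(m + 1) ^ CARD('n) \<le> card (b ` ?E)"
      using b(1) by (simp add: card_image card_exponent_box power_mono)
    ultimately show "\<exists>B. B \<subseteq> act w ` ore_filt m \<and> vs.independent B \<and> (m + 1) ^ CARD('n) \<le> card B"
      using b(2) by blast
  qed
qed

end

theorem theoremA:
  fixes g :: "'n::finite \<Rightarrow> ('k::field, 'n) laurent"
    and \<delta> :: "('k, 'n) laurent \<Rightarrow> ('k, 'n) laurent"
    and act :: "'m::ab_group_add \<Rightarrow> ('k, 'n) laurent poly \<Rightarrow> 'm"
  assumes g: "\<And>i. \<exists>a b. g i = lconst a * lvar i + lconst b"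
    and \<delta>: "\<delta> = (\<lambda>f. \<Sum>i\<in>UNIV. g i * lpartial i f)"
    and simple: "simple_ring (ore_ext \<delta>)"
    and M: "simple_right_module (ore_ext \<delta>) act"
  shows "\<exists>d \<in> {1, ereal (real CARD('n))}. has_GK_dim (ore_ext \<delta>) (\<lambda>c. [:lconst c:]) act d"
proof -
  interpret simple_laurent_ore_module g \<delta> act
    by unfold_locales (use assms in auto)
  show ?thesis
  proof (rule torsion_alternative)
    assume "torsion_free UNIV"
    from GK_dim_n[OF this] show ?thesis by (rule bexI) simp
  next
    fix w I e assume "minimal_family {} w I e" "\<And>p j. act w p = 0 \<Longrightarrow> w \<star> poly.coeff p j = 0"
    then have "has_GK_dim ore_ring emb act 1" by (rule GK_dim_1)
    then show ?thesis by (rule bexI) simp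
  qed
qed

end
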